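(* Let $\mathcal{T}$ be a bi-complete triangulated category with a pre-weight structure $(\mathcal{U}_{\geq0},\mathcal{U}_{\leq0})$ with core $\mathcal{C}$, and let $F\colon\mathcal{T}\rightarrow\mathcal{T}$ be a bi-continuous triangle endofunctor. Assume that the following conditions are fulfilled. (1) The pre-weight structure $(\mathcal{U}_{\geq0},\mathcal{U}_{\leq0})$ is two-sided convergent and has finite dimension. (2) We have $\mathrm{Hom}_{\mathcal{T}}(\mathcal{C},\Sigma^{-n}(\mathcal{C}))=0$ for any $n\geq1$. (3) We have $\mathcal{U}_{\leq0}\subseteq\mathrm{Loc}\langle\mathcal{U}_b\rangle$ and $\mathcal{U}_{\geq0}\subseteq\mathrm{coLoc}\langle\mathcal{U}_b\rangle$. (4) There is a natural isomorphism $\eta_A\colon F(A)\simeq A$ for each object $A\in\mathcal{C}$. (5) The restriction $F|_{\mathcal{U}_b}\colon\mathcal{U}_b\rightarrow\mathcal{T}$ is fully faithful. Then $F$ is isomorphic to a pseudo-identity on $\mathcal{T}$ (with respect to $(\mathcal{U}_{\geq0},\mathcal{U}_{\leq0})$).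
   Context: Let $\Sigma$ be the suspension functor of $\mathcal{T}$. For full subcategories $\mathcal{X},\mathcal{Y}$, $\mathcal{X}\ast\mathcal{Y}$ is the full subcategory of objects $Z$ fitting into an exact triangle $X\to Z\to Y\to\Sigma(X)$ with $X\in\mathcal{X}$, $Y\in\mathcal{Y}$; $\mathcal{X}$ is closed under extensions if $\mathcal{X}\ast\mathcal{X}\subseteq\mathcal{X}$. A pre-weight structure on $\mathcal{T}$ is a pair $(\mathcal{U}_{\geq0},\mathcal{U}_{\leq0})$ of full additive subcategories such that (i) $\mathcal{U}_{\geq0}\ast\Sigma(\mathcal{U}_{\leq0})=\mathcal{T}$; (ii) $\mathcal{U}_{\geq0}$ is closed under $\Sigma^{-1}$ and extensions; (iii) $\mathcal{U}_{\leq0}$ is closed under $\Sigma$ and extensions. Its core is $\mathcal{C}=\mathcal{U}_{\geq0}\cap\mathcal{U}_{\leq0}$. Put $\mathcal{U}_{\geq m}=\Sigma^{-m}(\mathcal{U}_{\geq0})$, $\mathcal{U}_{\leq m}=\Sigma^{-m}(\mathcal{U}_{\leq0})$, $\mathcal{U}_{[m,n]}=\mathcal{U}_{\geq m}\cap\mathcal{U}_{\leq n}$ for $m\le n$, and $\mathcal{U}_b=\bigcup_{m\leq n}\mathcal{U}_{[m,n]}$, a triangulated subcategory of $\mathcal{T}$. The dimension of the pre-weight structure is $\min\{+\infty,\ d\geq-1\mid\mathrm{Hom}_{\mathcal{T}}(\mathcal{U}_{\geq0},\mathcal{U}_{\leq-(d+1)})=0\}$; it is finite if this is not $+\infty$.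 $\mathrm{Hom}_{\mathcal{T}}(\mathcal{X},\mathcal{Y})=0$ means $\mathrm{Hom}_{\mathcal{T}}(X,Y)=0$ for all $X\in\mathcal{X},Y\in\mathcal{Y}$. A left tower of $X\in\mathcal{U}_{\leq0}$ consists of morphisms $\iota_n\colon X_n\to X$ and $\phi_n\colon X_n\to X_{n+1}$ ($n\geq0$) with $X_n\in\mathcal{U}_{[-n,0]}$, the cone of $\iota_n$ in $\mathcal{U}_{\leq-n-1}$, the cone of $\phi_n$ in $\Sigma^{n+1}(\mathcal{C})$, and $\iota_n=\iota_{n+1}\circ\phi_n$. A right tower of $Y\in\mathcal{U}_{\geq0}$ consists of morphisms $\pi_n\colon Y\to Y_n$ and $\psi_n\colon Y_{n+1}\to Y_n$ ($n\geq0$) with $Y_n\in\mathcal{U}_{[0,n]}$, the cone of $\pi_n$ in $\mathcal{U}_{\geq n}$, the cone of $\psi_n$ in $\Sigma^{-n}(\mathcal{C})$, and $\pi_n=\psi_n\circ\pi_{n+1}$. $\mathcal{T}$ is bi-complete if it has arbitrary coproducts and products. The homotopy colimit of $\{\phi_n\}$ is given by an exact triangle $\coprod X_n\xrightarrow{1-\phi}\coprod X_n\xrightarrow{\gamma}\mathrm{hocolim}\,X_n\to\Sigma(\coprod X_n)$ (where $1-\phi$ restricted to $X_n$ is $({\rm Id}_{X_n},-\phi_n)^t\colon X_n\to X_n\oplus X_{n+1}$ followed by the inclusion), and $\gamma_n$ is the restriction of $\gamma$ to $X_n$. The homotopy limit of $\{\psi_n\}$ is given by an exact triangle $\mathrm{holim}\,Y_n\xrightarrow{\sigma}\prod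 Y_n\xrightarrow{1-\psi}\prod Y_n\to\Sigma(\mathrm{holim}\,Y_n)$ (dually, the $n$-th component of $1-\psi$ is the projection to $Y_n\oplus Y_{n+1}$ followed by $({\rm Id}_{Y_n},-\psi_n)$), and $\sigma_n$ is the $n$-th component of $\sigma$. A left tower is convergent if there is an isomorphism $\kappa\colon\mathrm{hocolim}\,X_n\to X$ with $\kappa\circ\gamma_n=\iota_n$ for all $n$; a right tower is convergent if there is an isomorphism $\lambda\colon Y\to\mathrm{holim}\,Y_n$ with $\sigma_n\circ\lambda=\pi_n$ for all $n$. The pre-weight structure is left (resp. right) convergent if each object of $\mathcal{U}_{\leq0}$ (resp. $\mathcal{U}_{\geq0}$) admits a convergent left (resp. right) tower, and two-sided convergent if it is both. $\mathrm{Loc}\langle\mathcal{S}\rangle$ (resp. $\mathrm{coLoc}\langle\mathcal{S}\rangle$) is the smallest triangulated subcategory of $\mathcal{T}$ containing $\mathcal{S}$ and closed under arbitrary coproducts (resp. products). A triangle functor $(F,\omega)$ is an additive functor with a connecting natural isomorphism $\omega\colon F\Sigma\to\Sigma F$ preserving exact triangles; isomorphisms of triangle functors are compatible with connecting isomorphisms. It is bi-continuous if it preserves arbitrary coproducts and products. A pseudo-identity on $\mathcal{T}$ with respect to $(\mathcal{U}_{\geq0},\mathcal{U}_{\leq0})$ is a triangle autoequivalence $G\colon\mathcal{T}\to\mathcal{T}$ such that $G(X)=X$ for each object $X$ and $G|_{\mathcal{C}}\colon\mathcal{C}\to\mathcal{C}$ equals $\mathrm{Id}_{\mathcal{C}}$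 as a functor. *)

theory Defs
  imports "HOL-Algebra.Group" "HOL-Library.Extended_Real" "HOL-Library.Countable_Set"
    "HOL-Library.Equipollence"
begin

section \<open>Categories and functors\<close>

text \<open>
  The objects are all elements of the type \<open>'o\<close> and the arrows are all elements of the type \<open>'m\<close>;
  hom-sets are pairwise disjoint because every arrow has one source and one target. The values of
  the operations outside their intended domain (e.g. composition of non-composable arrows) are
  unconstrained and never used. Full subcategories are represented by their sets of objects.
\<close>

record ('o, 'm) category =
  src :: "'m \<Rightarrow> 'o"
  tgt :: "'m \<Rightarrow> 'o"
  idt :: "'o \<Rightarrow> 'm"
  cmp :: "'m \<Rightarrow> 'm \<Rightarrow> 'm"  (infixl \<open>\<cdot>\<index>\<close> 70)

definition Hom :: "('o, 'm, 'z) category_scheme \<Rightarrow> 'o \<Rightarrow> 'o \<Rightarrow> 'm set"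
  where "Hom T X Y = {f. src T f = X \<and> tgt T f = Y}"

locale category =
  fixes T :: "('o, 'm, 'z) category_scheme" (structure)
  assumes idt_in_Hom: "idt T X \<in> Hom T X X"
    and cmp_in_Hom: "f \<in> Hom T X Y \<Longrightarrow> g \<in> Hom T Y Z \<Longrightarrow> g \<cdot> f \<in> Hom T X Z"
    and cmp_assoc: "f \<in> Hom T W X \<Longrightarrow> g \<in> Hom T X Y \<Longrightarrow> h \<in> Hom T Y Z \<Longrightarrow>
      (h \<cdot> g) \<cdot> f = h \<cdot> (g \<cdot> f)"
    and cmp_idt_right: "f \<in> Hom T X Y \<Longrightarrow> f \<cdot> idt T X = f"
    and cmp_idt_left: "f \<in> Hom T X Y \<Longrightarrow> idt T Y \<cdot> f = f"

definition is_iso :: "('o, 'm, 'z) category_scheme \<Rightarrow> 'm \<Rightarrow> bool"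
  where "is_iso T f \<longleftrightarrow>
    (\<exists>g \<in> Hom T (tgt T f) (src T f).
       g \<cdot>\<^bsub>T\<^esub> f = idt T (src T f) \<and> f \<cdot>\<^bsub>T\<^esub> g = idt T (tgt T f))"

definition isomorphic :: "('o, 'm, 'z) category_scheme \<Rightarrow> 'o \<Rightarrow> 'o \<Rightarrow> bool"
  where "isomorphic T X Y \<longleftrightarrow> (\<exists>f \<in> Hom T X Y. is_iso T f)"

definition is_zero_object :: "('o, 'm, 'z) category_scheme \<Rightarrow> 'o \<Rightarrow> bool"
  where "is_zero_object T Z \<longleftrightarrow>
    (\<forall>X. (\<exists>!f. f \<in> Hom T X Z) \<and> (\<exists>!f. f \<in> Hom T Z X))"

definition is_coproduct ::
  "('o, 'm, 'z) category_scheme \<Rightarrow> 'k set \<Rightarrow> ('k \<Rightarrow> 'o) \<Rightarrow> 'o \<Rightarrow> ('k \<Rightarrow> 'm) \<Rightarrow> bool"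
  where "is_coproduct T I X P i \<longleftrightarrow>
    (\<forall>k\<in>I. i k \<in> Hom T (X k) P) \<and>
    (\<forall>Q f. (\<forall>k\<in>I. f k \<in> Hom T (X k) Q) \<longrightarrow>
       (\<exists>!u. u \<in> Hom T P Q \<and> (\<forall>k\<in>I. u \<cdot>\<^bsub>T\<^esub> i k = f k)))"

definition is_product ::
  "('o, 'm, 'z) category_scheme \<Rightarrow> 'k set \<Rightarrow> ('k \<Rightarrow> 'o) \<Rightarrow> 'o \<Rightarrow> ('k \<Rightarrow> 'm) \<Rightarrow> bool"
  where "is_product T I X P p \<longleftrightarrow>
    (\<forall>k\<in>I. p k \<in> Hom T P (X k)) \<and>
    (\<forall>Q f. (\<forall>k\<in>I. f k \<in> Hom T Q (X k)) \<longrightarrow>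
       (\<exists>!u. u \<in> Hom T Q P \<and> (\<forall>k\<in>I. p k \<cdot>\<^bsub>T\<^esub> u = f k)))"

record ('o, 'm, 'p, 'n) fctr =
  fob :: "'o \<Rightarrow> 'p"
  far :: "'m \<Rightarrow> 'n"

definition is_functor ::
  "('o, 'm, 'y) category_scheme \<Rightarrow> ('p, 'n, 'z) category_scheme \<Rightarrow> ('o, 'm, 'p, 'n) fctr \<Rightarrow> bool"
  where "is_functor C D F \<longleftrightarrow>
    (\<forall>X Y. \<forall>f \<in> Hom C X Y. far F f \<in> Hom D (fob F X) (fob F Y)) \<and>
    (\<forall>X. far F (idt C X) = idt D (fob F X)) \<and>
    (\<forall>X Y Z. \<forall>f \<in> Hom C X Y. \<forall>g \<in> Hom C Y Z.
       far F (g \<cdot>\<^bsub>C\<^esub> f) = far F g \<cdot>\<^bsub>D\<^esub> far F f)"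

definition id_functor :: "('o, 'm, 'o, 'm) fctr"
  where "id_functor = \<lparr>fob = id, far = id\<rparr>"

definition comp_functor ::
  "('p, 'n, 'q, 'l) fctr \<Rightarrow> ('o, 'm, 'p, 'n) fctr \<Rightarrow> ('o, 'm, 'q, 'l) fctr"
  where "comp_functor G F = \<lparr>fob = fob G \<circ> fob F, far = far G \<circ> far F\<rparr>"

text \<open>A natural isomorphism between the restrictions of two functors to the full subcategory \<open>A\<close>.\<close>

definition natural_iso_on ::
  "('o, 'm, 'y) category_scheme \<Rightarrow> ('p, 'n, 'z) category_scheme \<Rightarrow> 'o set \<Rightarrow>
   ('o, 'm, 'p, 'n) fctr \<Rightarrow> ('o, 'm, 'p, 'n) fctr \<Rightarrow> ('o \<Rightarrow> 'n) \<Rightarrow> bool"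
  where "natural_iso_on C D A F G \<alpha> \<longleftrightarrow>
    (\<forall>X\<in>A. \<alpha> X \<in> Hom D (fob F X) (fob G X) \<and> is_iso D (\<alpha> X)) \<and>
    (\<forall>X\<in>A. \<forall>Y\<in>A. \<forall>f \<in> Hom C X Y. \<alpha> Y \<cdot>\<^bsub>D\<^esub> far F f = far G f \<cdot>\<^bsub>D\<^esub> \<alpha> X)"

abbreviation natural_iso ::
  "('o, 'm, 'y) category_scheme \<Rightarrow> ('p, 'n, 'z) category_scheme \<Rightarrow>
   ('o, 'm, 'p, 'n) fctr \<Rightarrow> ('o, 'm, 'p, 'n) fctr \<Rightarrow> ('o \<Rightarrow> 'n) \<Rightarrow> bool"
  where "natural_iso C D \<equiv> natural_iso_on C D UNIV"

definition is_equivalence ::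
  "('o, 'm, 'y) category_scheme \<Rightarrow> ('p, 'n, 'z) category_scheme \<Rightarrow> ('o, 'm, 'p, 'n) fctr \<Rightarrow> bool"
  where "is_equivalence C D F \<longleftrightarrow> is_functor C D F \<and>
    (\<exists>H \<alpha> \<beta>. is_functor D C H \<and>
       natural_iso C C (comp_functor H F) id_functor \<alpha> \<and>
       natural_iso D D (comp_functor F H) id_functor \<beta>)"

definition fully_faithful_on ::
  "('o, 'm, 'y) category_scheme \<Rightarrow> ('p, 'n, 'z) category_scheme \<Rightarrow> 'o set \<Rightarrow>
   ('o, 'm, 'p, 'n) fctr \<Rightarrow> bool"
  where "fully_faithful_on C D A F \<longleftrightarrow>
    (\<forall>X\<in>A. \<forall>Y\<in>A. bij_betw (far F) (Hom C X Y) (Hom D (fob F X) (fob F Y)))"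


section \<open>Additive categories\<close>

record ('o, 'm) additive_category = "('o, 'm) category" +
  madd :: "'m \<Rightarrow> 'm \<Rightarrow> 'm"
  zarr :: "'o \<Rightarrow> 'o \<Rightarrow> 'm"

definition Hom_group :: "('o, 'm, 'z) additive_category_scheme \<Rightarrow> 'o \<Rightarrow> 'o \<Rightarrow> 'm monoid"
  where "Hom_group T X Y = \<lparr>carrier = Hom T X Y, mult = madd T, one = zarr T X Y\<rparr>"

definition mneg :: "('o, 'm, 'z) additive_category_scheme \<Rightarrow> 'm \<Rightarrow> 'm"
  where "mneg T f = inv\<^bsub>Hom_group T (src T f) (tgt T f)\<^esub> f"

definition msub :: "('o, 'm, 'z) additive_category_scheme \<Rightarrow> 'm \<Rightarrow> 'm \<Rightarrow> 'm"
  where "msub T f g = madd T f (mneg T g)"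

definition is_biproduct ::
  "('o, 'm, 'z) additive_category_scheme \<Rightarrow> 'o \<Rightarrow> 'o \<Rightarrow> 'o \<Rightarrow> bool"
  where "is_biproduct T X Y P \<longleftrightarrow>
    (\<exists>i \<in> Hom T X P. \<exists>j \<in> Hom T Y P. \<exists>p \<in> Hom T P X. \<exists>q \<in> Hom T P Y.
       p \<cdot>\<^bsub>T\<^esub> i = idt T X \<and> q \<cdot>\<^bsub>T\<^esub> j = idt T Y \<and>
       q \<cdot>\<^bsub>T\<^esub> i = zarr T X Y \<and> p \<cdot>\<^bsub>T\<^esub> j = zarr T Y X \<and>
       madd T (i \<cdot>\<^bsub>T\<^esub> p) (j \<cdot>\<^bsub>T\<^esub> q) = idt T P)"

locale additive_category = category T
  for T :: "('o, 'm, 'z) additive_category_scheme" (structure) +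
  assumes Hom_comm_group: "comm_group (Hom_group T X Y)"
    and cmp_madd_right: "f \<in> Hom T X Y \<Longrightarrow> f' \<in> Hom T X Y \<Longrightarrow> g \<in> Hom T Y Z \<Longrightarrow>
      g \<cdot> madd T f f' = madd T (g \<cdot> f) (g \<cdot> f')"
    and cmp_madd_left: "f \<in> Hom T X Y \<Longrightarrow> g \<in> Hom T Y Z \<Longrightarrow> g' \<in> Hom T Y Z \<Longrightarrow>
      madd T g g' \<cdot> f = madd T (g \<cdot> f) (g' \<cdot> f)"
    and ex_zero_object: "\<exists>Z. is_zero_object T Z"
    and ex_biproduct: "\<exists>P. is_biproduct T X Y P"

definition is_additive_functor ::
  "('o, 'm, 'y) additive_category_scheme \<Rightarrow> ('p, 'n, 'z) additive_category_scheme \<Rightarrow>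
   ('o, 'm, 'p, 'n) fctr \<Rightarrow> bool"
  where "is_additive_functor C D F \<longleftrightarrow> is_functor C D F \<and>
    (\<forall>X Y. \<forall>f \<in> Hom C X Y. \<forall>g \<in> Hom C X Y. far F (madd C f g) = madd D (far F f) (far F g))"

definition full_additive_subcategory ::
  "('o, 'm, 'z) additive_category_scheme \<Rightarrow> 'o set \<Rightarrow> bool"
  where "full_additive_subcategory T U \<longleftrightarrow>
    (\<exists>Z\<in>U. is_zero_object T Z) \<and> (\<forall>X\<in>U. \<forall>Y\<in>U. \<exists>P\<in>U. is_biproduct T X Y P)"

definition Hom_vanishes ::
  "('o, 'm, 'z) additive_category_scheme \<Rightarrow> 'o set \<Rightarrow> 'o set \<Rightarrow> bool"
  where "Hom_vanishes T A B \<longleftrightarrow> (\<forall>X\<in>A. \<forall>Y\<in>B. Hom T X Y = {zarr T X Y})"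


section \<open>Triangulated categories\<close>

text \<open>
  A triangle is a triple \<open>(f, g, h)\<close> with \<open>f : X \<rightarrow> Y\<close>, \<open>g : Y \<rightarrow> Z\<close>, \<open>h : Z \<rightarrow> \<Sigma> X\<close>; \<open>Sus\<close> is the
  suspension functor and \<open>Dist\<close> the class of exact triangles. The suspension is only required to be
  an autoequivalence, which covers the case of an automorphism.
\<close>

record ('o, 'm) triangulated_category = "('o, 'm) additive_category" +
  Sus :: "('o, 'm, 'o, 'm) fctr"
  Dist :: "('m \<times> 'm \<times> 'm) set"

definition is_triangle ::
  "('o, 'm, 'z) triangulated_category_scheme \<Rightarrow> 'm \<Rightarrow> 'm \<Rightarrow> 'm \<Rightarrow> bool"
  where "is_triangle T f g h \<longleftrightarrow>
    tgt T f = src T g \<and> tgt T g = src T h \<and> tgt T h = fob (Sus T) (src T f)"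

locale triangulated_category = additive_category T
  for T :: "('o, 'm, 'z) triangulated_category_scheme" (structure) +
  assumes Sus_additive: "is_additive_functor T T (Sus T)"
    and Sus_equivalence: "is_equivalence T T (Sus T)"
    and Dist_is_triangle: "(f, g, h) \<in> Dist T \<Longrightarrow> is_triangle T f g h"
    and TR1_iso: "(f, g, h) \<in> Dist T \<Longrightarrow> is_triangle T f' g' h' \<Longrightarrow>
      u \<in> Hom T (src T f) (src T f') \<Longrightarrow> v \<in> Hom T (src T g) (src T g') \<Longrightarrow>
      w \<in> Hom T (src T h) (src T h') \<Longrightarrow> is_iso T u \<Longrightarrow> is_iso T v \<Longrightarrow> is_iso T w \<Longrightarrow>
      v \<cdot> f = f' \<cdot> u \<Longrightarrow> w \<cdot> g = g' \<cdot> v \<Longrightarrow> far (Sus T) u \<cdot> h = h' \<cdot> w \<Longrightarrow>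
      (f', g', h') \<in> Dist T"
    and TR1_idt: "is_zero_object T Z \<Longrightarrow>
      (idt T X, zarr T X Z, zarr T Z (fob (Sus T) X)) \<in> Dist T"
    and TR1_cone: "\<exists>g h. (f, g, h) \<in> Dist T"
    and TR2: "is_triangle T f g h \<Longrightarrow>
      (f, g, h) \<in> Dist T \<longleftrightarrow> (g, h, mneg T (far (Sus T) f)) \<in> Dist T"
    and TR3: "(f, g, h) \<in> Dist T \<Longrightarrow> (f', g', h') \<in> Dist T \<Longrightarrow>
      u \<in> Hom T (src T f) (src T f') \<Longrightarrow> v \<in> Hom T (src T g) (src T g') \<Longrightarrow>
      v \<cdot> f = f' \<cdot> u \<Longrightarrow>
      \<exists>w \<in> Hom T (src T h) (src T h'). w \<cdot> g = g' \<cdot> v \<and> far (Sus T) u \<cdot> h = h' \<cdot> w"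
    and TR4: "(f, f', f'') \<in> Dist T \<Longrightarrow> (g, g', g'') \<in> Dist T \<Longrightarrow> tgt T f = src T g \<Longrightarrow>
      (g \<cdot> f, k', k'') \<in> Dist T \<Longrightarrow>
      \<exists>u \<in> Hom T (tgt T f') (tgt T k'). \<exists>v \<in> Hom T (tgt T k') (tgt T g').
        (u, v, far (Sus T) f' \<cdot> g'') \<in> Dist T \<and>
        u \<cdot> f' = k' \<cdot> g \<and> k'' \<cdot> u = f'' \<and> v \<cdot> k' = g' \<and> g'' \<cdot> v = far (Sus T) f \<cdot> k''"

definition extension_product ::
  "('o, 'm, 'z) triangulated_category_scheme \<Rightarrow> 'o set \<Rightarrow> 'o set \<Rightarrow> 'o set"
  where "extension_product T A B =
    {Z. \<exists>X\<in>A. \<exists>Y\<in>B. \<exists>f \<in> Hom T X Z. \<exists>g \<in> Hom T Z Y. \<exists>h. (f, g, h) \<in> Dist T}"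

definition closed_under_extensions ::
  "('o, 'm, 'z) triangulated_category_scheme \<Rightarrow> 'o set \<Rightarrow> bool"
  where "closed_under_extensions T A \<longleftrightarrow> extension_product T A A \<subseteq> A"

text \<open>
  \<open>shifted T n A\<close> is \<open>\<Sigma>\<^sup>n(A)\<close>, closed under isomorphism. As \<open>\<Sigma>\<close> is only an autoequivalence, \<open>X\<close>
  belongs to \<open>\<Sigma>\<^sup>-\<^sup>k(A)\<close> for \<open>k > 0\<close> iff \<open>\<Sigma>\<^sup>k(X)\<close> is isomorphic to an object of \<open>A\<close>.
\<close>

definition shifted ::
  "('o, 'm, 'z) triangulated_category_scheme \<Rightarrow> int \<Rightarrow> 'o set \<Rightarrow> 'o set"
  where "shifted T n A =
    {X. \<exists>Y\<in>A. if n \<ge> 0 then isomorphic T X ((fob (Sus T) ^^ nat n) Y)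
               else isomorphic T ((fob (Sus T) ^^ nat (- n)) X) Y}"

definition cone_in ::
  "('o, 'm, 'z) triangulated_category_scheme \<Rightarrow> 'm \<Rightarrow> 'o set \<Rightarrow> bool"
  where "cone_in T f A \<longleftrightarrow> (\<exists>g h. (f, g, h) \<in> Dist T \<and> tgt T g \<in> A)"

definition triangulated_subcategory ::
  "('o, 'm, 'z) triangulated_category_scheme \<Rightarrow> 'o set \<Rightarrow> bool"
  where "triangulated_subcategory T L \<longleftrightarrow> full_additive_subcategory T L \<and>
    (\<forall>X. fob (Sus T) X \<in> L \<longleftrightarrow> X \<in> L) \<and>
    (\<forall>f g h. (f, g, h) \<in> Dist T \<longrightarrow>
       (src T f \<in> L \<and> src T g \<in> L \<longrightarrow> src T h \<in> L) \<and>
       (src T g \<in> L \<and> src T h \<in> L \<longrightarrow> src T f \<in> L) \<and>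
       (src T f \<in> L \<and> src T h \<in> L \<longrightarrow> src T g \<in> L))"

text \<open>A triangle functor is a pair \<open>(F, \<omega>)\<close> with \<open>\<omega> : F \<Sigma> \<rightarrow> \<Sigma> F\<close>.\<close>

definition is_triangle_functor ::
  "('o, 'm, 'y) triangulated_category_scheme \<Rightarrow> ('p, 'n, 'z) triangulated_category_scheme \<Rightarrow>
   ('o, 'm, 'p, 'n) fctr \<Rightarrow> ('o \<Rightarrow> 'n) \<Rightarrow> bool"
  where "is_triangle_functor C D F \<omega> \<longleftrightarrow> is_additive_functor C D F \<and>
    natural_iso C D (comp_functor F (Sus C)) (comp_functor (Sus D) F) \<omega> \<and>
    (\<forall>f g h. (f, g, h) \<in> Dist C \<longrightarrow>
       (far F f, far F g, \<omega> (src C f) \<cdot>\<^bsub>D\<^esub> far F h) \<in> Dist D)"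

definition triangle_functors_isomorphic ::
  "('o, 'm, 'y) triangulated_category_scheme \<Rightarrow> ('p, 'n, 'z) triangulated_category_scheme \<Rightarrow>
   ('o, 'm, 'p, 'n) fctr \<Rightarrow> ('o \<Rightarrow> 'n) \<Rightarrow> ('o, 'm, 'p, 'n) fctr \<Rightarrow> ('o \<Rightarrow> 'n) \<Rightarrow> bool"
  where "triangle_functors_isomorphic C D F \<omega> G \<omega>' \<longleftrightarrow>
    (\<exists>\<alpha>. natural_iso C D F G \<alpha> \<and>
       (\<forall>X. \<omega>' X \<cdot>\<^bsub>D\<^esub> \<alpha> (fob (Sus C) X) = far (Sus D) (\<alpha> X) \<cdot>\<^bsub>D\<^esub> \<omega> X))"


section \<open>Arbitrary coproducts and products\<close>

text \<open>
  A category having coproducts indexed by all sets of the cardinality of its arrows is a preorder,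
  so ``arbitrary'' coproducts must mean coproducts indexed by small sets. The type \<open>'u\<close> plays the
  role of the universe: index sets are the subsets of \<open>'u\<close> of cardinality less than that of \<open>'u\<close>.
  (If \<open>'u\<close> is a Grothendieck universe these are, up to bijection, precisely the small sets.)
\<close>

definition small :: "'u set \<Rightarrow> bool"
  where "small I \<longleftrightarrow> I \<prec> (UNIV :: 'u set)"

definition bicomplete :: "'u itself \<Rightarrow> ('o, 'm, 'z) category_scheme \<Rightarrow> bool"
  where "bicomplete _ T \<longleftrightarrow>
    (\<forall>(I :: 'u set) X. small I \<longrightarrow>
       (\<exists>P i. is_coproduct T I X P i) \<and> (\<exists>P p. is_product T I X P p))"

definition bicontinuous ::
  "'u itself \<Rightarrow> ('o, 'm, 'y) category_scheme \<Rightarrow> ('p, 'n, 'z) category_scheme \<Rightarrow>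
   ('o, 'm, 'p, 'n) fctr \<Rightarrow> bool"
  where "bicontinuous _ C D F \<longleftrightarrow>
    (\<forall>(I :: 'u set) X P i. small I \<longrightarrow> is_coproduct C I X P i \<longrightarrow>
       is_coproduct D I (fob F \<circ> X) (fob F P) (far F \<circ> i)) \<and>
    (\<forall>(I :: 'u set) X P p. small I \<longrightarrow> is_product C I X P p \<longrightarrow>
       is_product D I (fob F \<circ> X) (fob F P) (far F \<circ> p))"

definition Loc :: "'u itself \<Rightarrow> ('o, 'm, 'z) triangulated_category_scheme \<Rightarrow> 'o set \<Rightarrow> 'o set"
  where "Loc _ T S = \<Inter>{L. triangulated_subcategory T L \<and> S \<subseteq> L \<and>
    (\<forall>(I :: 'u set) X P i. small I \<longrightarrow> X ` I \<subseteq> L \<longrightarrow> is_coproduct T I X P i \<longrightarrow> P \<in> L)}"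

definition coLoc :: "'u itself \<Rightarrow> ('o, 'm, 'z) triangulated_category_scheme \<Rightarrow> 'o set \<Rightarrow> 'o set"
  where "coLoc _ T S = \<Inter>{L. triangulated_subcategory T L \<and> S \<subseteq> L \<and>
    (\<forall>(I :: 'u set) X P p. small I \<longrightarrow> X ` I \<subseteq> L \<longrightarrow> is_product T I X P p \<longrightarrow> P \<in> L)}"

text \<open>\<open>d\<close> is the morphism \<open>1 - \<phi>\<close>; \<open>H\<close> is a homotopy colimit with structure morphisms \<open>\<gamma>\<^sub>n\<close>.\<close>

definition is_hocolim ::
  "('o, 'm, 'z) triangulated_category_scheme \<Rightarrow> (nat \<Rightarrow> 'o) \<Rightarrow> (nat \<Rightarrow> 'm) \<Rightarrow>
   'o \<Rightarrow> (nat \<Rightarrow> 'm) \<Rightarrow> bool"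
  where "is_hocolim T X \<phi> H \<gamma>s \<longleftrightarrow>
    (\<exists>P i d \<gamma> \<delta>. is_coproduct T UNIV X P i \<and> d \<in> Hom T P P \<and>
       (\<forall>n. d \<cdot>\<^bsub>T\<^esub> i n = msub T (i n) (i (Suc n) \<cdot>\<^bsub>T\<^esub> \<phi> n)) \<and>
       (d, \<gamma>, \<delta>) \<in> Dist T \<and> tgt T \<gamma> = H \<and> (\<forall>n. \<gamma>s n = \<gamma> \<cdot>\<^bsub>T\<^esub> i n))"

definition is_holim ::
  "('o, 'm, 'z) triangulated_category_scheme \<Rightarrow> (nat \<Rightarrow> 'o) \<Rightarrow> (nat \<Rightarrow> 'm) \<Rightarrow>
   'o \<Rightarrow> (nat \<Rightarrow> 'm) \<Rightarrow> bool"
  where "is_holim T Y \<psi> H \<sigma>s \<longleftrightarrow>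
    (\<exists>P p d \<sigma> \<delta>. is_product T UNIV Y P p \<and> d \<in> Hom T P P \<and>
       (\<forall>n. p n \<cdot>\<^bsub>T\<^esub> d = msub T (p n) (\<psi> n \<cdot>\<^bsub>T\<^esub> p (Suc n))) \<and>
       (\<sigma>, d, \<delta>) \<in> Dist T \<and> src T \<sigma> = H \<and> (\<forall>n. \<sigma>s n = p n \<cdot>\<^bsub>T\<^esub> \<sigma>))"


section \<open>Pre-weight structures\<close>

text \<open>In what follows \<open>U\<close> stands for \<open>\<U>\<^sub>\<ge>\<^sub>0\<close> and \<open>V\<close> for \<open>\<U>\<^sub>\<le>\<^sub>0\<close>.\<close>

definition pre_weight_structure ::
  "('o, 'm, 'z) triangulated_category_scheme \<Rightarrow> 'o set \<Rightarrow> 'o set \<Rightarrow> bool"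
  where "pre_weight_structure T U V \<longleftrightarrow>
    full_additive_subcategory T U \<and> full_additive_subcategory T V \<and>
    extension_product T U (shifted T 1 V) = UNIV \<and>
    shifted T (-1) U \<subseteq> U \<and> closed_under_extensions T U \<and>
    shifted T 1 V \<subseteq> V \<and> closed_under_extensions T V"

definition U_ge :: "('o, 'm, 'z) triangulated_category_scheme \<Rightarrow> 'o set \<Rightarrow> int \<Rightarrow> 'o set"
  where "U_ge T U m = shifted T (- m) U"

definition U_le :: "('o, 'm, 'z) triangulated_category_scheme \<Rightarrow> 'o set \<Rightarrow> int \<Rightarrow> 'o set"
  where "U_le T V m = shifted T (- m) V"

definition U_interval ::
  "('o, 'm, 'z) triangulated_category_scheme \<Rightarrow> 'o set \<Rightarrow> 'o set \<Rightarrow> int \<Rightarrow> int \<Rightarrow> 'o set"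
  where "U_interval T U V m n = U_ge T U m \<inter> U_le T V n"

definition U_bounded ::
  "('o, 'm, 'z) triangulated_category_scheme \<Rightarrow> 'o set \<Rightarrow> 'o set \<Rightarrow> 'o set"
  where "U_bounded T U V = (\<Union>m. \<Union>n\<in>{m..}. U_interval T U V m n)"

definition pw_dimension ::
  "('o, 'm, 'z) triangulated_category_scheme \<Rightarrow> 'o set \<Rightarrow> 'o set \<Rightarrow> ereal"
  where "pw_dimension T U V = Inf (insert \<infinity>
    {ereal (of_int d) | d :: int. d \<ge> -1 \<and> Hom_vanishes T U (U_le T V (- (d + 1)))})"

definition left_tower ::
  "('o, 'm, 'z) triangulated_category_scheme \<Rightarrow> 'o set \<Rightarrow> 'o set \<Rightarrow> 'o \<Rightarrow>
   (nat \<Rightarrow> 'o) \<Rightarrow> (nat \<Rightarrow> 'm) \<Rightarrow> (nat \<Rightarrow> 'm) \<Rightarrow> bool"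
  where "left_tower T U V X Xs \<iota> \<phi> \<longleftrightarrow>
    (\<forall>n. Xs n \<in> U_interval T U V (- int n) 0 \<and>
         \<iota> n \<in> Hom T (Xs n) X \<and> \<phi> n \<in> Hom T (Xs n) (Xs (Suc n)) \<and>
         cone_in T (\<iota> n) (U_le T V (- int n - 1)) \<and>
         cone_in T (\<phi> n) (shifted T (int n + 1) (U \<inter> V)) \<and>
         \<iota> n = \<iota> (Suc n) \<cdot>\<^bsub>T\<^esub> \<phi> n)"

definition right_tower ::
  "('o, 'm, 'z) triangulated_category_scheme \<Rightarrow> 'o set \<Rightarrow> 'o set \<Rightarrow> 'o \<Rightarrow>
   (nat \<Rightarrow> 'o) \<Rightarrow> (nat \<Rightarrow> 'm) \<Rightarrow> (nat \<Rightarrow> 'm) \<Rightarrow> bool"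
  where "right_tower T U V Y Ys \<pi> \<psi> \<longleftrightarrow>
    (\<forall>n. Ys n \<in> U_interval T U V 0 (int n) \<and>
         \<pi> n \<in> Hom T Y (Ys n) \<and> \<psi> n \<in> Hom T (Ys (Suc n)) (Ys n) \<and>
         cone_in T (\<pi> n) (U_ge T U (int n)) \<and>
         cone_in T (\<psi> n) (shifted T (- int n) (U \<inter> V)) \<and>
         \<pi> n = \<psi> n \<cdot>\<^bsub>T\<^esub> \<pi> (Suc n))"

definition convergent_left_tower ::
  "('o, 'm, 'z) triangulated_category_scheme \<Rightarrow> 'o set \<Rightarrow> 'o set \<Rightarrow> 'o \<Rightarrow>
   (nat \<Rightarrow> 'o) \<Rightarrow> (nat \<Rightarrow> 'm) \<Rightarrow> (nat \<Rightarrow> 'm) \<Rightarrow> bool"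
  where "convergent_left_tower T U V X Xs \<iota> \<phi> \<longleftrightarrow> left_tower T U V X Xs \<iota> \<phi> \<and>
    (\<exists>H \<gamma>s. is_hocolim T Xs \<phi> H \<gamma>s \<and>
       (\<exists>\<kappa> \<in> Hom T H X. is_iso T \<kappa> \<and> (\<forall>n. \<kappa> \<cdot>\<^bsub>T\<^esub> \<gamma>s n = \<iota> n)))"

definition convergent_right_tower ::
  "('o, 'm, 'z) triangulated_category_scheme \<Rightarrow> 'o set \<Rightarrow> 'o set \<Rightarrow> 'o \<Rightarrow>
   (nat \<Rightarrow> 'o) \<Rightarrow> (nat \<Rightarrow> 'm) \<Rightarrow> (nat \<Rightarrow> 'm) \<Rightarrow> bool"
  where "convergent_right_tower T U V Y Ys \<pi> \<psi> \<longleftrightarrow> right_tower T U V Y Ys \<pi> \<psi> \<and>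
    (\<exists>H \<sigma>s. is_holim T Ys \<psi> H \<sigma>s \<and>
       (\<exists>\<kappa> \<in> Hom T Y H. is_iso T \<kappa> \<and> (\<forall>n. \<sigma>s n \<cdot>\<^bsub>T\<^esub> \<kappa> = \<pi> n)))"

definition left_convergent ::
  "('o, 'm, 'z) triangulated_category_scheme \<Rightarrow> 'o set \<Rightarrow> 'o set \<Rightarrow> bool"
  where "left_convergent T U V \<longleftrightarrow> (\<forall>X\<in>V. \<exists>Xs \<iota> \<phi>. convergent_left_tower T U V X Xs \<iota> \<phi>)"

definition right_convergent ::
  "('o, 'm, 'z) triangulated_category_scheme \<Rightarrow> 'o set \<Rightarrow> 'o set \<Rightarrow> bool"
  where "right_convergent T U V \<longleftrightarrow> (\<forall>Y\<in>U. \<exists>Ys \<pi> \<psi>. convergent_right_tower T U V Y Ys \<pi> \<psi>)"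

definition two_sided_convergent ::
  "('o, 'm, 'z) triangulated_category_scheme \<Rightarrow> 'o set \<Rightarrow> 'o set \<Rightarrow> bool"
  where "two_sided_convergent T U V \<longleftrightarrow> left_convergent T U V \<and> right_convergent T U V"

definition pseudo_identity ::
  "('o, 'm, 'z) triangulated_category_scheme \<Rightarrow> 'o set \<Rightarrow> 'o set \<Rightarrow>
   ('o, 'm, 'o, 'm) fctr \<Rightarrow> ('o \<Rightarrow> 'm) \<Rightarrow> bool"
  where "pseudo_identity T U V G \<omega> \<longleftrightarrow>
    is_triangle_functor T T G \<omega> \<and> is_equivalence T T G \<and> (\<forall>X. fob G X = X) \<and>
    (\<forall>A \<in> U \<inter> V. \<forall>B \<in> U \<inter> V. \<forall>f \<in> Hom T A B. far G f = f)"

end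

theory Submission
  imports Defs
begin

text \<open>
  Negative self-extensions of the core vanish, so along a left or right tower the isomorphism
  \<open>\<eta>\<close> on the core extends, one cone at a time, to compatible isomorphisms from \<open>F\<close> of each stage
  to that stage; passing to homotopy (co)limits gives \<open>F X \<cong> X\<close> for \<open>X\<close> in \<open>\<U>\<^sub>\<le>\<^sub>0\<close> or \<open>\<U>\<^sub>\<ge>\<^sub>0\<close>. An
  arbitrary object is the fibre of a morphism from \<open>\<Sigma>(\<U>\<^sub>\<le>\<^sub>0)\<close> to \<open>\<Sigma>(\<U>\<^sub>\<ge>\<^sub>0)\<close>. By the towers
  \<open>Hom(\<U>\<^sub>\<le>\<^sub>0, \<U>\<^sub>\<ge>\<^sub>1) = 0\<close>, hence such a morphism is determined by the morphism it induces between
  the core objects at the bottom of the two towers, so the isomorphisms commute with it and \<open>F X \<cong> X\<close> for every object.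

  Full faithfulness spreads from \<open>\<U>\<^sub>b\<close> by five-lemma arguments: to \<open>Loc\<close> in the first and to
  \<open>coLoc\<close> in the second variable, and across a far stage of a tower because of the finite
  dimension. Conjugating \<open>F\<close> with the isomorphisms \<open>F X \<cong> X\<close> then gives the pseudo-identity.
\<close>

section \<open>Categories with additive structure\<close>

text \<open>Completions of morphisms of triangles exist but are not unique, so outside the core the
  isomorphisms F X \<cong> X are merely chosen, and no naturality in X can be expected from them.
  Hence the conclusion is a pseudo-identity rather than the identity functor.

  The objectwise isomorphisms have to precede full faithfulness, because they feed it: they turn
  Hom(X, Y) = 0 into Hom(F X, F Y) = 0, and such vanishing is how the cone of a far stage of a tower
  is handled.

  Coproducts in the first variable and products in the second both become products of Hom groups,
  and F preserves them. This explains the roles of Loc and coLoc; no compactness of objects is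
  involved.

  Since \<Sigma> is only an autoequivalence, an object of \<Sigma>(A) is a suspension only up to a
  chosen isomorphism. Statements are therefore often moved by suspending both sides, and where a
  chosen isomorphism enters a construction its independence of the choice has to be shown.\<close>

lemma in_Hom [simp]: "f \<in> Hom T X Y \<longleftrightarrow> src T f = X \<and> tgt T f = Y"
  by (simp add: Hom_def)

text \<open>Makes the inverse a function of the arrow, so that it can occur in rewrite rules;
  outside the isomorphisms the chosen value is arbitrary.\<close>

definition arr_inv :: "('o, 'm, 'z) category_scheme \<Rightarrow> 'm \<Rightarrow> 'm"
  where "arr_inv T f = (SOME g. g \<in> Hom T (tgt T f) (src T f) \<and>
     cmp T g f = idt T (src T f) \<and> cmp T f g = idt T (tgt T f))"

context category
begin

lemma src_idt [simp]: "src T (idt T X) = X" and tgt_idt [simp]: "tgt T (idt T X) = X"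
  using idt_in_Hom by simp_all

lemma src_cmp [simp]: "tgt T f = src T g \<Longrightarrow> src T (g \<cdot> f) = src T f"
  and tgt_cmp [simp]: "tgt T f = src T g \<Longrightarrow> tgt T (g \<cdot> f) = tgt T g"
  using cmp_in_Hom[of f "src T f" "tgt T f" g "tgt T g"] by simp_all

lemma assoc [simp]: "tgt T f = src T g \<Longrightarrow> tgt T g = src T h \<Longrightarrow> (h \<cdot> g) \<cdot> f = h \<cdot> (g \<cdot> f)"
  using cmp_assoc by simp

lemma idt_right [simp]: "src T f = X \<Longrightarrow> f \<cdot> idt T X = f"
  using cmp_idt_right[of f X "tgt T f"] by simp

lemma idt_left [simp]: "tgt T f = X \<Longrightarrow> idt T X \<cdot> f = f"
  using cmp_idt_left[of f "src T f" X] by simp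

text \<open>Composites are normalised to the right, which hides a known composite
  \<open>g \<cdot> f\<close> inside \<open>g \<cdot> (f \<cdot> x)\<close>. This rule makes an
  equation for \<open>g \<cdot> f\<close> applicable there.\<close>

lemma cmp_reduce:
  "g \<cdot> f = k \<Longrightarrow> tgt T f = src T g \<Longrightarrow> tgt T x = src T f \<Longrightarrow> g \<cdot> (f \<cdot> x) = k \<cdot> x"
  by (metis assoc)

lemma iso_inv:
  assumes "is_iso T f"
  shows src_inv: "src T (arr_inv T f) = tgt T f" and tgt_inv: "tgt T (arr_inv T f) = src T f"
    and inv_left: "arr_inv T f \<cdot> f = idt T (src T f)"
    and inv_right: "f \<cdot> arr_inv T f = idt T (tgt T f)"
proof -
  have "\<exists>g. g \<in> Hom T (tgt T f) (src T f) \<and>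
     cmp T g f = idt T (src T f) \<and> cmp T f g = idt T (tgt T f)"
    using assms unfolding is_iso_def by blast
  from someI_ex[OF this] show "src T (arr_inv T f) = tgt T f" "tgt T (arr_inv T f) = src T f"
    "arr_inv T f \<cdot> f = idt T (src T f)" "f \<cdot> arr_inv T f = idt T (tgt T f)"
    unfolding arr_inv_def by auto
qed

lemma isoI:
  assumes "src T g = tgt T f" "tgt T g = src T f" "g \<cdot> f = idt T (src T f)" "f \<cdot> g = idt T (tgt T f)"
  shows "is_iso T f"
  unfolding is_iso_def using assms by (intro bexI[of _ g]) simp_all

lemma inv_left_cmp: "is_iso T f \<Longrightarrow> tgt T x = src T f \<Longrightarrow> arr_inv T f \<cdot> (f \<cdot> x) = x"
  using cmp_reduce[OF inv_left] by (simp add: iso_inv)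

lemma inv_right_cmp: "is_iso T f \<Longrightarrow> tgt T x = tgt T f \<Longrightarrow> f \<cdot> (arr_inv T f \<cdot> x) = x"
  using cmp_reduce[OF inv_right] by (simp add: iso_inv)

lemmas inv_simps = src_inv tgt_inv inv_left inv_right inv_left_cmp inv_right_cmp

lemma iso_idt [simp]: "is_iso T (idt T X)"
  by (rule isoI[of "idt T X"]) simp_all

lemma iso_arr_inv: "is_iso T f \<Longrightarrow> is_iso T (arr_inv T f)"
  by (rule isoI[of f]) (simp_all add: inv_simps)

lemma iso_cmp: "is_iso T f \<Longrightarrow> is_iso T g \<Longrightarrow> tgt T f = src T g \<Longrightarrow> is_iso T (g \<cdot> f)"
  by (rule isoI[of "arr_inv T f \<cdot> arr_inv T g"]) (simp_all add: inv_simps)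

lemma iso_cancel_right:
  assumes "is_iso T f" "src T a = tgt T f" "src T b = tgt T f" "a \<cdot> f = b \<cdot> f"
  shows "a = b"
proof -
  have "(a \<cdot> f) \<cdot> arr_inv T f = (b \<cdot> f) \<cdot> arr_inv T f" using assms by simp
  then show ?thesis using assms(1-3) by (simp add: inv_simps)
qed

lemma iso_cancel_left:
  assumes "is_iso T f" "tgt T a = src T f" "tgt T b = src T f" "f \<cdot> a = f \<cdot> b"
  shows "a = b"
  using assms by (metis inv_left_cmp)

lemma isomorphicI: "is_iso T f \<Longrightarrow> src T f = X \<Longrightarrow> tgt T f = Y \<Longrightarrow> isomorphic T X Y"
  unfolding isomorphic_def by auto

lemma isomorphic_refl [simp]: "isomorphic T X X"
  by (rule isomorphicI[of "idt T X"]) simp_all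

lemma isomorphic_sym: "isomorphic T X Y \<Longrightarrow> isomorphic T Y X"
  unfolding isomorphic_def using iso_arr_inv src_inv tgt_inv by fastforce

lemma isomorphic_trans: "isomorphic T X Y \<Longrightarrow> isomorphic T Y Z \<Longrightarrow> isomorphic T X Z"
  unfolding isomorphic_def using iso_cmp by (metis in_Hom src_cmp tgt_cmp)

section \<open>Coproducts and products, and change of their index sets\<close>

lemma coproduct_arr: "is_coproduct T I X P i \<Longrightarrow> k \<in> I \<Longrightarrow> src T (i k) = X k \<and> tgt T (i k) = P"
  unfolding is_coproduct_def by simp

lemma coproduct_ex1:
  "is_coproduct T I X P i \<Longrightarrow> \<forall>k\<in>I. f k \<in> Hom T (X k) Q \<Longrightarrow>
    \<exists>!u. u \<in> Hom T P Q \<and> (\<forall>k\<in>I. u \<cdot> i k = f k)"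
  by (simp add: is_coproduct_def del: in_Hom)

lemma product_ex1:
  "is_product T I X P p \<Longrightarrow> \<forall>k\<in>I. f k \<in> Hom T Q (X k) \<Longrightarrow>
    \<exists>!u. u \<in> Hom T Q P \<and> (\<forall>k\<in>I. p k \<cdot> u = f k)"
  by (simp add: is_product_def del: in_Hom)

lemma coproduct_ex:
  assumes "is_coproduct T I X P i" "\<And>k. k \<in> I \<Longrightarrow> src T (f k) = X k \<and> tgt T (f k) = Q"
  obtains u where "src T u = P" "tgt T u = Q" "\<And>k. k \<in> I \<Longrightarrow> u \<cdot> i k = f k"
proof -
  have "\<forall>k\<in>I. f k \<in> Hom T (X k) Q" using assms(2) by simp
  from ex1_implies_ex[OF coproduct_ex1[OF assms(1) this]]
  obtain u where "u \<in> Hom T P Q \<and> (\<forall>k\<in>I. u \<cdot> i k = f k)" ..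
  then show ?thesis by (intro that[of u]) simp_all
qed

lemma coproduct_eq:
  assumes "is_coproduct T I X P i" "src T u = P" "src T v = P" "tgt T u = tgt T v"
    and eq: "\<And>k. k \<in> I \<Longrightarrow> u \<cdot> i k = v \<cdot> i k"
  shows "u = v"
proof -
  have "\<forall>k\<in>I. u \<cdot> i k \<in> Hom T (X k) (tgt T u)" using assms(2-4) coproduct_arr[OF assms(1)] by simp
  then have "\<exists>!w. w \<in> Hom T P (tgt T u) \<and> (\<forall>k\<in>I. w \<cdot> i k = u \<cdot> i k)"
    by (rule coproduct_ex1[OF assms(1)])
  moreover have "u \<in> Hom T P (tgt T u)" "v \<in> Hom T P (tgt T u)" using assms(2-4) by simp_all
  ultimately show ?thesis using eq by (metis (no_types))
qed

lemma coproductI: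
  assumes "\<And>k. k \<in> I \<Longrightarrow> src T (i k) = X k \<and> tgt T (i k) = P"
    and "\<And>Q f. (\<And>k. k \<in> I \<Longrightarrow> src T (f k) = X k \<and> tgt T (f k) = Q) \<Longrightarrow>
      \<exists>u. src T u = P \<and> tgt T u = Q \<and> (\<forall>k\<in>I. u \<cdot> i k = f k)"
    and "\<And>Q u v. src T u = P \<Longrightarrow> src T v = P \<Longrightarrow> tgt T u = Q \<Longrightarrow> tgt T v = Q \<Longrightarrow>
      (\<And>k. k \<in> I \<Longrightarrow> u \<cdot> i k = v \<cdot> i k) \<Longrightarrow> u = v"
  shows "is_coproduct T I X P i"
  unfolding is_coproduct_def
proof (intro conjI allI impI)
  show "\<forall>k\<in>I. i k \<in> Hom T (X k) P" using assms(1) by simp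
  fix Q f
  assume *: "\<forall>k\<in>I. f k \<in> Hom T (X k) Q"
  then obtain u where "src T u = P \<and> tgt T u = Q \<and> (\<forall>k\<in>I. u \<cdot> i k = f k)"
    using assms(2)[of f Q] by auto
  then show "\<exists>!u. u \<in> Hom T P Q \<and> (\<forall>k\<in>I. u \<cdot> i k = f k)"
    by (intro ex1I[of _ u]) (auto intro: assms(3))
qed

lemma product_arr: "is_product T I X P p \<Longrightarrow> k \<in> I \<Longrightarrow> src T (p k) = P \<and> tgt T (p k) = X k"
  unfolding is_product_def by simp

lemma product_ex:
  assumes "is_product T I X P p" "\<And>k. k \<in> I \<Longrightarrow> src T (f k) = Q \<and> tgt T (f k) = X k"
  obtains u where "src T u = Q" "tgt T u = P" "\<And>k. k \<in> I \<Longrightarrow> p k \<cdot> u = f k"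
proof -
  have "\<forall>k\<in>I. f k \<in> Hom T Q (X k)" using assms(2) by simp
  from ex1_implies_ex[OF product_ex1[OF assms(1) this]]
  obtain u where "u \<in> Hom T Q P \<and> (\<forall>k\<in>I. p k \<cdot> u = f k)" ..
  then show ?thesis by (intro that[of u]) simp_all
qed

lemma product_eq:
  assumes "is_product T I X P p" "tgt T u = P" "tgt T v = P" "src T u = src T v"
    and eq: "\<And>k. k \<in> I \<Longrightarrow> p k \<cdot> u = p k \<cdot> v"
  shows "u = v"
proof -
  have "\<forall>k\<in>I. p k \<cdot> u \<in> Hom T (src T u) (X k)" using assms(2-4) product_arr[OF assms(1)] by simp
  then have "\<exists>!w. w \<in> Hom T (src T u) P \<and> (\<forall>k\<in>I. p k \<cdot> w = p k \<cdot> u)"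
    by (rule product_ex1[OF assms(1)])
  moreover have "u \<in> Hom T (src T u) P" "v \<in> Hom T (src T u) P" using assms(2-4) by simp_all
  ultimately show ?thesis using eq by (metis (no_types))
qed

lemma productI:
  assumes "\<And>k. k \<in> I \<Longrightarrow> src T (p k) = P \<and> tgt T (p k) = X k"
    and "\<And>Q f. (\<And>k. k \<in> I \<Longrightarrow> src T (f k) = Q \<and> tgt T (f k) = X k) \<Longrightarrow>
      \<exists>u. src T u = Q \<and> tgt T u = P \<and> (\<forall>k\<in>I. p k \<cdot> u = f k)"
    and "\<And>Q u v. tgt T u = P \<Longrightarrow> tgt T v = P \<Longrightarrow> src T u = Q \<Longrightarrow> src T v = Q \<Longrightarrow>
      (\<And>k. k \<in> I \<Longrightarrow> p k \<cdot> u = p k \<cdot> v) \<Longrightarrow> u = v"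
  shows "is_product T I X P p"
  unfolding is_product_def
proof (intro conjI allI impI)
  show "\<forall>k\<in>I. p k \<in> Hom T P (X k)" using assms(1) by simp
  fix Q f
  assume *: "\<forall>k\<in>I. f k \<in> Hom T Q (X k)"
  then obtain u where "src T u = Q \<and> tgt T u = P \<and> (\<forall>k\<in>I. p k \<cdot> u = f k)"
    using assms(2)[of f Q] by auto
  then show "\<exists>!u. u \<in> Hom T Q P \<and> (\<forall>k\<in>I. p k \<cdot> u = f k)"
    by (intro ex1I[of _ u]) (auto intro: assms(3))
qed

text \<open>Homotopy colimits are indexed by \<open>nat\<close>, bicontinuity by subsets of the
  universe type; an injection between the two index types carries coproduct diagrams across.\<close>

lemma coproduct_reindex:
  assumes e: "inj_on e I" and Y: "\<And>k. k \<in> I \<Longrightarrow> Y (e k) = X k \<and> j (e k) = i k"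
  shows "is_coproduct T (e ` I) Y P j \<longleftrightarrow> is_coproduct T I X P i"
proof
  assume *: "is_coproduct T (e ` I) Y P j"
  show "is_coproduct T I X P i"
    unfolding is_coproduct_def
  proof (intro conjI allI impI)
    show "\<forall>k\<in>I. i k \<in> Hom T (X k) P"
      using coproduct_arr[OF *, OF imageI] Y by fastforce
    fix Q f assume f: "\<forall>k\<in>I. f k \<in> Hom T (X k) Q"
    have "\<forall>k\<in>e ` I. (f \<circ> the_inv_into I e) k \<in> Hom T (Y k) Q"
      using f Y by (auto simp: the_inv_into_f_f[OF e])
    then have "\<exists>!u. u \<in> Hom T P Q \<and> (\<forall>k\<in>e ` I. u \<cdot> j k = (f \<circ> the_inv_into I e) k)"
      by (rule coproduct_ex1[OF *])
    then show "\<exists>!u. u \<in> Hom T P Q \<and> (\<forall>k\<in>I. u \<cdot> i k = f k)"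
      using Y by (simp add: the_inv_into_f_f[OF e])
  qed
next
  assume *: "is_coproduct T I X P i"
  show "is_coproduct T (e ` I) Y P j"
    unfolding is_coproduct_def
  proof (intro conjI allI impI)
    show "\<forall>k\<in>e ` I. j k \<in> Hom T (Y k) P" using coproduct_arr[OF *] Y by auto
    fix Q f assume f: "\<forall>k\<in>e ` I. f k \<in> Hom T (Y k) Q"
    have "\<forall>k\<in>I. (f \<circ> e) k \<in> Hom T (X k) Q"
      using f Y by auto
    then have "\<exists>!u. u \<in> Hom T P Q \<and> (\<forall>k\<in>I. u \<cdot> i k = (f \<circ> e) k)"
      by (rule coproduct_ex1[OF *])
    then show "\<exists>!u. u \<in> Hom T P Q \<and> (\<forall>k\<in>e ` I. u \<cdot> j k = f k)"
      using Y by simp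
  qed
qed

lemma product_reindex:
  assumes e: "inj_on e I" and Y: "\<And>k. k \<in> I \<Longrightarrow> Y (e k) = X k \<and> q (e k) = p k"
  shows "is_product T (e ` I) Y P q \<longleftrightarrow> is_product T I X P p"
proof
  assume *: "is_product T (e ` I) Y P q"
  show "is_product T I X P p"
    unfolding is_product_def
  proof (intro conjI allI impI)
    show "\<forall>k\<in>I. p k \<in> Hom T P (X k)"
      using product_arr[OF *, OF imageI] Y by fastforce
    fix Q f assume f: "\<forall>k\<in>I. f k \<in> Hom T Q (X k)"
    have "\<forall>k\<in>e ` I. (f \<circ> the_inv_into I e) k \<in> Hom T Q (Y k)"
      using f Y by (auto simp: the_inv_into_f_f[OF e])
    then have "\<exists>!u. u \<in> Hom T Q P \<and> (\<forall>k\<in>e ` I. q k \<cdot> u = (f \<circ> the_inv_into I e) k)"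
      by (rule product_ex1[OF *])
    then show "\<exists>!u. u \<in> Hom T Q P \<and> (\<forall>k\<in>I. p k \<cdot> u = f k)"
      using Y by (simp add: the_inv_into_f_f[OF e])
  qed
next
  assume *: "is_product T I X P p"
  show "is_product T (e ` I) Y P q"
    unfolding is_product_def
  proof (intro conjI allI impI)
    show "\<forall>k\<in>e ` I. q k \<in> Hom T P (Y k)" using product_arr[OF *] Y by auto
    fix Q f assume f: "\<forall>k\<in>e ` I. f k \<in> Hom T Q (Y k)"
    have "\<forall>k\<in>I. (f \<circ> e) k \<in> Hom T Q (X k)"
      using f Y by auto
    then have "\<exists>!u. u \<in> Hom T Q P \<and> (\<forall>k\<in>I. p k \<cdot> u = (f \<circ> e) k)"
      by (rule product_ex1[OF *])
    then show "\<exists>!u. u \<in> Hom T Q P \<and> (\<forall>k\<in>e ` I. q k \<cdot> u = f k)"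
      using Y by simp
  qed
qed

section \<open>Functors, natural isomorphisms and equivalences\<close>

lemma functor_simps:
  assumes "is_functor T T F"
  shows "src T (far F f) = fob F (src T f)" "tgt T (far F f) = fob F (tgt T f)"
    "far F (idt T X) = idt T (fob F X)"
    "tgt T f = src T g \<Longrightarrow> far F (g \<cdot> f) = far F g \<cdot> far F f"
  using assms by (simp_all add: is_functor_def)

lemma functor_iso:
  assumes "is_functor T T F" "is_iso T f"
  shows "is_iso T (far F f)"
proof -
  note [simp] = functor_simps[OF assms(1)] inv_simps[OF assms(2)]
  have "far F (arr_inv T f \<cdot> f) = idt T (fob F (src T f))"
    "far F (f \<cdot> arr_inv T f) = idt T (fob F (tgt T f))"
    by (simp_all only: inv_left[OF assms(2)] inv_right[OF assms(2)] functor_simps(3)[OF assms(1)])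
  moreover have "far F (arr_inv T f \<cdot> f) = far F (arr_inv T f) \<cdot> far F f"
    "far F (f \<cdot> arr_inv T f) = far F f \<cdot> far F (arr_inv T f)"
    by (rule functor_simps(4)[OF assms(1)], simp)+
  ultimately show ?thesis
    by (intro isoI[of "far F (arr_inv T f)"]) simp_all
qed

lemma functor_isomorphic: "is_functor T T F \<Longrightarrow> isomorphic T X Y \<Longrightarrow> isomorphic T (fob F X) (fob F Y)"
proof -
  assume F: "is_functor T T F" and "isomorphic T X Y"
  then obtain f where f: "src T f = X" "tgt T f = Y" "is_iso T f" unfolding isomorphic_def by auto
  show ?thesis
    by (rule isomorphicI[of "far F f"]) (use functor_iso[OF F f(3)] functor_simps[OF F] f in simp_all)
qed

lemma natural_isoD:
  assumes "natural_iso_on T T A F G \<alpha>"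
  shows "X \<in> A \<Longrightarrow> src T (\<alpha> X) = fob F X" "X \<in> A \<Longrightarrow> tgt T (\<alpha> X) = fob G X"
    "X \<in> A \<Longrightarrow> is_iso T (\<alpha> X)"
    "src T f \<in> A \<Longrightarrow> tgt T f \<in> A \<Longrightarrow> \<alpha> (tgt T f) \<cdot> far F f = far G f \<cdot> \<alpha> (src T f)"
  using assms by (simp_all add: natural_iso_on_def)

text \<open>By naturality \<open>f\<close> is the conjugate by \<open>\<alpha>\<close> of its image
  under H F, hence is determined by \<open>far F f\<close>.\<close>

lemma faithful_of_natural_iso:
  assumes H: "is_functor T T H" and F: "is_functor T T F"
    and \<alpha>: "natural_iso T T (comp_functor H F) id_functor \<alpha>"
    and eq: "src T f = src T g" "tgt T f = tgt T g" "far F f = far F g"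
  shows "f = g"
proof -
  note a = natural_isoD[OF \<alpha>]
  have "f \<cdot> \<alpha> (src T f) = g \<cdot> \<alpha> (src T f)"
    using a(4)[of f] a(4)[of g] eq by (simp add: comp_functor_def id_functor_def)
  then show ?thesis
    by (rule iso_cancel_right[of "\<alpha> (src T f)", rotated 3])
      (use eq a(1-3)[of "src T f"] in \<open>simp_all add: id_functor_def\<close>)
qed

text \<open>The preimage is \<open>far H f\<close> conjugated by \<open>\<alpha>\<close>. It is sent
  to the right arrow after applying H, and H is faithful because of \<open>\<beta>\<close>.\<close>

lemma full_of_natural_iso:
  assumes H: "is_functor T T H" and F: "is_functor T T F"
    and \<alpha>: "natural_iso T T (comp_functor H F) id_functor \<alpha>"
    and \<beta>: "natural_iso T T (comp_functor F H) id_functor \<beta>"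
    and f: "src T f = fob F X" "tgt T f = fob F Y"
  obtains g where "src T g = X" "tgt T g = Y" "far F g = f"
proof -
  note a = natural_isoD[OF \<alpha>] note [simp] = a(1-3) functor_simps[OF F] functor_simps[OF H]
  define g where "g = \<alpha> Y \<cdot> (far H f \<cdot> arr_inv T (\<alpha> X))"
  have g: "src T g = X" "tgt T g = Y"
    using f by (simp_all add: g_def comp_functor_def id_functor_def inv_simps)
  have "\<alpha> Y \<cdot> far H (far F g) = g \<cdot> \<alpha> X"
    using a(4)[of g] g by (simp add: comp_functor_def id_functor_def)
  also have "\<dots> = \<alpha> Y \<cdot> far H f"
    using f by (simp add: g_def comp_functor_def id_functor_def inv_simps)
  finally have "far H (far F g) = far H f"
    by (rule iso_cancel_left[rotated 3]) (use f g in \<open>simp_all add: comp_functor_def\<close>)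
  then have "far F g = f"
    by (rule faithful_of_natural_iso[OF F H \<beta>, rotated 2]) (use f g in simp_all)
  then show ?thesis using g that by blast
qed

end

context additive_category
begin

section \<open>The calculus of Hom groups\<close>

lemma Hom_group_simps [simp]: "carrier (Hom_group T X Y) = Hom T X Y"
  "mult (Hom_group T X Y) = madd T" "one (Hom_group T X Y) = zarr T X Y"
  by (simp_all add: Hom_group_def)

lemma Hom_grp: "group (Hom_group T X Y)"
  using Hom_comm_group comm_group_def by blast

lemma src_zarr [simp]: "src T (zarr T X Y) = X" and tgt_zarr [simp]: "tgt T (zarr T X Y) = Y"
  using monoid.one_closed[of "Hom_group T X Y"] Hom_grp[of X Y] by (auto simp: group_def)

lemma src_madd [simp]: "src T f = src T g \<Longrightarrow> tgt T f = tgt T g \<Longrightarrow> src T (madd T f g) = src T f"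
  and tgt_madd [simp]: "src T f = src T g \<Longrightarrow> tgt T f = tgt T g \<Longrightarrow> tgt T (madd T f g) = tgt T f"
  using monoid.m_closed[of "Hom_group T (src T f) (tgt T f)" f g] Hom_grp[of "src T f" "tgt T f"]
  by (auto simp: group_def)

lemma src_mneg [simp]: "src T (mneg T f) = src T f" and tgt_mneg [simp]: "tgt T (mneg T f) = tgt T f"
  using group.inv_closed[OF Hom_grp[of "src T f" "tgt T f"], of f] by (auto simp: mneg_def)

lemma src_msub [simp]: "src T f = src T g \<Longrightarrow> tgt T f = tgt T g \<Longrightarrow> src T (msub T f g) = src T f"
  and tgt_msub [simp]: "src T f = src T g \<Longrightarrow> tgt T f = tgt T g \<Longrightarrow> tgt T (msub T f g) = tgt T f"
  by (simp_all add: msub_def)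

lemma madd_zarr [simp]: "src T f = X \<Longrightarrow> tgt T f = Y \<Longrightarrow> madd T f (zarr T X Y) = f"
  "src T f = X \<Longrightarrow> tgt T f = Y \<Longrightarrow> madd T (zarr T X Y) f = f"
  using monoid.r_one[of "Hom_group T X Y" f] monoid.l_one[of "Hom_group T X Y" f] Hom_grp[of X Y]
  by (auto simp: group_def)

lemma madd_mneg [simp]: "madd T f (mneg T f) = zarr T (src T f) (tgt T f)"
  "madd T (mneg T f) f = zarr T (src T f) (tgt T f)"
  using group.r_inv[OF Hom_grp[of "src T f" "tgt T f"], of f]
    group.l_inv[OF Hom_grp[of "src T f" "tgt T f"], of f] by (auto simp: mneg_def)

lemma msub_self [simp]: "msub T f f = zarr T (src T f) (tgt T f)"
  by (simp add: msub_def)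

lemma madd_assoc: "src T f = src T g \<Longrightarrow> tgt T f = tgt T g \<Longrightarrow> src T h = src T g \<Longrightarrow> tgt T h = tgt T g \<Longrightarrow>
  madd T (madd T f g) h = madd T f (madd T g h)"
  using monoid.m_assoc[of "Hom_group T (src T f) (tgt T f)" f g h] Hom_grp[of "src T f" "tgt T f"]
  by (auto simp: group_def)

lemma madd_commute: "src T f = src T g \<Longrightarrow> tgt T f = tgt T g \<Longrightarrow> madd T f g = madd T g f"
  using comm_monoid.m_comm[of "Hom_group T (src T f) (tgt T f)" f g]
    Hom_comm_group[of "src T f" "tgt T f"] by (auto simp: comm_group_def)

lemma madd_cancel:
  assumes "src T f = src T g" "tgt T f = tgt T g" "src T h = src T g" "tgt T h = tgt T g"
    and eq: "madd T f g = madd T f h"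
  shows "g = h"
proof -
  have "madd T (madd T (mneg T f) f) g = madd T (madd T (mneg T f) f) h"
    using assms by (subst (1 2) madd_assoc) simp_all
  moreover have "madd T (madd T (mneg T f) f) g = g" "madd T (madd T (mneg T f) f) h = h"
    using assms(1-4) by simp_all
  ultimately show ?thesis by argo
qed

lemma mneg_mneg [simp]: "mneg T (mneg T f) = f"
  using group.inv_inv[OF Hom_grp[of "src T f" "tgt T f"], of f]
    src_mneg[of f] tgt_mneg[of f] by (simp add: mneg_def)

lemma mneg_unique:
  assumes "src T f = src T g" "tgt T f = tgt T g" "madd T f g = zarr T (src T f) (tgt T f)"
  shows "g = mneg T f"
  by (rule madd_cancel[of f]) (use assms in simp_all)

lemma madd_msub [simp]: "src T f = src T g \<Longrightarrow> tgt T f = tgt T g \<Longrightarrow> madd T (msub T f g) g = f"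
  by (simp add: msub_def madd_assoc)

lemma msub_zero: "src T f = src T g \<Longrightarrow> tgt T f = tgt T g \<Longrightarrow> msub T f g = zarr T X Y \<Longrightarrow> f = g"
  by (metis madd_msub madd_zarr(2) src_msub src_zarr tgt_msub tgt_zarr)

lemma cmp_madd [simp]: "src T f = src T f' \<Longrightarrow> tgt T f = tgt T f' \<Longrightarrow> tgt T f = src T g \<Longrightarrow>
    g \<cdot> madd T f f' = madd T (g \<cdot> f) (g \<cdot> f')"
  "src T g = src T g' \<Longrightarrow> tgt T g = tgt T g' \<Longrightarrow> tgt T f = src T g \<Longrightarrow>
    madd T g g' \<cdot> f = madd T (g \<cdot> f) (g' \<cdot> f)"
  using cmp_madd_right[of f "src T f" "tgt T f" f' g "tgt T g"]
    cmp_madd_left[of f "src T f" "src T g" g "tgt T g" g'] by simp_all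

lemma cmp_zarr [simp]: "src T g = Y \<Longrightarrow> g \<cdot> zarr T X Y = zarr T X (tgt T g)"
proof -
  assume g: "src T g = Y"
  have "madd T (g \<cdot> zarr T X Y) (g \<cdot> zarr T X Y) = g \<cdot> madd T (zarr T X Y) (zarr T X Y)"
    using g by (subst cmp_madd) simp_all
  then have "madd T (g \<cdot> zarr T X Y) (g \<cdot> zarr T X Y) = madd T (g \<cdot> zarr T X Y) (zarr T X (tgt T g))"
    using g by simp
  then show ?thesis using g 
    by - (rule madd_cancel[of "g \<cdot> zarr T X Y"]; simp)
qed

lemma zarr_cmp [simp]: "tgt T f = X \<Longrightarrow> zarr T X Y \<cdot> f = zarr T (src T f) Y"
proof -
  assume g: "tgt T f = X"
  have "madd T (zarr T X Y \<cdot> f) (zarr T X Y \<cdot> f) = madd T (zarr T X Y) (zarr T X Y) \<cdot> f"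
    using g by (subst cmp_madd) simp_all
  then have "madd T (zarr T X Y \<cdot> f) (zarr T X Y \<cdot> f) = madd T (zarr T X Y \<cdot> f) (zarr T (src T f) Y)"
    using g by simp
  then show ?thesis using g 
    by - (rule madd_cancel[of "zarr T X Y \<cdot> f"]; simp)
qed

lemma cmp_mneg [simp]: "tgt T f = src T g \<Longrightarrow> g \<cdot> mneg T f = mneg T (g \<cdot> f)"
  by (rule mneg_unique) (simp_all flip: cmp_madd)

lemma mneg_cmp [simp]: "tgt T f = src T g \<Longrightarrow> mneg T g \<cdot> f = mneg T (g \<cdot> f)"
  by (rule mneg_unique) (simp_all flip: cmp_madd)

lemma mneg_inj [simp]: "mneg T f = mneg T g \<longleftrightarrow> f = g"
  by (metis mneg_mneg)

lemma mneg_zarr [simp]: "mneg T (zarr T X Y) = zarr T X Y"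
  by (rule mneg_unique[symmetric]) simp_all

lemma cmp_msub [simp]: "src T f = src T f' \<Longrightarrow> tgt T f = tgt T f' \<Longrightarrow> tgt T f = src T g \<Longrightarrow>
    g \<cdot> msub T f f' = msub T (g \<cdot> f) (g \<cdot> f')"
  by (simp add: msub_def)

lemma msub_cmp [simp]: "src T g = src T g' \<Longrightarrow> tgt T g = tgt T g' \<Longrightarrow> tgt T f = src T g \<Longrightarrow>
    msub T g g' \<cdot> f = msub T (g \<cdot> f) (g' \<cdot> f)"
  by (simp add: msub_def)

lemma additive_madd: "is_additive_functor T T F \<Longrightarrow> src T f = src T g \<Longrightarrow> tgt T f = tgt T g \<Longrightarrow>
    far F (madd T f g) = madd T (far F f) (far F g)"
  by (simp add: is_additive_functor_def)

lemma additive_functor: "is_additive_functor T T F \<Longrightarrow> is_functor T T F"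
  by (simp add: is_additive_functor_def)

lemma additive_zarr:
  assumes "is_additive_functor T T F"
  shows "far F (zarr T X Y) = zarr T (fob F X) (fob F Y)"
proof -
  have "madd T (far F (zarr T X Y)) (far F (zarr T X Y)) = far F (zarr T X Y)"
    by (simp flip: additive_madd[OF assms])
  then show ?thesis
    
    by - (rule madd_cancel[of "far F (zarr T X Y)"]; simp add: functor_simps[OF additive_functor[OF assms]])
qed

lemma additive_mneg:
  assumes "is_additive_functor T T F"
  shows "far F (mneg T f) = mneg T (far F f)"
  by (rule mneg_unique)
    (simp_all add: additive_zarr[OF assms] functor_simps[OF additive_functor[OF assms]]
      flip: additive_madd[OF assms])

section \<open>Vanishing of Hom between two objects, and zero objects\<close>

definition hom0 :: "'o \<Rightarrow> 'o \<Rightarrow> bool"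
  where "hom0 X Y \<longleftrightarrow> (\<forall>f. src T f = X \<longrightarrow> tgt T f = Y \<longrightarrow> f = zarr T X Y)"

lemma hom0D: "hom0 X Y \<Longrightarrow> src T f = X \<Longrightarrow> tgt T f = Y \<Longrightarrow> f = zarr T X Y"
  by (simp add: hom0_def)

lemma Hom_vanishes_iff: "Hom_vanishes T A B \<longleftrightarrow> (\<forall>X\<in>A. \<forall>Y\<in>B. hom0 X Y)"
proof -
  have "Hom T X Y = {zarr T X Y} \<longleftrightarrow> hom0 X Y" for X Y
    using src_zarr[of X Y] tgt_zarr[of X Y] unfolding hom0_def Hom_def by blast
  then show ?thesis unfolding Hom_vanishes_def by simp
qed

lemma hom0_iso:
  assumes "hom0 X Y" "isomorphic T X X'" "isomorphic T Y Y'"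
  shows "hom0 X' Y'"
  unfolding hom0_def
proof (intro allI impI)
  fix f assume f: "src T f = X'" "tgt T f = Y'"
  obtain a b where a: "src T a = X" "tgt T a = X'" "is_iso T a" and b: "src T b = Y" "tgt T b = Y'" "is_iso T b"
    using assms unfolding isomorphic_def by auto
  have "arr_inv T b \<cdot> (f \<cdot> a) = zarr T X Y"
    by (rule hom0D[OF assms(1)]) (use a b f in \<open>simp_all add: inv_simps\<close>)
  then have "b \<cdot> ((arr_inv T b \<cdot> (f \<cdot> a)) \<cdot> arr_inv T a) = zarr T X' Y'"
    using a b by (simp add: inv_simps)
  then show "f = zarr T X' Y'" using a b f by (simp add: inv_simps)
qed

lemma hom0_coproduct:
  assumes "is_coproduct T I X P i" "\<And>k. k \<in> I \<Longrightarrow> hom0 (X k) Y"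
  shows "hom0 P Y"
  unfolding hom0_def
proof (intro allI impI)
  fix f assume f: "src T f = P" "tgt T f = Y"
  show "f = zarr T P Y"
    using f coproduct_arr[OF assms(1)] assms(2)
    
    by - (rule coproduct_eq[OF assms(1)]; force simp: hom0_def)
qed

lemma hom0_product:
  assumes "is_product T I Y P p" "\<And>k. k \<in> I \<Longrightarrow> hom0 X (Y k)"
  shows "hom0 X P"
  unfolding hom0_def
proof (intro allI impI)
  fix f assume f: "src T f = X" "tgt T f = P"
  show "f = zarr T X P"
    using f product_arr[OF assms(1)] assms(2)
    
    by - (rule product_eq[OF assms(1)]; force simp: hom0_def)
qed

lemma zero_object_arr: "is_zero_object T Z \<Longrightarrow> src T f = Z \<Longrightarrow> f = zarr T Z (tgt T f)"
  "is_zero_object T Z \<Longrightarrow> tgt T f = Z \<Longrightarrow> f = zarr T (src T f) Z"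
proof -
  assume Z: "is_zero_object T Z"
  have "f \<in> Hom T Z (tgt T f)" "zarr T Z (tgt T f) \<in> Hom T Z (tgt T f)" if "src T f = Z"
    using that by simp_all
  then show "src T f = Z \<Longrightarrow> f = zarr T Z (tgt T f)"
    using Z unfolding is_zero_object_def by blast
  have "f \<in> Hom T (src T f) Z" "zarr T (src T f) Z \<in> Hom T (src T f) Z" if "tgt T f = Z"
    using that by simp_all
  then show "tgt T f = Z \<Longrightarrow> f = zarr T (src T f) Z"
    using Z unfolding is_zero_object_def by blast
qed

lemma zero_objectI: "idt T Z = zarr T Z Z \<Longrightarrow> is_zero_object T Z"
  unfolding is_zero_object_def
proof (intro allI conjI)
  fix X
  assume *: "idt T Z = zarr T Z Z"
  have "f = zarr T X Z" if "src T f = X" "tgt T f = Z" for f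
    using zarr_cmp[of f Z Z] idt_left[of f Z] that * by simp
  then show "\<exists>!f. f \<in> Hom T X Z"
    by (intro ex1I[of _ "zarr T X Z"]) simp_all
  have "f = zarr T Z X" if "src T f = Z" "tgt T f = X" for f
    using cmp_zarr[of f Z Z] idt_right[of f Z] that * by simp
  then show "\<exists>!f. f \<in> Hom T Z X"
    by (intro ex1I[of _ "zarr T Z X"]) simp_all
qed

end

section \<open>Exact triangles\<close>

context triangulated_category
begin

abbreviation So :: "'o \<Rightarrow> 'o" where "So \<equiv> fob (Sus T)"
abbreviation Sa :: "'m \<Rightarrow> 'm" where "Sa \<equiv> far (Sus T)"

section \<open>The suspension as a fully faithful and essentially surjective functor\<close>

lemma Sus_functor: "is_functor T T (Sus T)"
  using Sus_additive by (rule additive_functor)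

lemma Sus_simps [simp]:
  "src T (Sa f) = So (src T f)" "tgt T (Sa f) = So (tgt T f)" "Sa (idt T X) = idt T (So X)"
  "tgt T f = src T g \<Longrightarrow> Sa (g \<cdot> f) = Sa g \<cdot> Sa f"
  "Sa (zarr T X Y) = zarr T (So X) (So Y)" "Sa (mneg T f) = mneg T (Sa f)"
  "src T f = src T g \<Longrightarrow> tgt T f = tgt T g \<Longrightarrow> Sa (madd T f g) = madd T (Sa f) (Sa g)"
  "src T f = src T g \<Longrightarrow> tgt T f = tgt T g \<Longrightarrow> Sa (msub T f g) = msub T (Sa f) (Sa g)"
  using functor_simps[OF Sus_functor] additive_zarr[OF Sus_additive] additive_mneg[OF Sus_additive]
    additive_madd[OF Sus_additive]
  by (simp_all add: msub_def)

lemma Sus_faithful: "Sa f = Sa g \<Longrightarrow> src T f = src T g \<Longrightarrow> tgt T f = tgt T g \<Longrightarrow> f = g"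
  using Sus_equivalence unfolding is_equivalence_def by (blast intro: faithful_of_natural_iso)

lemma Sus_full:
  assumes "src T f = So X" "tgt T f = So Y"
  obtains g where "src T g = X" "tgt T g = Y" "Sa g = f"
proof -
  obtain H \<alpha> \<beta> where "is_functor T T H"
    "natural_iso T T (comp_functor H (Sus T)) id_functor \<alpha>"
    "natural_iso T T (comp_functor (Sus T) H) id_functor \<beta>"
    using Sus_equivalence unfolding is_equivalence_def by blast
  from full_of_natural_iso[OF this(1) Sus_functor this(2,3) assms] show ?thesis using that .
qed

lemma Sus_iso: "is_iso T (Sa f) \<longleftrightarrow> is_iso T f"
proof
  assume *: "is_iso T (Sa f)"
  obtain g where g: "src T g = tgt T f" "tgt T g = src T f" "Sa g = arr_inv T (Sa f)"
    using Sus_full[of "arr_inv T (Sa f)" "tgt T f" "src T f"] inv_simps[OF *] by auto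
  then have "Sa (g \<cdot> f) = Sa (idt T (src T f))" "Sa (f \<cdot> g) = Sa (idt T (tgt T f))"
    using inv_simps[OF *] by simp_all
  from this[THEN Sus_faithful] have "g \<cdot> f = idt T (src T f)" "f \<cdot> g = idt T (tgt T f)"
    using g(1,2) by simp_all
  then show "is_iso T f" using g by (intro isoI[of g])
qed (rule functor_iso[OF Sus_functor])

text \<open>Replaces an inverse of \<Sigma>: \<open>X\<close> plays the part of the desuspension of
  \<open>Y\<close>, and \<open>f\<close> is the price for \<Sigma> being only an
  autoequivalence.\<close>

lemma Sus_ess_surj: obtains X f where "is_iso T f" "src T f = So X" "tgt T f = Y"
proof -
  obtain H \<beta> where *: "natural_iso T T (comp_functor (Sus T) H) id_functor \<beta>"
    using Sus_equivalence unfolding is_equivalence_def by blast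
  from natural_isoD(1-3)[OF this, of Y] show ?thesis
    by (intro that[of "\<beta> Y" "fob H Y"]) (simp_all add: comp_functor_def id_functor_def)
qed

lemma Sus_isomorphic: "isomorphic T (So X) (So Y) \<longleftrightarrow> isomorphic T X Y"
proof
  assume "isomorphic T (So X) (So Y)"
  then obtain f where f: "src T f = So X" "tgt T f = So Y" "is_iso T f"
    unfolding isomorphic_def by auto
  obtain g where "src T g = X" "tgt T g = Y" "Sa g = f" using Sus_full[OF f(1,2)] .
  with f show "isomorphic T X Y" by (intro isomorphicI[of g]) (auto simp: Sus_iso)
qed (rule functor_isomorphic[OF Sus_functor])

lemma Sus_zero_object:
  assumes "is_zero_object T Z" shows "is_zero_object T (So Z)"
proof (rule zero_objectI)
  have "idt T Z = zarr T Z Z" using zero_object_arr(1)[OF assms, of "idt T Z"] by simp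
  then have "Sa (idt T Z) = Sa (zarr T Z Z)" by (rule arg_cong)
  then show "idt T (So Z) = zarr T (So Z) (So Z)" by simp
qed

text \<open>The test object is replaced by an isomorphic suspension \<open>So Q'\<close>; full
  faithfulness of \<Sigma> then moves the universal property to the given coproduct.\<close>

lemma Sus_coproduct:
  assumes "is_coproduct T I X P i"
  shows "is_coproduct T I (So \<circ> X) (So P) (Sa \<circ> i)"
proof (rule coproductI)
  note i = coproduct_arr[OF assms]
  show "src T ((Sa \<circ> i) k) = (So \<circ> X) k \<and> tgt T ((Sa \<circ> i) k) = So P" if "k \<in> I" for k
    using i[OF that] by simp
next
  fix Q f assume f: "\<And>k. k \<in> I \<Longrightarrow> src T (f k) = (So \<circ> X) k \<and> tgt T (f k) = Q"
  note i = coproduct_arr[OF assms]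
  obtain Q' e where e: "is_iso T e" "src T e = So Q'" "tgt T e = Q" by (rule Sus_ess_surj)
  have "\<exists>g. src T g = X k \<and> tgt T g = Q' \<and> Sa g = arr_inv T e \<cdot> f k" if "k \<in> I" for k
    using Sus_full[of "arr_inv T e \<cdot> f k" "X k" Q'] f[OF that] e inv_simps[OF e(1)] by auto
  then obtain g where g: "\<And>k. k \<in> I \<Longrightarrow> src T (g k) = X k \<and> tgt T (g k) = Q' \<and> Sa (g k) = arr_inv T e \<cdot> f k"
    by metis
  obtain u where u: "src T u = P" "tgt T u = Q'" "\<And>k. k \<in> I \<Longrightarrow> u \<cdot> i k = g k"
    using coproduct_ex[OF assms, of g Q'] g by blast
  have "e \<cdot> Sa u \<cdot> (Sa \<circ> i) k = f k" if k: "k \<in> I" for k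
  proof -
    have "Sa u \<cdot> Sa (i k) = Sa (g k)"
      using u(1) i[OF k] by (simp flip: u(3)[OF k])
    then show ?thesis
      using g[OF k] f[OF k] i[OF k] e u(1,2) inv_simps[OF e(1)] by simp
  qed
  then show "\<exists>u. src T u = So P \<and> tgt T u = Q \<and> (\<forall>k\<in>I. u \<cdot> (Sa \<circ> i) k = f k)"
    using e u(1,2) by (intro exI[of _ "e \<cdot> Sa u"]) simp
next
  fix Q u v assume uv: "src T u = So P" "src T v = So P" "tgt T u = Q" "tgt T v = Q"
    and eq: "\<And>k. k \<in> I \<Longrightarrow> u \<cdot> (Sa \<circ> i) k = v \<cdot> (Sa \<circ> i) k"
  note i = coproduct_arr[OF assms]
  obtain Q' e where e: "is_iso T e" "src T e = So Q'" "tgt T e = Q" by (rule Sus_ess_surj)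
  note [simp] = inv_simps[OF e(1)] e(2,3) uv
  obtain u' where u: "src T u' = P" "tgt T u' = Q'" "Sa u' = arr_inv T e \<cdot> u"
    using Sus_full[of "arr_inv T e \<cdot> u" P Q'] by auto
  obtain v' where v: "src T v' = P" "tgt T v' = Q'" "Sa v' = arr_inv T e \<cdot> v"
    using Sus_full[of "arr_inv T e \<cdot> v" P Q'] by auto
  have "u' = v'"
  proof (rule coproduct_eq[OF assms])
    fix k assume k: "k \<in> I"
    then have "Sa (u' \<cdot> i k) = Sa (v' \<cdot> i k)"
      using u v i[OF k] eq[OF k] by simp
    then show "u' \<cdot> i k = v' \<cdot> i k"
      by (rule Sus_faithful) (use u v i[OF k] in simp_all)
  qed (use u v in simp_all)
  then have "e \<cdot> Sa u' = e \<cdot> Sa v'" by simp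
  then show "u = v" using u(3) v(3) by simp
qed

lemma Sus_product:
  assumes "is_product T I X P p"
  shows "is_product T I (So \<circ> X) (So P) (Sa \<circ> p)"
proof (rule productI)
  note p = product_arr[OF assms]
  show "src T ((Sa \<circ> p) k) = So P \<and> tgt T ((Sa \<circ> p) k) = (So \<circ> X) k" if "k \<in> I" for k
    using p[OF that] by simp
next
  fix Q f assume f: "\<And>k. k \<in> I \<Longrightarrow> src T (f k) = Q \<and> tgt T (f k) = (So \<circ> X) k"
  note p = product_arr[OF assms]
  obtain Q' e where e: "is_iso T e" "src T e = So Q'" "tgt T e = Q" by (rule Sus_ess_surj)
  have "\<exists>g. src T g = Q' \<and> tgt T g = X k \<and> Sa g = f k \<cdot> e" if "k \<in> I" for k
    using Sus_full[of "f k \<cdot> e" Q' "X k"] f[OF that] e by auto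
  then obtain g where g: "\<And>k. k \<in> I \<Longrightarrow> src T (g k) = Q' \<and> tgt T (g k) = X k \<and> Sa (g k) = f k \<cdot> e"
    by metis
  obtain u where u: "src T u = Q'" "tgt T u = P" "\<And>k. k \<in> I \<Longrightarrow> p k \<cdot> u = g k"
    using product_ex[OF assms, of g Q'] g by blast
  have "(Sa \<circ> p) k \<cdot> (Sa u \<cdot> arr_inv T e) = f k" if k: "k \<in> I" for k
  proof -
    have "Sa (p k) \<cdot> Sa u = Sa (g k)"
      using u(2) p[OF k] by (simp flip: u(3)[OF k])
    then have "Sa (p k) \<cdot> (Sa u \<cdot> arr_inv T e) = Sa (g k) \<cdot> arr_inv T e"
      by (rule cmp_reduce) (use u(1,2) p[OF k] e inv_simps[OF e(1)] in simp_all)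
    then show ?thesis
      using g[OF k] f[OF k] p[OF k] e u(1,2) inv_simps[OF e(1)] by simp
  qed
  then show "\<exists>u. src T u = Q \<and> tgt T u = So P \<and> (\<forall>k\<in>I. (Sa \<circ> p) k \<cdot> u = f k)"
    using e u(1,2) inv_simps[OF e(1)] by (intro exI[of _ "Sa u \<cdot> arr_inv T e"]) simp
next
  fix Q u v assume uv: "tgt T u = So P" "tgt T v = So P" "src T u = Q" "src T v = Q"
    and eq: "\<And>k. k \<in> I \<Longrightarrow> (Sa \<circ> p) k \<cdot> u = (Sa \<circ> p) k \<cdot> v"
  note p = product_arr[OF assms]
  obtain Q' e where e: "is_iso T e" "src T e = So Q'" "tgt T e = Q" by (rule Sus_ess_surj)
  note [simp] = inv_simps[OF e(1)] e(2,3) uv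
  obtain u' where u: "src T u' = Q'" "tgt T u' = P" "Sa u' = u \<cdot> e"
    using Sus_full[of "u \<cdot> e" Q' P] by auto
  obtain v' where v: "src T v' = Q'" "tgt T v' = P" "Sa v' = v \<cdot> e"
    using Sus_full[of "v \<cdot> e" Q' P] by auto
  have "u' = v'"
  proof (rule product_eq[OF assms])
    fix k assume k: "k \<in> I"
    then have "Sa (p k \<cdot> u') = Sa (p k \<cdot> v')"
      using u v p[OF k] cmp_reduce[OF eq[OF k], of e] by simp
    then show "p k \<cdot> u' = p k \<cdot> v'"
      by (rule Sus_faithful) (use u v p[OF k] in simp_all)
  qed (use u v in simp_all)
  then have "u \<cdot> e = v \<cdot> e" using u(3) v(3) by simp
  then show "u = v" by (rule iso_cancel_right[OF e(1), rotated 2]) simp_all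
qed

text \<open>The vertices are parameters so that all sources and targets of a triangle become rewrite
  rules through \<open>dtri_arr\<close>.\<close>

definition dtri :: "'o \<Rightarrow> 'o \<Rightarrow> 'o \<Rightarrow> 'm \<Rightarrow> 'm \<Rightarrow> 'm \<Rightarrow> bool"
  where "dtri X Y Z f g h \<longleftrightarrow> (f, g, h) \<in> Dist T \<and> src T f = X \<and> tgt T f = Y \<and>
    src T g = Y \<and> tgt T g = Z \<and> src T h = Z \<and> tgt T h = So X"

lemma dtri_arr:
  assumes "dtri X Y Z f g h"
  shows "src T f = X" "tgt T f = Y" "src T g = Y" "tgt T g = Z" "src T h = Z" "tgt T h = So X"
  using assms by (simp_all add: dtri_def)

lemma dtriI: "(f, g, h) \<in> Dist T \<Longrightarrow> dtri (src T f) (src T g) (src T h) f g h"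
  using Dist_is_triangle unfolding dtri_def is_triangle_def by auto

lemma dtri_rotate: "dtri X Y Z f g h \<Longrightarrow> dtri Y Z (So X) g h (mneg T (Sa f))"
  unfolding dtri_def using TR2[of f g h] by (auto simp: is_triangle_def)

lemma dtri_rotate_iff:
  assumes "src T f = X" "tgt T f = Y" "src T g = Y" "tgt T g = Z" "src T h = Z" "tgt T h = So X"
  shows "dtri Y Z (So X) g h (mneg T (Sa f)) \<longleftrightarrow> dtri X Y Z f g h"
  unfolding dtri_def using TR2[of f g h] assms by (auto simp: is_triangle_def)

lemma dtri_idt:
  assumes "is_zero_object T Z"
  shows "dtri X X Z (idt T X) (zarr T X Z) (zarr T Z (So X))"
  using TR1_idt[OF assms, of X] by (simp add: dtri_def)

lemma dtri_idt':
  assumes "is_zero_object T Z"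
  shows "dtri Z X X (zarr T Z X) (idt T X) (zarr T X (So Z))"
  by (rule dtri_rotate_iff[THEN iffD1]) (use dtri_idt[OF Sus_zero_object[OF assms], of X] in simp_all)

lemma fill_third:
  assumes "dtri X Y Z f g h" "dtri X' Y' Z' f' g' h'"
    and "src T u = X" "tgt T u = X'" "src T v = Y" "tgt T v = Y'" "v \<cdot> f = f' \<cdot> u"
  obtains w where "src T w = Z" "tgt T w = Z'" "w \<cdot> g = g' \<cdot> v" "Sa u \<cdot> h = h' \<cdot> w"
  using TR3[of f g h f' g' h' u v] assms that unfolding dtri_def by auto

text \<open>The completion axiom supplies only the third morphism. After a rotation the missing
  first morphism stands in third place, between suspensions, and full faithfulness of \<Sigma>
  brings it back; the signs of the rotation cancel. Two rotations do the same for the middle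
  morphism.\<close>

lemma fill_first:
  assumes t: "dtri X Y Z f g h" "dtri X' Y' Z' f' g' h'"
    and w: "src T w = Z" "tgt T w = Z'" "src T v = Y" "tgt T v = Y'" "w \<cdot> g = g' \<cdot> v"
  obtains u where "src T u = X" "tgt T u = X'" "v \<cdot> f = f' \<cdot> u" "Sa u \<cdot> h = h' \<cdot> w"
proof -
  note [simp] = dtri_arr[OF t(1)] dtri_arr[OF t(2)] w(1-4)
  obtain t where t: "src T t = So X" "tgt T t = So X'" "t \<cdot> h = h' \<cdot> w"
    "Sa v \<cdot> mneg T (Sa f) = mneg T (Sa f') \<cdot> t"
    by (rule fill_third[OF dtri_rotate[OF t(1)] dtri_rotate[OF t(2)] w(3,4,1,2,5)])
  obtain u where u: "src T u = X" "tgt T u = X'" "Sa u = t" using Sus_full[OF t(1,2)] .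
  have "Sa (v \<cdot> f) = Sa (f' \<cdot> u)" using t u by simp
  then have "v \<cdot> f = f' \<cdot> u" by (rule Sus_faithful) (simp_all add: u)
  with u t show ?thesis by (intro that[of u]) simp_all
qed

lemma fill_middle:
  assumes t: "dtri X Y Z f g h" "dtri X' Y' Z' f' g' h'"
    and w: "src T w = Z" "tgt T w = Z'" "src T u = X" "tgt T u = X'" "Sa u \<cdot> h = h' \<cdot> w"
  obtains v where "src T v = Y" "tgt T v = Y'" "v \<cdot> f = f' \<cdot> u" "w \<cdot> g = g' \<cdot> v"
proof -
  note [simp] = dtri_arr[OF t(1)] dtri_arr[OF t(2)] w(1-4)
  have Su: "src T (Sa u) = So X" "tgt T (Sa u) = So X'" by simp_all
  obtain t where t: "src T t = So Y" "tgt T t = So Y'" "t \<cdot> mneg T (Sa f) = mneg T (Sa f') \<cdot> Sa u"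
    "Sa w \<cdot> mneg T (Sa g) = mneg T (Sa g') \<cdot> t"
    by (rule fill_third[OF dtri_rotate[OF dtri_rotate[OF t(1)]] dtri_rotate[OF dtri_rotate[OF t(2)]]
        w(1,2) Su w(5)])
  obtain v where v: "src T v = Y" "tgt T v = Y'" "Sa v = t" using Sus_full[OF t(1,2)] .
  have "Sa (v \<cdot> f) = Sa (f' \<cdot> u)" "Sa (w \<cdot> g) = Sa (g' \<cdot> v)" using t v by simp_all
  from this[THEN Sus_faithful] have "v \<cdot> f = f' \<cdot> u" "w \<cdot> g = g' \<cdot> v"
    by (simp_all add: v)
  with v show ?thesis by (rule_tac that[of v])
qed

text \<open>The triangle over the identity of \<open>X\<close> maps to the given one and has third
  vertex zero, so \<open>g \<cdot> f\<close> factors through a zero object. The other two composites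
  follow by rotation.\<close>

lemma dtri_cmp:
  assumes "dtri X Y Z f g h"
  shows "g \<cdot> f = zarr T X Z" "h \<cdot> g = zarr T Y (So X)" "Sa f \<cdot> h = zarr T Z (So Y)"
proof -
  have *: "g \<cdot> f = zarr T X Z" if t: "dtri X Y Z f g h" for X Y Z f g h
  proof -
    obtain N where N: "is_zero_object T N" using ex_zero_object by blast
    note [simp] = dtri_arr[OF t]
    have eq: "f \<cdot> idt T X = f \<cdot> idt T X" ..
    obtain w where "src T w = N" "tgt T w = Z" "w \<cdot> zarr T X N = g \<cdot> f"
      by (rule fill_third[OF dtri_idt[OF N] t _ _ _ _ eq]) simp_all
    then show ?thesis by simp
  qed
  note t1 = dtri_rotate[OF assms] note t2 = dtri_rotate[OF t1]
  show "g \<cdot> f = zarr T X Z" "h \<cdot> g = zarr T Y (So X)" by (rule *[OF assms], rule *[OF t1])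
  have "mneg T (Sa f \<cdot> h) = mneg T (zarr T Z (So Y))"
    using *[OF t2] dtri_arr[OF assms] by simp
  then show "Sa f \<cdot> h = zarr T Z (So Y)" unfolding mneg_inj .
qed

text \<open>Exactness of Hom(W, -): the vanishing of \<open>g \<cdot> a\<close> says that
  \<open>a\<close> and zero form a morphism from the triangle over the identity of \<open>W\<close>,
  and its first component is the lift.\<close>

lemma lift_Y:
  assumes t: "dtri X Y Z f g h" and a: "src T a = W" "tgt T a = Y" "g \<cdot> a = zarr T W Z"
  obtains b where "src T b = W" "tgt T b = X" "f \<cdot> b = a"
proof -
  obtain N where N: "is_zero_object T N" using ex_zero_object by blast
  note [simp] = dtri_arr[OF t] a(1,2)
  have "zarr T N Z \<cdot> zarr T W N = g \<cdot> a" using a(3) by simp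
  from fill_first[OF dtri_idt[OF N, of W] t _ _ _ _ this]
  obtain u where "src T u = W" "tgt T u = X" "a \<cdot> idt T W = f \<cdot> u" by auto
  then show ?thesis using that[of u] by simp
qed

lemma lift_Z:
  assumes t: "dtri X Y Z f g h" and a: "src T a = W" "tgt T a = Z" "h \<cdot> a = zarr T W (So X)"
  obtains b where "src T b = W" "tgt T b = Y" "g \<cdot> b = a"
  using lift_Y[OF dtri_rotate[OF t] a] .

lemma lift_SX:
  assumes t: "dtri X Y Z f g h" and a: "src T a = W" "tgt T a = So X" "Sa f \<cdot> a = zarr T W (So Y)"
  obtains b where "src T b = W" "tgt T b = Z" "h \<cdot> b = a"
proof -
  have "mneg T (Sa f) \<cdot> a = zarr T W (So Y)" using a dtri_arr[OF t] by simp
  from lift_Z[OF dtri_rotate[OF t] a(1,2) this] show ?thesis using that .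
qed

lemma extend_Y:
  assumes t: "dtri X Y Z f g h" and a: "src T a = Y" "tgt T a = W" "a \<cdot> f = zarr T X W"
  obtains b where "src T b = Z" "tgt T b = W" "b \<cdot> g = a"
proof -
  obtain N where N: "is_zero_object T N" using ex_zero_object by blast
  note [simp] = dtri_arr[OF t] a(1,2)
  have "a \<cdot> f = zarr T N W \<cdot> zarr T X N" using a(3) by simp
  from fill_third[OF t dtri_idt'[OF N, of W] _ _ _ _ this]
  obtain u where "src T u = Z" "tgt T u = W" "u \<cdot> g = idt T W \<cdot> a" by auto
  then show ?thesis using that[of u] by simp
qed

lemma extend_Z:
  assumes t: "dtri X Y Z f g h" and a: "src T a = Z" "tgt T a = W" "a \<cdot> g = zarr T Y W"
  obtains b where "src T b = So X" "tgt T b = W" "b \<cdot> h = a"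
  using extend_Y[OF dtri_rotate[OF t] a] .

lemma extend_SX:
  assumes t: "dtri X Y Z f g h" and a: "src T a = So X" "tgt T a = W" "a \<cdot> h = zarr T Z W"
  obtains b where "src T b = So Y" "tgt T b = W" "b \<cdot> Sa f = a"
proof -
  obtain b where "src T b = So Y" "tgt T b = W" "b \<cdot> mneg T (Sa f) = a"
    using extend_Z[OF dtri_rotate[OF t] a] .
  then show ?thesis using that[of "mneg T b"] dtri_arr[OF t] by simp
qed

section \<open>Isomorphisms of triangles\<close>

text \<open>The difference of \<open>e\<close> and the identity factors through both \<open>h\<close> and \<open>g\<close>, hence has square zero.\<close>

lemma iso_unipotent:
  assumes t: "dtri X Y Z f g h" and e: "src T e = Z" "tgt T e = Z" "e \<cdot> g = g" "h \<cdot> e = h"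
  shows "is_iso T e"
proof -
  note [simp] = dtri_arr[OF t] e(1,2)
  define n where "n = msub T e (idt T Z)"
  have n [simp]: "src T n = Z" "tgt T n = Z" by (simp_all add: n_def)
  have "n \<cdot> g = zarr T Y Z" "h \<cdot> n = zarr T Z (So X)" by (simp_all add: n_def e(3,4))
  moreover from this obtain b where b: "src T b = So X" "tgt T b = Z" "b \<cdot> h = n"
    using extend_Z[OF t] n by blast
  ultimately have "b \<cdot> (h \<cdot> n) = zarr T Z Z" by simp
  then have nn: "n \<cdot> n = zarr T Z Z" using b cmp_reduce[OF b(3), of n] by simp
  have en: "e = madd T n (idt T Z)" by (simp add: n_def)
  have e1: "e \<cdot> msub T (idt T Z) n = idt T Z"
    by (simp add: nn msub_def en madd_assoc madd_commute[of n])
  have e2: "msub T (idt T Z) n \<cdot> e = idt T Z"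
    by (simp add: nn msub_def en madd_assoc madd_commute[of n])
  show ?thesis by (rule isoI[of "msub T (idt T Z) n"]) (simp_all add: e1 e2)
qed

lemma iso_of_left_right_inverse:
  assumes "is_iso T (g \<cdot> f)" "is_iso T (f \<cdot> k)" "tgt T f = src T g" "tgt T k = src T f"
  shows "is_iso T f"
proof -
  let ?l = "arr_inv T (g \<cdot> f) \<cdot> g" and ?r = "k \<cdot> arr_inv T (f \<cdot> k)"
  note [simp] = assms(3,4) inv_simps[OF assms(1), simplified] inv_simps[OF assms(2), simplified]
  have l: "?l \<cdot> f = idt T (src T f)" using assms(3) inv_left[OF assms(1)] by simp
  have r: "f \<cdot> ?r = idt T (tgt T f)" using assms(4) inv_right[OF assms(2)] by simp
  have "?l \<cdot> (f \<cdot> ?r) = ?l" by (subst r) simp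
  moreover have "(?l \<cdot> f) \<cdot> ?r = ?r" by (subst l) simp
  moreover have "?l \<cdot> (f \<cdot> ?r) = (?l \<cdot> f) \<cdot> ?r" by (rule assoc[symmetric]) simp_all
  ultimately have "?l = ?r" by argo
  then show ?thesis using l r by (intro isoI[of ?r]) simp_all
qed

text \<open>A completion \<open>w'\<close> of the inverse morphisms need not invert
  \<open>w\<close>, since completions are not unique. But both composites of \<open>w\<close> and
  \<open>w'\<close> fix the adjacent morphisms of a triangle, so they are isomorphisms by
  \<open>iso_unipotent\<close>, and \<open>w\<close> has a left and a right inverse.\<close>

lemma iso_third:
  assumes t: "dtri X Y Z f g h" "dtri X' Y' Z' f' g' h'"
    and u: "src T u = X" "tgt T u = X'" "is_iso T u" and v: "src T v = Y" "tgt T v = Y'" "is_iso T v"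
    and w: "src T w = Z" "tgt T w = Z'" and eq: "v \<cdot> f = f' \<cdot> u" "w \<cdot> g = g' \<cdot> v" "Sa u \<cdot> h = h' \<cdot> w"
  shows "is_iso T w"
proof -
  note [simp] = dtri_arr[OF t(1)] dtri_arr[OF t(2)] u v w inv_simps[OF u(3)] inv_simps[OF v(3)]
  have "f \<cdot> arr_inv T u = arr_inv T v \<cdot> (v \<cdot> f) \<cdot> arr_inv T u" by simp
  also have "\<dots> = arr_inv T v \<cdot> f'" unfolding eq(1) by simp
  finally have eq': "arr_inv T v \<cdot> f' = f \<cdot> arr_inv T u" ..
  obtain w' where w': "src T w' = Z'" "tgt T w' = Z" "w' \<cdot> g' = g \<cdot> arr_inv T v"
    "Sa (arr_inv T u) \<cdot> h' = h \<cdot> w'"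
    by (rule fill_third[OF t(2,1) _ _ _ _ eq']) simp_all
  note [simp] = w'(1,2)
  have Su: "Sa (arr_inv T u) \<cdot> Sa u = idt T (So X)" "Sa u \<cdot> Sa (arr_inv T u) = idt T (So X')"
    by (simp_all flip: Sus_simps(4))
  have "w' \<cdot> (g' \<cdot> v) = g" by (simp add: cmp_reduce[OF w'(3)])
  moreover have "h \<cdot> (w' \<cdot> w) = h"
    by (simp add: cmp_reduce[OF w'(4)[symmetric]] eq(3)[symmetric] cmp_reduce[OF Su(1)])
  ultimately have 1: "is_iso T (w' \<cdot> w)"
    by (intro iso_unipotent[OF t(1)]) (simp_all add: eq(2))
  have "w \<cdot> (g \<cdot> arr_inv T v) = g'" by (simp add: cmp_reduce[OF eq(2)])
  moreover have "h' \<cdot> (w \<cdot> w') = h'"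
    by (simp add: cmp_reduce[OF eq(3)[symmetric]] w'(4)[symmetric] cmp_reduce[OF Su(2)])
  ultimately have 2: "is_iso T (w \<cdot> w')"
    by (intro iso_unipotent[OF t(2)]) (simp_all add: w'(3))
  show ?thesis by (rule iso_of_left_right_inverse[OF 1 2]) simp_all
qed

lemma iso_first:
  assumes t: "dtri X Y Z f g h" "dtri X' Y' Z' f' g' h'"
    and u: "src T u = X" "tgt T u = X'" and v: "src T v = Y" "tgt T v = Y'" "is_iso T v"
    and w: "src T w = Z" "tgt T w = Z'" "is_iso T w"
    and eq: "v \<cdot> f = f' \<cdot> u" "w \<cdot> g = g' \<cdot> v" "Sa u \<cdot> h = h' \<cdot> w"
  shows "is_iso T u"
proof -
  note [simp] = dtri_arr[OF t(1)] dtri_arr[OF t(2)] u v w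
  have "Sa v \<cdot> Sa f = Sa f' \<cdot> Sa u" using arg_cong[OF eq(1), of Sa] by simp
  then have "is_iso T (Sa u)"
    by (intro iso_third[OF dtri_rotate[OF t(1)] dtri_rotate[OF t(2)] v w _ _ eq(2,3)]) simp_all
  then show ?thesis by (simp add: Sus_iso)
qed

lemma iso_middle:
  assumes t: "dtri X Y Z f g h" "dtri X' Y' Z' f' g' h'"
    and u: "src T u = X" "tgt T u = X'" "is_iso T u" and v: "src T v = Y" "tgt T v = Y'"
    and w: "src T w = Z" "tgt T w = Z'" "is_iso T w"
    and eq: "v \<cdot> f = f' \<cdot> u" "w \<cdot> g = g' \<cdot> v" "Sa u \<cdot> h = h' \<cdot> w"
  shows "is_iso T v"
proof -
  note [simp] = dtri_arr[OF t(1)] dtri_arr[OF t(2)] u v w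
  have "Sa v \<cdot> Sa f = Sa f' \<cdot> Sa u" using arg_cong[OF eq(1), of Sa] by simp
  then show ?thesis
    by (intro iso_first[OF dtri_rotate[OF t(1)] dtri_rotate[OF t(2)] v w _ _ _ eq(2,3)])
      (simp_all add: Sus_iso)
qed

lemma dtri_iso:
  assumes t: "dtri X Y Z f g h" and g: "src T g' = Y" "tgt T g' = Z'" "src T h' = Z'" "tgt T h' = So X"
    and w: "src T w = Z" "tgt T w = Z'" "is_iso T w" and eq: "w \<cdot> g = g'" "h = h' \<cdot> w"
  shows "dtri X Y Z' f g' h'"
  using TR1_iso[of f g h f g' h' "idt T X" "idt T Y" w] assms dtri_arr[OF t]
  unfolding dtri_def is_triangle_def by simp

end

section \<open>Shifts and triangle endofunctors\<close>

context triangulated_category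
begin

section \<open>Shifted subcategories\<close>

lemma Sus_pow_isomorphic: "isomorphic T ((So ^^ k) X) ((So ^^ k) Y) \<longleftrightarrow> isomorphic T X Y"
  by (induction k) (simp_all add: Sus_isomorphic)

lemma isomorphic_cong: "isomorphic T X Y \<Longrightarrow> isomorphic T X Z \<longleftrightarrow> isomorphic T Y Z"
  using isomorphic_sym isomorphic_trans by blast

text \<open>The case distinction follows the two formulas in the definition of
  \<open>shifted\<close>; at \<open>n = -1\<close> the membership passes from one formula to the
  other.\<close>

lemma shifted_Sus: "So X \<in> shifted T (n + 1) A \<longleftrightarrow> X \<in> shifted T n A"
proof -
  consider "n \<ge> 0" | "n = -1" | "n < -1" by linarith
  then show ?thesis
  proof cases
    case 1
    then have "nat (n + 1) = Suc (nat n)" by simp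
    with 1 show ?thesis by (simp add: shifted_def Sus_isomorphic)
  next
    case 2
    then show ?thesis by (simp add: shifted_def)
  next
    case 3
    then have "nat (- n) = Suc (nat (- (n + 1)))" by simp
    then have "(So ^^ nat (- n)) X = (So ^^ nat (- (n + 1))) (So X)" by (simp add: funpow_swap1)
    with 3 show ?thesis by (simp add: shifted_def)
  qed
qed

lemma shifted_iso: "X \<in> shifted T n A \<Longrightarrow> isomorphic T X Y \<Longrightarrow> Y \<in> shifted T n A"
  unfolding shifted_def using isomorphic_cong[of X Y]
    isomorphic_cong[of "(So ^^ nat (- n)) X" "(So ^^ nat (- n)) Y"]
  by (auto simp: Sus_pow_isomorphic split: if_splits)

text \<open>Inductions over shifts go down one degree through this: an object of a shift is replaced
  by an isomorphic suspension of an object one degree lower.\<close>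

lemma shifted_Suc_ex:
  assumes "X \<in> shifted T (n + 1) A"
  obtains Y s where "Y \<in> shifted T n A" "is_iso T s" "src T s = So Y" "tgt T s = X"
proof -
  obtain Y s where s: "is_iso T s" "src T s = So Y" "tgt T s = X" by (rule Sus_ess_surj)
  then have "So Y \<in> shifted T (n + 1) A"
    using assms by (blast intro: shifted_iso isomorphic_sym isomorphicI)
  with s show ?thesis using that by (simp add: shifted_Sus)
qed

lemma shifted_pow: "(So ^^ k) X \<in> shifted T (n + int k) A \<longleftrightarrow> X \<in> shifted T n A"
proof (induction k)
  case (Suc k)
  then show ?case using shifted_Sus[of "(So ^^ k) X" "n + int k" A] by (simp add: algebra_simps)
qed simp

lemma shifted_pow': "X \<in> shifted T n A \<Longrightarrow> (So ^^ k) X \<in> shifted T (n + int k) A"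
  by (simp add: shifted_pow)

definition iso_closed :: "'o set \<Rightarrow> bool"
  where "iso_closed A \<longleftrightarrow> (\<forall>X\<in>A. \<forall>Y. isomorphic T X Y \<longrightarrow> Y \<in> A)"

lemma iso_closedD: "iso_closed A \<Longrightarrow> X \<in> A \<Longrightarrow> isomorphic T X Y \<Longrightarrow> Y \<in> A"
  by (auto simp: iso_closed_def)

lemma shifted_0: "iso_closed A \<Longrightarrow> shifted T 0 A = A"
proof -
  assume "iso_closed A"
  then have "X \<in> A \<longleftrightarrow> (\<exists>Y\<in>A. isomorphic T X Y)" for X
    using isomorphic_sym isomorphic_refl iso_closedD by meson
  moreover have "shifted T 0 A = {X. \<exists>Y\<in>A. isomorphic T X Y}" by (simp add: shifted_def)
  ultimately show ?thesis by blast
qed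

lemma dtri_isomorphic_middle:
  assumes "is_zero_object T Z" "isomorphic T X Y"
  obtains f g h where "dtri X Y Z f g h"
proof -
  obtain f where f: "src T f = X" "tgt T f = Y" "is_iso T f"
    using assms(2) unfolding isomorphic_def by auto
  note [simp] = f inv_simps[OF f(3)]
  have "(f, zarr T Y Z, zarr T Z (So X)) \<in> Dist T"
    by (rule TR1_iso[OF TR1_idt[OF assms(1), of X], of _ _ _ "idt T X" f "idt T Z"])
      (simp_all add: is_triangle_def)
  then have "dtri X Y Z f (zarr T Y Z) (zarr T Z (So X))" by (simp add: dtri_def)
  then show ?thesis by (rule that)
qed

lemma dtri_extension_product: "dtri X Y Z f g h \<Longrightarrow> X \<in> A \<Longrightarrow> Z \<in> B \<Longrightarrow> Y \<in> extension_product T A B"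
proof -
  assume t: "dtri X Y Z f g h" and XZ: "X \<in> A" "Z \<in> B"
  have "f \<in> Hom T X Y" "g \<in> Hom T Y Z" "(f, g, h) \<in> Dist T" using t by (simp_all add: dtri_def)
  with XZ show ?thesis unfolding extension_product_def by blast
qed

lemma extension_productE:
  assumes "Y \<in> extension_product T A B"
  obtains X Z f g h where "X \<in> A" "Z \<in> B" "dtri X Y Z f g h"
proof -
  obtain X Z f g h where XZ: "X \<in> A" "Z \<in> B" and t: "f \<in> Hom T X Y" "g \<in> Hom T Y Z" "(f, g, h) \<in> Dist T"
    using assms unfolding extension_product_def by blast
  have "dtri X Y Z f g h" using t dtriI[OF t(3)] Dist_is_triangle[OF t(3)] by (simp add: is_triangle_def)
  with XZ show ?thesis by (rule that)
qed

text \<open>An object isomorphic to \<open>X\<close> is an extension of \<open>X\<close> by a zero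
  object. This is how both classes of a pre-weight structure turn out to be closed under
  isomorphism.\<close>

lemma iso_closed_of_extension_closed:
  assumes "full_additive_subcategory T A" "closed_under_extensions T A"
  shows "iso_closed A"
  unfolding iso_closed_def
proof (intro ballI allI impI)
  fix X Y assume X: "X \<in> A" and iso: "isomorphic T X Y"
  obtain Z where Z: "Z \<in> A" "is_zero_object T Z"
    using assms(1) unfolding full_additive_subcategory_def by blast
  obtain f g h where "dtri X Y Z f g h" using dtri_isomorphic_middle[OF Z(2) iso] .
  then have "Y \<in> extension_product T A A"
    using X Z(1) by (rule dtri_extension_product)
  then show "Y \<in> A" using assms(2) unfolding closed_under_extensions_def by blast
qed

section \<open>Orthogonality along triangles and shifts\<close>

lemma hom0_Sus: "hom0 (So X) (So Y) \<longleftrightarrow> hom0 X Y"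
proof
  assume *: "hom0 (So X) (So Y)"
  show "hom0 X Y" unfolding hom0_def
  proof (intro allI impI)
    fix f assume f: "src T f = X" "tgt T f = Y"
    then have "Sa f = Sa (zarr T X Y)" using hom0D[OF *, of "Sa f"] by simp
    then show "f = zarr T X Y" by (rule Sus_faithful) (use f in simp_all)
  qed
next
  assume *: "hom0 X Y"
  show "hom0 (So X) (So Y)" unfolding hom0_def
  proof (intro allI impI)
    fix f assume "src T f = So X" "tgt T f = So Y"
    then obtain g where "src T g = X" "tgt T g = Y" "Sa g = f" by (rule Sus_full)
    then show "f = zarr T (So X) (So Y)" using hom0D[OF *, of g] by auto
  qed
qed

lemma hom0_right_middle:
  assumes t: "dtri X Y Z f g h" and "hom0 W X" "hom0 W Z"
  shows "hom0 W Y"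
  unfolding hom0_def
proof (intro allI impI)
  fix a assume a: "src T a = W" "tgt T a = Y"
  note [simp] = dtri_arr[OF t]
  have "g \<cdot> a = zarr T W Z" by (rule hom0D[OF assms(3)]) (simp_all add: a)
  from lift_Y[OF t a this] obtain b where b: "src T b = W" "tgt T b = X" "f \<cdot> b = a" .
  then show "a = zarr T W Y" using hom0D[OF assms(2) b(1,2)] by auto
qed

lemma hom0_right_first:
  assumes t: "dtri X Y Z f g h" and "hom0 W Y" "hom0 (So W) Z"
  shows "hom0 W X"
  using hom0_right_middle[OF dtri_rotate[OF dtri_rotate[OF t]], of "So W"] assms(2,3) hom0_Sus by blast

lemma hom0_left_middle:
  assumes t: "dtri X Y Z f g h" and "hom0 X W" "hom0 Z W"
  shows "hom0 Y W"
  unfolding hom0_def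
proof (intro allI impI)
  fix a assume a: "src T a = Y" "tgt T a = W"
  note [simp] = dtri_arr[OF t]
  have "a \<cdot> f = zarr T X W" by (rule hom0D[OF assms(2)]) (simp_all add: a)
  from extend_Y[OF t a this] obtain b where b: "src T b = Z" "tgt T b = W" "b \<cdot> g = a" .
  then show "a = zarr T Y W" using hom0D[OF assms(3) b(1,2)] by auto
qed

lemma hom0_left_third:
  assumes t: "dtri X Y Z f g h" and "hom0 Y W" "hom0 (So X) W"
  shows "hom0 Z W"
  using hom0_left_middle[OF dtri_rotate[OF t]] assms(2,3) by blast

lemma hom0_left_first:
  assumes t: "dtri X Y Z f g h" and "hom0 Y W" "hom0 Z (So W)"
  shows "hom0 X W"
  using hom0_left_middle[OF dtri_rotate[OF dtri_rotate[OF t]], of "So W"] assms(2,3) hom0_Sus by blast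

text \<open>Vanishing depends only on the difference \<open>e\<close> of the two degrees. Going up,
  both objects are replaced by isomorphic suspensions; going down, both are suspended.\<close>

lemma hom0_shifted:
  assumes base: "\<And>X Y. X \<in> shifted T 0 A \<Longrightarrow> Y \<in> shifted T e B \<Longrightarrow> hom0 X Y"
  shows "X \<in> shifted T p A \<Longrightarrow> Y \<in> shifted T (p + e) B \<Longrightarrow> hom0 X Y"
proof (induction p arbitrary: X Y rule: int_induct[where k = 0])
  case base
  then show ?case using assms by simp
next
  case (step1 p)
  obtain X' s where X: "X' \<in> shifted T p A" "is_iso T s" "src T s = So X'" "tgt T s = X"
    using step1.prems(1) by (rule shifted_Suc_ex)
  have "Y \<in> shifted T (p + e + 1) B" using step1.prems(2) by (simp add: algebra_simps)
  then obtain Y' s' where Y: "Y' \<in> shifted T (p + e) B" "is_iso T s'" "src T s' = So Y'" "tgt T s' = Y"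
    by (rule shifted_Suc_ex)
  have "hom0 (So X') (So Y')" using step1.IH[OF X(1) Y(1)] by (simp add: hom0_Sus)
  then show ?case by (rule hom0_iso) (rule isomorphicI[OF X(2-4)], rule isomorphicI[OF Y(2-4)])
next
  case (step2 p)
  have "So X \<in> shifted T p A" "So Y \<in> shifted T (p + e) B"
    using step2.prems shifted_Sus[of X "p - 1" A] shifted_Sus[of Y "p - 1 + e" B]
    by (simp_all add: algebra_simps)
  then have "hom0 (So X) (So Y)" by (rule step2.IH)
  then show ?case by (simp add: hom0_Sus)
qed

end

section \<open>Triangle endofunctors\<close>

locale triangle_endofunctor = triangulated_category T
  for T :: "('o, 'm, 'z) triangulated_category_scheme" (structure) +
  fixes F :: "('o, 'm, 'o, 'm) fctr" and \<omega> :: "'o \<Rightarrow> 'm"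
  assumes triangle_functor: "is_triangle_functor T T F \<omega>"
begin

abbreviation Fo :: "'o \<Rightarrow> 'o" where "Fo \<equiv> fob F"
abbreviation Fa :: "'m \<Rightarrow> 'm" where "Fa \<equiv> far F"

lemma F_additive: "is_additive_functor T T F"
  using triangle_functor by (simp add: is_triangle_functor_def)

lemma F_functor: "is_functor T T F"
  using F_additive by (rule additive_functor)

lemma F_simps [simp]:
  "src T (Fa f) = Fo (src T f)" "tgt T (Fa f) = Fo (tgt T f)" "Fa (idt T X) = idt T (Fo X)"
  "tgt T f = src T g \<Longrightarrow> Fa (g \<cdot> f) = Fa g \<cdot> Fa f"
  "Fa (zarr T X Y) = zarr T (Fo X) (Fo Y)" "Fa (mneg T f) = mneg T (Fa f)"
  "src T f = src T g \<Longrightarrow> tgt T f = tgt T g \<Longrightarrow> Fa (madd T f g) = madd T (Fa f) (Fa g)"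
  "src T f = src T g \<Longrightarrow> tgt T f = tgt T g \<Longrightarrow> Fa (msub T f g) = msub T (Fa f) (Fa g)"
  using functor_simps[OF F_functor] additive_zarr[OF F_additive] additive_mneg[OF F_additive]
    additive_madd[OF F_additive]
  by (simp_all add: msub_def)

lemma \<omega>_iso: "natural_iso T T (comp_functor F (Sus T)) (comp_functor (Sus T) F) \<omega>"
  using triangle_functor by (simp add: is_triangle_functor_def)

lemma \<omega>_simps [simp]: "src T (\<omega> X) = Fo (So X)" "tgt T (\<omega> X) = So (Fo X)" "is_iso T (\<omega> X)"
  using natural_isoD(1-3)[OF \<omega>_iso, of X] by (simp_all add: comp_functor_def)

lemma \<omega>_natural: "\<omega> (tgt T f) \<cdot> Fa (Sa f) = Sa (Fa f) \<cdot> \<omega> (src T f)"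
  using natural_isoD(4)[OF \<omega>_iso, of f] by (simp add: comp_functor_def)

lemma F_Sus: "Fa (Sa f) = arr_inv T (\<omega> (tgt T f)) \<cdot> (Sa (Fa f) \<cdot> \<omega> (src T f))"
  by (simp add: inv_simps flip: \<omega>_natural)

lemma F_dtri:
  assumes "dtri X Y Z f g h"
  shows "dtri (Fo X) (Fo Y) (Fo Z) (Fa f) (Fa g) (\<omega> X \<cdot> Fa h)"
proof -
  have "(f, g, h) \<in> Dist T" using assms by (simp add: dtri_def)
  then have "(Fa f, Fa g, \<omega> (src T f) \<cdot> Fa h) \<in> Dist T"
    using triangle_functor unfolding is_triangle_functor_def by blast
  then show ?thesis using dtri_arr[OF assms] by (simp add: dtri_def)
qed

lemma F_iso: "is_iso T f \<Longrightarrow> is_iso T (Fa f)"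
  using functor_iso[OF F_functor] .

end

section \<open>Countable index sets inside the universe\<close>

lemma small_countable:
  fixes I :: "'u set"
  assumes "uncountable (UNIV :: 'u set)" "countable I"
  shows "small I"
proof -
  have "\<not> (UNIV :: 'u set) \<lesssim> I"
    using assms countable_lepoll by blast
  moreover have "I \<lesssim> (UNIV :: 'u set)" by (rule subset_imp_lepoll) simp
  ultimately show ?thesis
    unfolding small_def lesspoll_def using eqpoll_imp_lepoll eqpoll_sym by blast
qed

lemma uncountable_inj_nat:
  assumes "uncountable (UNIV :: 'u set)"
  obtains e :: "nat \<Rightarrow> 'u" where "inj e"
  using infinite_countable_subset[OF uncountable_infinite[OF assms]] that by (elim exE conjE)

context triangle_endofunctor
begin

text \<open>An injection of \<open>nat\<close> into the uncountable type \<open>'u\<close> has small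
  range; bicontinuity is applied to the family transported to that range.\<close>

lemma bicontinuous_nat:
  assumes u: "uncountable (UNIV :: 'u set)" and c: "bicontinuous TYPE('u) T T F"
  shows "is_coproduct T (UNIV :: nat set) X P i \<Longrightarrow> is_coproduct T UNIV (Fo \<circ> X) (Fo P) (Fa \<circ> i)"
    and "is_product T (UNIV :: nat set) X P i \<Longrightarrow> is_product T UNIV (Fo \<circ> X) (Fo P) (Fa \<circ> i)"
proof -
  obtain e :: "nat \<Rightarrow> 'u" where e: "inj e" using u by (rule uncountable_inj_nat)
  have s: "small (range e)" using u by (rule small_countable) simp
  define d where "d = the_inv_into UNIV e"
  have d: "d (e k) = k" for k using e by (simp add: d_def the_inv_into_f_f)
  have c1: "is_coproduct T (range e) (Fo \<circ> (X \<circ> d)) (Fo P) (Fa \<circ> (i \<circ> d))"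
    if "is_coproduct T (range e) (X \<circ> d) P (i \<circ> d)"
    using c s that unfolding bicontinuous_def by blast
  have c2: "is_product T (range e) (Fo \<circ> (X \<circ> d)) (Fo P) (Fa \<circ> (i \<circ> d))"
    if "is_product T (range e) (X \<circ> d) P (i \<circ> d)"
    using c s that unfolding bicontinuous_def by blast
  show "is_coproduct T (UNIV :: nat set) X P i \<Longrightarrow> is_coproduct T UNIV (Fo \<circ> X) (Fo P) (Fa \<circ> i)"
    using c1 coproduct_reindex[OF e, of "X \<circ> d" X "i \<circ> d" i P]
      coproduct_reindex[OF e, of "Fo \<circ> (X \<circ> d)" "Fo \<circ> X" "Fa \<circ> (i \<circ> d)" "Fa \<circ> i" "Fo P"]
    by (simp add: d)
  show "is_product T (UNIV :: nat set) X P i \<Longrightarrow> is_product T UNIV (Fo \<circ> X) (Fo P) (Fa \<circ> i)"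
    using c2 product_reindex[OF e, of "X \<circ> d" X "i \<circ> d" i P]
      product_reindex[OF e, of "Fo \<circ> (X \<circ> d)" "Fo \<circ> X" "Fa \<circ> (i \<circ> d)" "Fa \<circ> i" "Fo P"]
    by (simp add: d)
qed

end

section \<open>Full faithfulness of a triangle functor\<close>

context triangulated_category
begin

lemma biproduct_Sus:
  assumes "is_biproduct T X Y P" shows "is_biproduct T (So X) (So Y) (So P)"
proof -
  obtain i j p q where *: "src T i = X" "tgt T i = P" "src T j = Y" "tgt T j = P"
      "src T p = P" "tgt T p = X" "src T q = P" "tgt T q = Y"
      and e: "p \<cdot> i = idt T X" "q \<cdot> j = idt T Y" "q \<cdot> i = zarr T X Y" "p \<cdot> j = zarr T Y X"
      "madd T (i \<cdot> p) (j \<cdot> q) = idt T P"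
    using assms unfolding is_biproduct_def by auto
  note [simp] = *
  have "Sa p \<cdot> Sa i = idt T (So X)" "Sa q \<cdot> Sa j = idt T (So Y)"
    "Sa q \<cdot> Sa i = zarr T (So X) (So Y)" "Sa p \<cdot> Sa j = zarr T (So Y) (So X)"
    "madd T (Sa i \<cdot> Sa p) (Sa j \<cdot> Sa q) = idt T (So P)"
    using e[THEN arg_cong[of _ _ Sa]] by simp_all
  then show ?thesis
    unfolding is_biproduct_def
    by (intro bexI[of _ "Sa i"] bexI[of _ "Sa j"] bexI[of _ "Sa p"] bexI[of _ "Sa q"]) simp_all
qed

lemma biproduct_Sus_pow: "is_biproduct T X Y P \<Longrightarrow> is_biproduct T ((So ^^ n) X) ((So ^^ n) Y) ((So ^^ n) P)"
  by (induction n) (simp_all add: biproduct_Sus)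

text \<open>Three rotations suspend all vertices and introduce signs in the morphisms. Later
  arguments depend on the vertices alone, so the morphisms are left existential.\<close>

lemma dtri_Sus_pow:
  assumes "dtri X Y Z f g h"
  obtains f' g' h' where "dtri ((So ^^ n) X) ((So ^^ n) Y) ((So ^^ n) Z) f' g' h'"
proof -
  have "\<exists>f' g' h'. dtri ((So ^^ n) X) ((So ^^ n) Y) ((So ^^ n) Z) f' g' h'"
  proof (induction n)
    case 0
    then show ?case using assms by auto
  next
    case (Suc n)
    then obtain f' g' h' where "dtri ((So ^^ n) X) ((So ^^ n) Y) ((So ^^ n) Z) f' g' h'" by blast
    from dtri_rotate[OF dtri_rotate[OF dtri_rotate[OF this]]] show ?case by auto
  qed
  then show ?thesis using that by blast
qed

lemma Sus_pow_coproduct: "is_coproduct T I X P i \<Longrightarrow> \<exists>i'. is_coproduct T I (\<lambda>k. (So ^^ n) (X k)) ((So ^^ n) P) i'"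
proof (induction n)
  case (Suc n)
  then obtain i' where "is_coproduct T I (\<lambda>k. (So ^^ n) (X k)) ((So ^^ n) P) i'" by blast
  from Sus_coproduct[OF this] show ?case by (auto simp: comp_def)
qed auto

lemma Sus_pow_product: "is_product T I X P p \<Longrightarrow> \<exists>p'. is_product T I (\<lambda>k. (So ^^ n) (X k)) ((So ^^ n) P) p'"
proof (induction n)
  case (Suc n)
  then obtain p' where "is_product T I (\<lambda>k. (So ^^ n) (X k)) ((So ^^ n) P) p'" by blast
  from Sus_product[OF this] show ?case by (auto simp: comp_def)
qed auto

lemma Sus_pow_zero_object: "is_zero_object T Z \<Longrightarrow> is_zero_object T ((So ^^ n) Z)"
  by (induction n) (simp_all add: Sus_zero_object)

text \<open>Membership is insensitive to suspension, so rotation reduces the closure conditions for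
  the first and third vertex to the one for the middle vertex.\<close>

lemma triangulated_subcategoryI:
  assumes zero: "\<And>Z. is_zero_object T Z \<Longrightarrow> Z \<in> L"
    and bip: "\<And>X Y P. is_biproduct T X Y P \<Longrightarrow> X \<in> L \<Longrightarrow> Y \<in> L \<Longrightarrow> P \<in> L"
    and Sus: "\<And>X. So X \<in> L \<longleftrightarrow> X \<in> L"
    and mid: "\<And>X Y Z f g h. dtri X Y Z f g h \<Longrightarrow> X \<in> L \<Longrightarrow> Z \<in> L \<Longrightarrow> Y \<in> L"
  shows "triangulated_subcategory T L"
  unfolding triangulated_subcategory_def full_additive_subcategory_def
proof (intro conjI allI impI ballI)
  show "\<exists>Z\<in>L. is_zero_object T Z" using ex_zero_object zero by blast
  show "\<exists>P\<in>L. is_biproduct T X Y P" if "X \<in> L" "Y \<in> L" for X Y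
    using ex_biproduct[of X Y] bip[OF _ that] by blast
  show "So X \<in> L \<longleftrightarrow> X \<in> L" for X by (rule Sus)
next
  fix f g h assume "(f, g, h) \<in> Dist T"
  then have t: "dtri (src T f) (src T g) (src T h) f g h" by (rule dtriI)
  show "src T h \<in> L" if "src T f \<in> L \<and> src T g \<in> L"
    using mid[OF dtri_rotate[OF t]] that Sus by simp
  show "src T f \<in> L" if "src T g \<in> L \<and> src T h \<in> L"
    using mid[OF dtri_rotate[OF dtri_rotate[OF t]]] that Sus by simp
  show "src T g \<in> L" if "src T f \<in> L \<and> src T h \<in> L"
    using mid[OF t] that by simp
qed

lemma zero_object_hom0: "is_zero_object T Z \<Longrightarrow> hom0 X Z" "is_zero_object T Z \<Longrightarrow> hom0 Z X"
  unfolding hom0_def using zero_object_arr by blast+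

end

context triangle_endofunctor
begin

section \<open>Bijectivity of the functor on a single Hom group\<close>

definition ff :: "'o \<Rightarrow> 'o \<Rightarrow> bool"
  where "ff X Y \<longleftrightarrow> bij_betw Fa (Hom T X Y) (Hom T (Fo X) (Fo Y))"

lemma ff_zero:
  assumes "ff X Y" "src T f = X" "tgt T f = Y" "Fa f = zarr T (Fo X) (Fo Y)"
  shows "f = zarr T X Y"
  by (rule inj_onD[of Fa "Hom T X Y"]) (use assms in \<open>simp_all add: ff_def bij_betw_def\<close>)

lemma ff_surj:
  assumes "ff X Y" "src T y = Fo X" "tgt T y = Fo Y"
  obtains f where "src T f = X" "tgt T f = Y" "Fa f = y"
proof -
  have "y \<in> Fa ` Hom T X Y" using assms by (simp add: ff_def bij_betw_def)
  then show ?thesis using that by auto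
qed

text \<open>F is additive on Hom groups, so injectivity may be tested on the kernel.\<close>

lemma ffI:
  assumes zero: "\<And>f. src T f = X \<Longrightarrow> tgt T f = Y \<Longrightarrow> Fa f = zarr T (Fo X) (Fo Y) \<Longrightarrow> f = zarr T X Y"
    and surj: "\<And>y. src T y = Fo X \<Longrightarrow> tgt T y = Fo Y \<Longrightarrow> \<exists>f. src T f = X \<and> tgt T f = Y \<and> Fa f = y"
  shows "ff X Y"
  unfolding ff_def bij_betw_def
proof
  show "inj_on Fa (Hom T X Y)"
  proof (rule inj_onI)
    fix f g assume fg: "f \<in> Hom T X Y" "g \<in> Hom T X Y" "Fa f = Fa g"
    have "msub T f g = zarr T X Y" by (rule zero) (use fg in simp_all)
    then show "f = g" by (rule msub_zero[rotated 2]) (use fg in simp_all)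
  qed
  show "Fa ` Hom T X Y = Hom T (Fo X) (Fo Y)"
  proof
    show "Fa ` Hom T X Y \<subseteq> Hom T (Fo X) (Fo Y)" by auto
    show "Hom T (Fo X) (Fo Y) \<subseteq> Fa ` Hom T X Y"
    proof
      fix y assume "y \<in> Hom T (Fo X) (Fo Y)"
      then obtain f where "src T f = X \<and> tgt T f = Y \<and> Fa f = y" using surj[of y] by auto
      then show "y \<in> Fa ` Hom T X Y" by (intro image_eqI[of _ _ f]) simp_all
    qed
  qed
qed

lemma ff_hom0: "hom0 X Y \<Longrightarrow> hom0 (Fo X) (Fo Y) \<Longrightarrow> ff X Y"
proof (rule ffI)
  fix y assume *: "hom0 X Y" "hom0 (Fo X) (Fo Y)" "src T y = Fo X" "tgt T y = Fo Y"
  then have "y = zarr T (Fo X) (Fo Y)" using hom0D by blast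
  then show "\<exists>f. src T f = X \<and> tgt T f = Y \<and> Fa f = y" by (intro exI[of _ "zarr T X Y"]) simp
qed (auto intro: hom0D)

text \<open>Conjugation by \<open>\<omega>\<close> identifies F on Hom(\<Sigma>X, \<Sigma>Y) with
  \<Sigma> applied to F on Hom(X, Y), and \<Sigma> is fully faithful.\<close>

lemma ff_Sus: "ff (So X) (So Y) \<longleftrightarrow> ff X Y"
proof
  assume *: "ff (So X) (So Y)"
  show "ff X Y"
  proof (rule ffI)
    fix f assume f: "src T f = X" "tgt T f = Y" "Fa f = zarr T (Fo X) (Fo Y)"
    have "Sa f = zarr T (So X) (So Y)"
      by (rule ff_zero[OF *]) (use f in \<open>simp_all add: F_Sus inv_simps\<close>)
    then have "Sa f = Sa (zarr T X Y)" by simp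
    then show "f = zarr T X Y" by (rule Sus_faithful) (use f in simp_all)
  next
    fix y assume y: "src T y = Fo X" "tgt T y = Fo Y"
    obtain g where g: "src T g = So X" "tgt T g = So Y" "Fa g = arr_inv T (\<omega> Y) \<cdot> Sa y \<cdot> \<omega> X"
      by (rule ff_surj[OF *, of "arr_inv T (\<omega> Y) \<cdot> Sa y \<cdot> \<omega> X"]) (use y in \<open>simp_all add: inv_simps\<close>)
    obtain f where f: "src T f = X" "tgt T f = Y" "Sa f = g" using Sus_full[OF g(1,2)] .
    have "Sa (Fa f) \<cdot> \<omega> X = \<omega> Y \<cdot> Fa g" using \<omega>_natural[of f] f by simp
    also have "\<dots> = Sa y \<cdot> \<omega> X" using y by (simp add: g inv_simps)
    finally have "Sa (Fa f) = Sa y"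
      by (rule iso_cancel_right[rotated 3]) (use f y in simp_all)
    then have "Fa f = y" by (rule Sus_faithful) (use f y in simp_all)
    with f show "\<exists>f. src T f = X \<and> tgt T f = Y \<and> Fa f = y" by blast
  qed
next
  assume *: "ff X Y"
  show "ff (So X) (So Y)"
  proof (rule ffI)
    fix g assume g: "src T g = So X" "tgt T g = So Y" "Fa g = zarr T (Fo (So X)) (Fo (So Y))"
    obtain f where f: "src T f = X" "tgt T f = Y" "Sa f = g" using Sus_full[OF g(1,2)] .
    have "Sa (Fa f) \<cdot> \<omega> X = Sa (zarr T (Fo X) (Fo Y)) \<cdot> \<omega> X"
      using \<omega>_natural[of f] f g by simp
    then have "Sa (Fa f) = Sa (zarr T (Fo X) (Fo Y))"
      by (rule iso_cancel_right[rotated 3]) (use f in simp_all)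
    then have "Fa f = zarr T (Fo X) (Fo Y)" by (rule Sus_faithful) (use f in simp_all)
    from ff_zero[OF * f(1,2) this] show "g = zarr T (So X) (So Y)" using f(3) by auto
  next
    fix y assume y: "src T y = Fo (So X)" "tgt T y = Fo (So Y)"
    obtain y' where y': "src T y' = Fo X" "tgt T y' = Fo Y" "Sa y' = \<omega> Y \<cdot> y \<cdot> arr_inv T (\<omega> X)"
      by (rule Sus_full[of "\<omega> Y \<cdot> y \<cdot> arr_inv T (\<omega> X)" "Fo X" "Fo Y"]) (use y in \<open>simp_all add: inv_simps\<close>)
    obtain f where f: "src T f = X" "tgt T f = Y" "Fa f = y'" using ff_surj[OF * y'(1,2)] .
    have "Fa (Sa f) = y" using y' f y by (simp add: F_Sus inv_simps)
    then show "\<exists>f. src T f = So X \<and> tgt T f = So Y \<and> Fa f = y"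
      using f by (intro exI[of _ "Sa f"]) simp
  qed
qed

text \<open>The five lemma for Hom(X, -) on a triangle and its image. The outer terms are
  Hom(\<Sigma>X, Y3), standing for Hom(X, \<Sigma>^-1 Y3), which serves injectivity, and Hom(X,
  \<Sigma>Y1), which serves surjectivity.\<close>

lemma ff_right_middle:
  assumes t: "dtri Y1 Y2 Y3 f g h"
    and h1: "ff X Y1" and h3: "ff X Y3" and h4: "ff (So X) Y3" and h2: "ff X (So Y1)"
  shows "ff X Y2"
proof (rule ffI)
  note Ft = F_dtri[OF t] note [simp] = dtri_arr[OF t] dtri_arr[OF Ft]
  fix a assume a: "src T a = X" "tgt T a = Y2" "Fa a = zarr T (Fo X) (Fo Y2)"
  have "g \<cdot> a = zarr T X Y3" by (rule ff_zero[OF h3]) (use a in simp_all)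
  from lift_Y[OF t a(1,2) this] obtain b where b: "src T b = X" "tgt T b = Y1" "f \<cdot> b = a" .
  have "Fa f \<cdot> Fa b = zarr T (Fo X) (Fo Y2)" using a b(1,2) by (simp flip: F_simps(4) add: b(3))
  then have "Sa (Fa f \<cdot> Fa b) = Sa (zarr T (Fo X) (Fo Y2))" by simp
  then have "Sa (Fa f) \<cdot> (Sa (Fa b) \<cdot> \<omega> X) = zarr T (Fo (So X)) (So (Fo Y2))"
    using b(1,2) cmp_reduce[of "Sa (Fa f)" "Sa (Fa b)" _ "\<omega> X"] by simp
  from lift_SX[OF Ft _ _ this] obtain c where c: "src T c = Fo (So X)" "tgt T c = Fo Y3"
    "\<omega> Y1 \<cdot> Fa h \<cdot> c = Sa (Fa b) \<cdot> \<omega> X" using b(1,2) by auto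
  \<comment> \<open>The factor \<open>c\<close> lives in the image triangle; fullness on
    Hom(\<Sigma>X, Y3) brings it back, so that \<open>Sa b\<close> itself factors through
    \<open>h\<close> and is killed by \<open>Sa f\<close>.\<close>
  obtain c' where c': "src T c' = So X" "tgt T c' = Y3" "Fa c' = c" using ff_surj[OF h4 c(1,2)] .
  have "\<omega> Y1 \<cdot> Fa (h \<cdot> c') = \<omega> Y1 \<cdot> Fa (Sa b)"
    using c c' b(1,2) \<omega>_natural[of b] by simp
  then have "Fa (h \<cdot> c') = Fa (Sa b)"
    by (rule iso_cancel_left[rotated 3]) (use b(1,2) c(1,2) c' in simp_all)
  then have eq: "h \<cdot> c' = Sa b"
    using inj_onD[of Fa "Hom T (So X) (So Y1)" "h \<cdot> c'" "Sa b"] ff_Sus[of X Y1] h1 b(1,2) c'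
    by (simp add: ff_def bij_betw_def)
  have "Sa (f \<cdot> b) = Sa f \<cdot> (h \<cdot> c')" using b(1,2) eq by simp
  also have "\<dots> = Sa (zarr T X Y2)"
    using cmp_reduce[OF dtri_cmp(3)[OF t], of c'] c' by simp
  finally have "f \<cdot> b = zarr T X Y2" by (rule Sus_faithful) (use b(1,2) in simp_all)
  then show "a = zarr T X Y2" using b(3) by simp
next
  note Ft = F_dtri[OF t] note [simp] = dtri_arr[OF t] dtri_arr[OF Ft]
  fix y assume y [simp]: "src T y = Fo X" "tgt T y = Fo Y2"
  obtain c where c [simp]: "src T c = X" "tgt T c = Y3" and Fc: "Fa c = Fa g \<cdot> y"
    by (rule ff_surj[OF h3, of "Fa g \<cdot> y"]) simp_all
  have "(\<omega> Y1 \<cdot> Fa h) \<cdot> Fa g \<cdot> y = zarr T (Fo X) (So (Fo Y1))"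
    by (subst dtri_cmp(2)[OF Ft]) simp
  then have "\<omega> Y1 \<cdot> Fa (h \<cdot> c) = \<omega> Y1 \<cdot> zarr T (Fo X) (Fo (So Y1))" by (simp add: Fc)
  then have "Fa (h \<cdot> c) = zarr T (Fo X) (Fo (So Y1))"
    by (rule iso_cancel_left[rotated 3]) simp_all
  then have "h \<cdot> c = zarr T X (So Y1)" by (rule ff_zero[OF h2, rotated 2]) simp_all
  from lift_Z[OF t c this] obtain e where e [simp]: "src T e = X" "tgt T e = Y2" and ge: "g \<cdot> e = c" .
  have "Fa g \<cdot> Fa e = Fa c" by (simp flip: F_simps(4) add: ge)
  \<comment> \<open>\<open>Fa e\<close> agrees with \<open>y\<close> after composing with
    \<open>Fa g\<close>, so the error comes from \<open>Y1\<close>, where F is already full.\<close>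
  then have "Fa g \<cdot> msub T y (Fa e) = zarr T (Fo X) (Fo Y3)" by (simp add: Fc)
  from lift_Y[OF Ft _ _ this] obtain b where b: "src T b = Fo X" "tgt T b = Fo Y1"
    "Fa f \<cdot> b = msub T y (Fa e)" by auto
  obtain b' where b' [simp]: "src T b' = X" "tgt T b' = Y1" and Fb: "Fa b' = b" using ff_surj[OF h1 b(1,2)] .
  have "Fa (madd T (f \<cdot> b') e) = y" by (simp add: Fb b(3))
  then show "\<exists>f. src T f = X \<and> tgt T f = Y2 \<and> Fa f = y"
    by (intro exI[of _ "madd T (f \<cdot> b') e"]) simp
qed

text \<open>The five lemma for Hom(-, Y). Here Hom(\<Sigma>X1, Y) serves injectivity and Hom(X3,
  \<Sigma>Y), standing for Hom(\<Sigma>^-1 X3, Y), serves surjectivity.\<close>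

lemma ff_left_middle:
  assumes t: "dtri X1 X2 X3 f g h"
    and h1: "ff X1 Y" and h3: "ff X3 Y" and h4: "ff X3 (So Y)" and h2: "ff (So X1) Y"
  shows "ff X2 Y"
proof (rule ffI)
  note Ft = F_dtri[OF t] note [simp] = dtri_arr[OF t] dtri_arr[OF Ft]
  fix a assume a: "src T a = X2" "tgt T a = Y" "Fa a = zarr T (Fo X2) (Fo Y)"
  have "a \<cdot> f = zarr T X1 Y" by (rule ff_zero[OF h1]) (use a in simp_all)
  from extend_Y[OF t a(1,2) this] obtain b where b: "src T b = X3" "tgt T b = Y" "b \<cdot> g = a" .
  have "Fa b \<cdot> Fa g = zarr T (Fo X2) (Fo Y)" using a b(1,2) by (simp flip: F_simps(4) add: b(3))
  from extend_Z[OF Ft _ _ this] obtain c where c: "src T c = So (Fo X1)" "tgt T c = Fo Y"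
    "c \<cdot> (\<omega> X1 \<cdot> Fa h) = Fa b" using b(1,2) by auto
  obtain c' where c': "src T c' = So X1" "tgt T c' = Y" "Fa c' = c \<cdot> \<omega> X1"
    by (rule ff_surj[OF h2, of "c \<cdot> \<omega> X1"]) (use c in simp_all)
  have "Fa (c' \<cdot> h) = Fa b" using c c' by simp
  then have "c' \<cdot> h = b"
    using inj_onD[of Fa "Hom T X3 Y" "c' \<cdot> h" b] h3 b(1,2) c'
    by (simp add: ff_def bij_betw_def)
  then have "a = (c' \<cdot> h) \<cdot> g" using b by simp
  then show "a = zarr T X2 Y" using c' dtri_cmp(2)[OF t] by simp
next
  note Ft = F_dtri[OF t] note [simp] = dtri_arr[OF t] dtri_arr[OF Ft]
  fix y assume y [simp]: "src T y = Fo X2" "tgt T y = Fo Y"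
  obtain c where c [simp]: "src T c = X1" "tgt T c = Y" and Fc: "Fa c = y \<cdot> Fa f"
    by (rule ff_surj[OF h1, of "y \<cdot> Fa f"]) simp_all
  have "\<omega> Y \<cdot> Fa (Sa c \<cdot> h) = Sa y \<cdot> (Sa (Fa f) \<cdot> (\<omega> X1 \<cdot> Fa h))"
    using cmp_reduce[OF \<omega>_natural[of c], of "Fa h"] by (simp add: Fc)
  also have "\<dots> = \<omega> Y \<cdot> zarr T (Fo X3) (Fo (So Y))"
    by (subst dtri_cmp(3)[OF Ft]) simp
  finally have "Fa (Sa c \<cdot> h) = zarr T (Fo X3) (Fo (So Y))"
    by (rule iso_cancel_left[rotated 3]) simp_all
  then have "Sa c \<cdot> h = zarr T X3 (So Y)" by (rule ff_zero[OF h4, rotated 2]) simp_all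
  \<comment> \<open>The obstruction to extending \<open>c\<close> along \<open>f\<close> is the
    composite of \<open>Sa c\<close> with \<open>h\<close>. The extension is thus found between
    suspensions and then desuspended.\<close>
  from extend_SX[OF t _ _ this] obtain d where d: "src T d = So X2" "tgt T d = So Y" "d \<cdot> Sa f = Sa c"
    by auto
  obtain e where e [simp]: "src T e = X2" "tgt T e = Y" and Se: "Sa e = d" using Sus_full[OF d(1,2)] .
  have "Sa (e \<cdot> f) = Sa c" by (simp add: Se d)
  then have ef: "e \<cdot> f = c" by (rule Sus_faithful) simp_all
  have "Fa e \<cdot> Fa f = Fa c" by (simp flip: F_simps(4) add: ef)
  then have "msub T y (Fa e) \<cdot> Fa f = zarr T (Fo X1) (Fo Y)" by (simp add: Fc)
  from extend_Y[OF Ft _ _ this] obtain b where b: "src T b = Fo X3" "tgt T b = Fo Y"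
    "b \<cdot> Fa g = msub T y (Fa e)" by auto
  obtain b' where b' [simp]: "src T b' = X3" "tgt T b' = Y" and Fb: "Fa b' = b" using ff_surj[OF h3 b(1,2)] .
  have "Fa (madd T (b' \<cdot> g) e) = y" by (simp add: Fb b(3))
  then show "\<exists>f. src T f = X2 \<and> tgt T f = Y \<and> Fa f = y"
    by (intro exI[of _ "madd T (b' \<cdot> g) e"]) simp
qed

text \<open>The decomposition i p + j q = 1 splits morphisms into \<open>P\<close>, and, being
  preserved by the additive functor F, also those into F P.\<close>

lemma ff_right_biproduct:
  assumes P: "is_biproduct T Y1 Y2 P" and ff: "ff X Y1" "ff X Y2"
  shows "ff X P"
proof -
  obtain i j p q where *: "src T i = Y1" "tgt T i = P" "src T j = Y2" "tgt T j = P"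
      "src T p = P" "tgt T p = Y1" "src T q = P" "tgt T q = Y2"
      and e: "madd T (i \<cdot> p) (j \<cdot> q) = idt T P"
    using P unfolding is_biproduct_def by auto
  note [simp] = *
  show ?thesis
  proof (rule ffI)
    fix a assume a: "src T a = X" "tgt T a = P" "Fa a = zarr T (Fo X) (Fo P)"
    have 1: "p \<cdot> a = zarr T X Y1" by (rule ff_zero[OF ff(1)]) (use a in simp_all)
    have 2: "q \<cdot> a = zarr T X Y2" by (rule ff_zero[OF ff(2)]) (use a in simp_all)
    have "madd T (i \<cdot> p) (j \<cdot> q) \<cdot> a = zarr T X P" using a(1,2) by (simp add: 1 2)
    then show "a = zarr T X P" using a(1,2) by (simp add: e)
  next
    fix y assume y [simp]: "src T y = Fo X" "tgt T y = Fo P"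
    obtain a where a [simp]: "src T a = X" "tgt T a = Y1" and Fa: "Fa a = Fa p \<cdot> y"
      by (rule ff_surj[OF ff(1), of "Fa p \<cdot> y"]) simp_all
    obtain b where b [simp]: "src T b = X" "tgt T b = Y2" and Fb: "Fa b = Fa q \<cdot> y"
      by (rule ff_surj[OF ff(2), of "Fa q \<cdot> y"]) simp_all
    have "Fa (madd T (i \<cdot> a) (j \<cdot> b)) = Fa (madd T (i \<cdot> p) (j \<cdot> q)) \<cdot> y"
      by (simp add: Fa Fb)
    also have "\<dots> = y" by (subst e) simp
    finally show "\<exists>f. src T f = X \<and> tgt T f = P \<and> Fa f = y"
      by (intro exI[of _ "madd T (i \<cdot> a) (j \<cdot> b)"]) simp
  qed
qed

lemma ff_left_biproduct:
  assumes P: "is_biproduct T X1 X2 P" and ff: "ff X1 Y" "ff X2 Y"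
  shows "ff P Y"
proof -
  obtain i j p q where *: "src T i = X1" "tgt T i = P" "src T j = X2" "tgt T j = P"
      "src T p = P" "tgt T p = X1" "src T q = P" "tgt T q = X2"
      and e: "madd T (i \<cdot> p) (j \<cdot> q) = idt T P"
    using P unfolding is_biproduct_def by auto
  note [simp] = *
  show ?thesis
  proof (rule ffI)
    fix a assume a: "src T a = P" "tgt T a = Y" "Fa a = zarr T (Fo P) (Fo Y)"
    have 1: "a \<cdot> i = zarr T X1 Y" by (rule ff_zero[OF ff(1)]) (use a in simp_all)
    have 2: "a \<cdot> j = zarr T X2 Y" by (rule ff_zero[OF ff(2)]) (use a in simp_all)
    have "a \<cdot> madd T (i \<cdot> p) (j \<cdot> q) = zarr T P Y"
      using a(1,2) cmp_reduce[OF 1, of p] cmp_reduce[OF 2, of q] by simp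
    then show "a = zarr T P Y" using a(1,2) by (simp add: e)
  next
    fix y assume y [simp]: "src T y = Fo P" "tgt T y = Fo Y"
    obtain a where a [simp]: "src T a = X1" "tgt T a = Y" and Fa: "Fa a = y \<cdot> Fa i"
      by (rule ff_surj[OF ff(1), of "y \<cdot> Fa i"]) simp_all
    obtain b where b [simp]: "src T b = X2" "tgt T b = Y" and Fb: "Fa b = y \<cdot> Fa j"
      by (rule ff_surj[OF ff(2), of "y \<cdot> Fa j"]) simp_all
    have "Fa (madd T (a \<cdot> p) (b \<cdot> q)) = y \<cdot> Fa (madd T (i \<cdot> p) (j \<cdot> q))"
      by (simp add: Fa Fb)
    also have "\<dots> = y" by (subst e) simp
    finally show "\<exists>f. src T f = P \<and> tgt T f = Y \<and> Fa f = y"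
      by (intro exI[of _ "madd T (a \<cdot> p) (b \<cdot> q)"]) simp
  qed
qed

text \<open>Hom(X, P) and Hom(F X, F P) are products of the corresponding Hom groups over
  \<open>I\<close>, the latter because F preserves this product, and F acts componentwise.\<close>

lemma ff_product:
  assumes P: "is_product T I Y P p" and FP: "is_product T I (Fo \<circ> Y) (Fo P) (Fa \<circ> p)"
    and ff: "\<And>k. k \<in> I \<Longrightarrow> ff X (Y k)"
  shows "ff X P"
proof (rule ffI)
  note p = product_arr[OF P]
  fix a assume a: "src T a = X" "tgt T a = P" "Fa a = zarr T (Fo X) (Fo P)"
  show "a = zarr T X P"
  proof (rule product_eq[OF P])
    fix k assume k: "k \<in> I"
    have "p k \<cdot> a = zarr T X (Y k)" by (rule ff_zero[OF ff[OF k]]) (use a p[OF k] in simp_all)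
    then show "p k \<cdot> a = p k \<cdot> zarr T X P" using p[OF k] by simp
  qed (use a in simp_all)
next
  note p = product_arr[OF P]
  fix y assume y [simp]: "src T y = Fo X" "tgt T y = Fo P"
  have "\<exists>f. src T f = X \<and> tgt T f = Y k \<and> Fa f = Fa (p k) \<cdot> y" if "k \<in> I" for k
    using ff_surj[OF ff[OF that], of "Fa (p k) \<cdot> y"] p[OF that] by auto
  then obtain f where f: "\<And>k. k \<in> I \<Longrightarrow> src T (f k) = X \<and> tgt T (f k) = Y k \<and> Fa (f k) = Fa (p k) \<cdot> y"
    by metis
  obtain u where u: "src T u = X" "tgt T u = P" "\<And>k. k \<in> I \<Longrightarrow> p k \<cdot> u = f k"
    using product_ex[OF P, of f X] f by blast
  have "Fa u = y"
  proof (rule product_eq[OF FP])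
    fix k assume k: "k \<in> I"
    have "Fa (p k) \<cdot> Fa u = Fa (f k)" using u(2) p[OF k] by (simp flip: u(3)[OF k])
    then show "(Fa \<circ> p) k \<cdot> Fa u = (Fa \<circ> p) k \<cdot> y" using f[OF k] by simp
  qed (use u in simp_all)
  with u show "\<exists>f. src T f = X \<and> tgt T f = P \<and> Fa f = y" by blast
qed

lemma ff_coproduct:
  assumes P: "is_coproduct T I X P i" and FP: "is_coproduct T I (Fo \<circ> X) (Fo P) (Fa \<circ> i)"
    and ff: "\<And>k. k \<in> I \<Longrightarrow> ff (X k) Y"
  shows "ff P Y"
proof (rule ffI)
  note i = coproduct_arr[OF P]
  fix a assume a: "src T a = P" "tgt T a = Y" "Fa a = zarr T (Fo P) (Fo Y)"
  show "a = zarr T P Y"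
  proof (rule coproduct_eq[OF P])
    fix k assume k: "k \<in> I"
    have "a \<cdot> i k = zarr T (X k) Y" by (rule ff_zero[OF ff[OF k]]) (use a i[OF k] in simp_all)
    then show "a \<cdot> i k = zarr T P Y \<cdot> i k" using i[OF k] by simp
  qed (use a in simp_all)
next
  note i = coproduct_arr[OF P]
  fix y assume y [simp]: "src T y = Fo P" "tgt T y = Fo Y"
  have "\<exists>f. src T f = X k \<and> tgt T f = Y \<and> Fa f = y \<cdot> Fa (i k)" if "k \<in> I" for k
    using ff_surj[OF ff[OF that], of "y \<cdot> Fa (i k)"] i[OF that] by auto
  then obtain f where f: "\<And>k. k \<in> I \<Longrightarrow> src T (f k) = X k \<and> tgt T (f k) = Y \<and> Fa (f k) = y \<cdot> Fa (i k)"
    by metis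
  obtain u where u: "src T u = P" "tgt T u = Y" "\<And>k. k \<in> I \<Longrightarrow> u \<cdot> i k = f k"
    using coproduct_ex[OF P, of f Y] f by blast
  have "Fa u = y"
  proof (rule coproduct_eq[OF FP])
    fix k assume k: "k \<in> I"
    have "Fa u \<cdot> Fa (i k) = Fa (f k)" using u(1) i[OF k] by (simp flip: u(3)[OF k])
    then show "Fa u \<cdot> (Fa \<circ> i) k = y \<cdot> (Fa \<circ> i) k" using f[OF k] by simp
  qed (use u in simp_all)
  with u show "\<exists>f. src T f = P \<and> tgt T f = Y \<and> Fa f = y" by blast
qed

text \<open>The five lemmas also ask for bijectivity at one suspension of either argument, so it is
  the version over all suspensions that is closed under triangles. Nonnegative powers suffice
  because \<open>ff_Sus\<close> cancels a common suspension.\<close>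

definition FF :: "'o \<Rightarrow> 'o \<Rightarrow> bool"
  where "FF X Y \<longleftrightarrow> (\<forall>m n. ff ((So ^^ m) X) ((So ^^ n) Y))"

lemma FF_ff: "FF X Y \<Longrightarrow> ff X Y"
  unfolding FF_def using funpow_0 by metis

lemma FF_Sus_left: "FF (So X) Y \<longleftrightarrow> FF X Y"
proof
  assume *: "FF (So X) Y"
  show "FF X Y" unfolding FF_def
  proof (intro allI)
    fix m n
    have "ff ((So ^^ m) (So X)) ((So ^^ Suc n) Y)" using * by (simp only: FF_def)
    then show "ff ((So ^^ m) X) ((So ^^ n) Y)" by (simp add: ff_Sus flip: funpow_swap1)
  qed
next
  assume *: "FF X Y"
  show "FF (So X) Y" unfolding FF_def
  proof (intro allI)
    fix m n
    have "ff ((So ^^ Suc m) X) ((So ^^ n) Y)" using * by (simp only: FF_def)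
    then show "ff ((So ^^ m) (So X)) ((So ^^ n) Y)" by (simp add: funpow_swap1)
  qed
qed

lemma FF_Sus_right: "FF X (So Y) \<longleftrightarrow> FF X Y"
proof
  assume *: "FF X (So Y)"
  show "FF X Y" unfolding FF_def
  proof (intro allI)
    fix m n
    have "ff ((So ^^ Suc m) X) ((So ^^ n) (So Y))" using * by (simp only: FF_def)
    then show "ff ((So ^^ m) X) ((So ^^ n) Y)" by (simp add: ff_Sus flip: funpow_swap1)
  qed
next
  assume *: "FF X Y"
  show "FF X (So Y)" unfolding FF_def
  proof (intro allI)
    fix m n
    have "ff ((So ^^ m) X) ((So ^^ Suc n) Y)" using * by (simp only: FF_def)
    then show "ff ((So ^^ m) X) ((So ^^ n) (So Y))" by (simp add: funpow_swap1)
  qed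
qed

lemma FF_pow: "FF X Y \<Longrightarrow> ff ((So ^^ m) X) ((So ^^ n) Y)"
  "FF X Y \<Longrightarrow> ff (So ((So ^^ m) X)) ((So ^^ n) Y)" "FF X Y \<Longrightarrow> ff ((So ^^ m) X) (So ((So ^^ n) Y))"
  unfolding FF_def by (simp, metis funpow.simps(2) comp_apply, metis funpow.simps(2) comp_apply)

lemma FF_right_middle:
  assumes t: "dtri Y1 Y2 Y3 f g h" and FF: "FF X Y1" "FF X Y3"
  shows "FF X Y2"
  unfolding FF_def
proof (intro allI)
  fix m n
  obtain f' g' h' where "dtri ((So ^^ n) Y1) ((So ^^ n) Y2) ((So ^^ n) Y3) f' g' h'"
    using t by (rule dtri_Sus_pow)
  then show "ff ((So ^^ m) X) ((So ^^ n) Y2)"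
    by (rule ff_right_middle) (use FF in \<open>simp_all add: FF_pow\<close>)
qed

lemma FF_left_middle:
  assumes t: "dtri X1 X2 X3 f g h" and FF: "FF X1 Y" "FF X3 Y"
  shows "FF X2 Y"
  unfolding FF_def
proof (intro allI)
  fix m n
  obtain f' g' h' where "dtri ((So ^^ m) X1) ((So ^^ m) X2) ((So ^^ m) X3) f' g' h'"
    using t by (rule dtri_Sus_pow)
  then show "ff ((So ^^ m) X2) ((So ^^ n) Y)"
    by (rule ff_left_middle) (use FF in \<open>simp_all add: FF_pow\<close>)
qed

lemma F_zero_object: 
  assumes "is_zero_object T Z" shows "is_zero_object T (Fo Z)"
proof (rule zero_objectI)
  have "idt T Z = zarr T Z Z" using zero_object_arr(1)[OF assms, of "idt T Z"] by simp
  then have "Fa (idt T Z) = Fa (zarr T Z Z)" by (rule arg_cong)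
  then show "idt T (Fo Z) = zarr T (Fo Z) (Fo Z)" by simp
qed

lemma FF_zero_object: "is_zero_object T Z \<Longrightarrow> FF X Z" "is_zero_object T Z \<Longrightarrow> FF Z X"
  unfolding FF_def
  by (intro allI ff_hom0 zero_object_hom0 F_zero_object Sus_pow_zero_object; assumption)+

lemma triangulated_FF_right: "triangulated_subcategory T {Y. \<forall>X\<in>A. FF X Y}"
proof (rule triangulated_subcategoryI)
  show "P \<in> {Y. \<forall>X\<in>A. FF X Y}"
    if "is_biproduct T Y1 Y2 P" "Y1 \<in> {Y. \<forall>X\<in>A. FF X Y}" "Y2 \<in> {Y. \<forall>X\<in>A. FF X Y}" for Y1 Y2 P
    using that ff_right_biproduct[OF biproduct_Sus_pow[OF that(1)]] by (simp add: FF_def)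
qed (auto simp: FF_zero_object FF_Sus_right intro: FF_right_middle)

lemma triangulated_FF_left: "triangulated_subcategory T {X. \<forall>Y\<in>B. FF X Y}"
proof (rule triangulated_subcategoryI)
  show "P \<in> {X. \<forall>Y\<in>B. FF X Y}"
    if "is_biproduct T X1 X2 P" "X1 \<in> {X. \<forall>Y\<in>B. FF X Y}" "X2 \<in> {X. \<forall>Y\<in>B. FF X Y}" for X1 X2 P
    using that ff_left_biproduct[OF biproduct_Sus_pow[OF that(1)]] by (simp add: FF_def)
qed (auto simp: FF_zero_object FF_Sus_left intro: FF_left_middle)

text \<open>The objects \<open>X\<close> with \<open>FF X Y\<close> for all \<open>Y\<close> in
  \<open>B\<close> form a triangulated subcategory closed under small coproducts; containing
  \<open>A\<close>, it contains Loc of \<open>A\<close>.\<close>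

lemma FF_Loc:
  assumes c: "bicontinuous TYPE('u) T T F" and AB: "\<And>X Y. X \<in> A \<Longrightarrow> Y \<in> B \<Longrightarrow> FF X Y"
  shows "X \<in> Loc TYPE('u) T A \<Longrightarrow> Y \<in> B \<Longrightarrow> FF X Y"
proof -
  let ?L = "{X. \<forall>Y\<in>B. FF X Y}"
  have "P \<in> ?L" if I: "small (I :: 'u set)" "X ` I \<subseteq> ?L" "is_coproduct T I X P i" for I X P i
  proof (simp, intro ballI)
    fix Y assume Y: "Y \<in> B"
    show "FF P Y" unfolding FF_def
    proof (intro allI)
      fix m n
      obtain i' where i': "is_coproduct T I (\<lambda>k. (So ^^ m) (X k)) ((So ^^ m) P) i'"
        using Sus_pow_coproduct[OF I(3)] by blast
      have "is_coproduct T I (Fo \<circ> (\<lambda>k. (So ^^ m) (X k))) (Fo ((So ^^ m) P)) (Fa \<circ> i')"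
        using c I(1) i' unfolding bicontinuous_def by blast
      from ff_coproduct[OF i' this] show "ff ((So ^^ m) P) ((So ^^ n) Y)"
        using I(2) Y FF_pow(1) by blast
    qed
  qed
  then have "Loc TYPE('u) T A \<subseteq> ?L"
    unfolding Loc_def by (intro Inter_lower) (use triangulated_FF_left AB in auto)
  then show "X \<in> Loc TYPE('u) T A \<Longrightarrow> Y \<in> B \<Longrightarrow> FF X Y" by blast
qed

lemma FF_coLoc:
  assumes c: "bicontinuous TYPE('u) T T F" and AB: "\<And>X Y. X \<in> A \<Longrightarrow> Y \<in> B \<Longrightarrow> FF X Y"
  shows "X \<in> A \<Longrightarrow> Y \<in> coLoc TYPE('u) T B \<Longrightarrow> FF X Y"
proof -
  let ?L = "{Y. \<forall>X\<in>A. FF X Y}"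
  have "P \<in> ?L" if I: "small (I :: 'u set)" "Y ` I \<subseteq> ?L" "is_product T I Y P p" for I Y P p
  proof (simp, intro ballI)
    fix X assume X: "X \<in> A"
    show "FF X P" unfolding FF_def
    proof (intro allI)
      fix m n
      obtain p' where p': "is_product T I (\<lambda>k. (So ^^ n) (Y k)) ((So ^^ n) P) p'"
        using Sus_pow_product[OF I(3)] by blast
      have "is_product T I (Fo \<circ> (\<lambda>k. (So ^^ n) (Y k))) (Fo ((So ^^ n) P)) (Fa \<circ> p')"
        using c I(1) p' unfolding bicontinuous_def by blast
      from ff_product[OF p' this] show "ff ((So ^^ m) X) ((So ^^ n) P)"
        using I(2) X FF_pow(1) by blast
    qed
  qed
  then have "coLoc TYPE('u) T B \<subseteq> ?L"
    unfolding coLoc_def by (intro Inter_lower) (use triangulated_FF_right AB in auto)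
  then show "X \<in> A \<Longrightarrow> Y \<in> coLoc TYPE('u) T B \<Longrightarrow> FF X Y" by blast
qed

end

section \<open>Towers\<close>

context triangulated_category
begin

text \<open>For vanishing arguments a homotopy colimit is just a cone of an endomorphism of the
  coproduct, and this is the form in which it enters them.\<close>

lemma hocolim_dtri:
  assumes "is_hocolim T Xs \<phi> H \<gamma>s"
  obtains P i d \<gamma> \<delta> where "is_coproduct T UNIV Xs P i" "dtri P P H d \<gamma> \<delta>" "\<forall>n. \<gamma>s n = \<gamma> \<cdot> i n"
proof -
  obtain P i d \<gamma> \<delta> where P: "is_coproduct T UNIV Xs P i" and d: "src T d = P" "tgt T d = P"
    and D: "(d, \<gamma>, \<delta>) \<in> Dist T" and tg: "tgt T \<gamma> = H" and gs: "\<forall>n. \<gamma>s n = \<gamma> \<cdot> i n"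
    using assms unfolding is_hocolim_def by auto
  have t: "dtri P P H d \<gamma> \<delta>"
    using dtriI[OF D] Dist_is_triangle[OF D] tg d by (simp add: is_triangle_def)
  show ?thesis using that[OF P t gs] .
qed

lemma holim_dtri:
  assumes "is_holim T Ys \<psi> H \<sigma>s"
  obtains P p d \<sigma> \<delta> where "is_product T UNIV Ys P p" "dtri H P P \<sigma> d \<delta>" "\<forall>n. \<sigma>s n = p n \<cdot> \<sigma>"
proof -
  obtain P p d \<sigma> \<delta> where P: "is_product T UNIV Ys P p" and d: "src T d = P" "tgt T d = P"
    and D: "(\<sigma>, d, \<delta>) \<in> Dist T" and tg: "src T \<sigma> = H" and gs: "\<forall>n. \<sigma>s n = p n \<cdot> \<sigma>"
    using assms unfolding is_holim_def by auto
  have t: "dtri H P P \<sigma> d \<delta>"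
    using dtriI[OF D] Dist_is_triangle[OF D] tg d by (simp add: is_triangle_def)
  show ?thesis using that[OF P t gs] .
qed

end

context triangle_endofunctor
begin

section \<open>Natural isomorphisms to the identity, and their shifts\<close>

definition nat_to_id :: "'o set \<Rightarrow> ('o \<Rightarrow> 'm) \<Rightarrow> bool"
  where "nat_to_id A \<eta> \<longleftrightarrow> natural_iso_on T T A F id_functor \<eta>"

lemma nat_to_idD:
  assumes "nat_to_id A \<eta>"
  shows "X \<in> A \<Longrightarrow> src T (\<eta> X) = Fo X" "X \<in> A \<Longrightarrow> tgt T (\<eta> X) = X" "X \<in> A \<Longrightarrow> is_iso T (\<eta> X)"
    "src T f = X \<Longrightarrow> tgt T f = Y \<Longrightarrow> X \<in> A \<Longrightarrow> Y \<in> A \<Longrightarrow> \<eta> Y \<cdot> Fa f = f \<cdot> \<eta> X"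
  using natural_isoD[OF assms[unfolded nat_to_id_def]] by (auto simp: id_functor_def)

lemma nat_to_idI:
  assumes "\<And>X. X \<in> A \<Longrightarrow> src T (\<eta> X) = Fo X" "\<And>X. X \<in> A \<Longrightarrow> tgt T (\<eta> X) = X"
    "\<And>X. X \<in> A \<Longrightarrow> is_iso T (\<eta> X)"
    "\<And>f X Y. src T f = X \<Longrightarrow> tgt T f = Y \<Longrightarrow> X \<in> A \<Longrightarrow> Y \<in> A \<Longrightarrow> \<eta> Y \<cdot> Fa f = f \<cdot> \<eta> X"
  shows "nat_to_id A \<eta>"
  unfolding nat_to_id_def natural_iso_on_def id_functor_def using assms by simp

text \<open>Every morphism between suspensions is some \<Sigma>f, so naturality follows from that of
  \<open>\<eta>\<close> and \<open>\<omega>\<close> at \<open>f\<close>.\<close>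

lemma nat_to_id_Sus:
  assumes \<eta>: "nat_to_id A \<eta>" and X: "X \<in> A" "Y \<in> A" and g: "src T g = So X" "tgt T g = So Y"
  shows "Sa (\<eta> Y) \<cdot> (\<omega> Y \<cdot> Fa g) = g \<cdot> (Sa (\<eta> X) \<cdot> \<omega> X)"
proof -
  obtain f where f: "src T f = X" "tgt T f = Y" "Sa f = g" using Sus_full[OF g] .
  note e [simp] = nat_to_idD(1-3)[OF \<eta> X(1)] nat_to_idD(1-3)[OF \<eta> X(2)]
  have "\<omega> Y \<cdot> Fa g = Sa (Fa f) \<cdot> \<omega> X" using \<omega>_natural[of f] f by simp
  moreover have "Sa (\<eta> Y) \<cdot> Sa (Fa f) = Sa f \<cdot> Sa (\<eta> X)"
    using arg_cong[OF nat_to_idD(4)[OF \<eta> f(1,2) X], of Sa] f(1,2) by simp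
  ultimately show ?thesis
    using cmp_reduce[of "Sa (\<eta> Y)" "Sa (Fa f)" _ "\<omega> X"] f g by simp
qed

text \<open>An object of \<open>B\<close> is only isomorphic to a suspension, so the value of
  \<open>\<zeta>\<close> is transported along a chosen isomorphism \<open>s\<close>. On an actual
  suspension the result does not depend on that choice.\<close>

lemma nat_to_id_up:
  assumes \<eta>: "nat_to_id A \<eta>" and B: "\<And>Y. Y \<in> B \<Longrightarrow> \<exists>X\<in>A. \<exists>s. is_iso T s \<and> src T s = So X \<and> tgt T s = Y"
  obtains \<zeta> where "nat_to_id B \<zeta>" "\<And>X. X \<in> A \<Longrightarrow> So X \<in> B \<Longrightarrow> \<zeta> (So X) = Sa (\<eta> X) \<cdot> \<omega> X"
proof -
  have "\<forall>Y. \<exists>s X. Y \<in> B \<longrightarrow> X \<in> A \<and> is_iso T s \<and> src T s = So X \<and> tgt T s = Y"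
    using B by blast
  then obtain s X where s: "\<And>Y. Y \<in> B \<Longrightarrow> X Y \<in> A \<and> is_iso T (s Y) \<and> src T (s Y) = So (X Y) \<and> tgt T (s Y) = Y"
    by metis
  define \<zeta> where "\<zeta> = (\<lambda>Y. s Y \<cdot> (Sa (\<eta> (X Y)) \<cdot> (\<omega> (X Y) \<cdot> arr_inv T (Fa (s Y)))))"
  note e = nat_to_idD(1-3)[OF \<eta>]
  have inv: "src T (arr_inv T (Fa (s Y))) = Fo Y" "tgt T (arr_inv T (Fa (s Y))) = Fo (So (X Y))"
    "is_iso T (arr_inv T (Fa (s Y)))" "Fa (s Y) \<cdot> arr_inv T (Fa (s Y)) = idt T (Fo Y)"
    "arr_inv T (Fa (s Y)) \<cdot> Fa (s Y) = idt T (Fo (So (X Y)))" if "Y \<in> B" for Y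
    using s[OF that] inv_simps[of "Fa (s Y)"] F_iso iso_arr_inv by auto
  have arr: "src T (\<zeta> Y) = Fo Y" "tgt T (\<zeta> Y) = Y" if "Y \<in> B" for Y
    using that s[OF that] e inv[OF that] by (simp_all add: \<zeta>_def)
  have key: "\<zeta> Y \<cdot> Fa (s Y) = s Y \<cdot> (Sa (\<eta> (X Y)) \<cdot> \<omega> (X Y))" if "Y \<in> B" for Y
    using that s[OF that] e inv[OF that] by (simp add: \<zeta>_def)
  have 1: "nat_to_id B \<zeta>"
  proof (rule nat_to_idI)
    fix Y assume Y: "Y \<in> B"
    show "is_iso T (\<zeta> Y)"
      unfolding \<zeta>_def using s[OF Y] e inv[OF Y] by (intro iso_cmp) (simp_all add: Sus_iso)
  next
    fix f Y Y' assume f: "src T f = Y" "tgt T f = Y'" and Y: "Y \<in> B" "Y' \<in> B"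
    note [simp] = f s[OF Y(1)] s[OF Y(2)] arr[OF Y(1)] arr[OF Y(2)] inv_simps[of "s Y'"] e
    define g where "g = arr_inv T (s Y') \<cdot> (f \<cdot> s Y)"
    have g [simp]: "src T g = So (X Y)" "tgt T g = So (X Y')" by (simp_all add: g_def)
    have sg: "s Y' \<cdot> g = f \<cdot> s Y" by (simp add: g_def)
    have "(\<zeta> Y' \<cdot> Fa f) \<cdot> Fa (s Y) = \<zeta> Y' \<cdot> Fa (s Y' \<cdot> g)" by (subst sg) simp
    also have "\<dots> = s Y' \<cdot> (Sa (\<eta> (X Y')) \<cdot> (\<omega> (X Y') \<cdot> Fa g))"
      using cmp_reduce[OF key[OF Y(2)], of "Fa g"] by simp
    also have "\<dots> = s Y' \<cdot> (g \<cdot> (Sa (\<eta> (X Y)) \<cdot> \<omega> (X Y)))"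
      by (subst nat_to_id_Sus[OF \<eta>]) simp_all
    also have "\<dots> = (f \<cdot> \<zeta> Y) \<cdot> Fa (s Y)"
      using cmp_reduce[OF sg, of "Sa (\<eta> (X Y)) \<cdot> \<omega> (X Y)"] by (simp add: key[OF Y(1)])
    finally show "\<zeta> Y' \<cdot> Fa f = f \<cdot> \<zeta> Y"
      by (rule iso_cancel_right[rotated 3]) (simp_all add: F_iso)
  qed (use arr in simp_all)
  \<comment> \<open>After cancelling the image of the chosen isomorphism, independence of the choice
    is naturality along that isomorphism, a morphism between two suspensions.\<close>
  have "\<zeta> (So X') = Sa (\<eta> X') \<cdot> \<omega> X'" if X': "X' \<in> A" "So X' \<in> B" for X'
  proof (rule iso_cancel_right)
    note [simp] = s[OF X'(2)] arr[OF X'(2)] e X'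
    show "is_iso T (Fa (s (So X')))" by (simp add: F_iso)
    show "\<zeta> (So X') \<cdot> Fa (s (So X')) = (Sa (\<eta> X') \<cdot> \<omega> X') \<cdot> Fa (s (So X'))"
      using nat_to_id_Sus[OF \<eta>, of "X (So X')" X' "s (So X')"] key[OF X'(2)] by simp
  qed (use s[OF X'(2)] arr[OF X'(2)] e X' in simp_all)
  with 1 show ?thesis using that by blast
qed

text \<open>Desuspension involves no choice of objects: \<open>\<zeta> X\<close> is the unique arrow
  whose suspension is \<open>\<eta> (So X)\<close> corrected by \<open>\<omega>\<close>.\<close>

lemma nat_to_id_down:
  assumes \<eta>: "nat_to_id B \<eta>" and B: "\<And>X. X \<in> A \<Longrightarrow> So X \<in> B"
  obtains \<zeta> where "nat_to_id A \<zeta>" "\<And>X. X \<in> A \<Longrightarrow> \<eta> (So X) = Sa (\<zeta> X) \<cdot> \<omega> X"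
proof -
  note e = nat_to_idD(1-3)[OF \<eta> B]
  have "\<exists>z. src T z = Fo X \<and> tgt T z = X \<and> Sa z = \<eta> (So X) \<cdot> arr_inv T (\<omega> X)" if X: "X \<in> A" for X
    using Sus_full[of "\<eta> (So X) \<cdot> arr_inv T (\<omega> X)" "Fo X" X] e[OF X] by (auto simp: inv_simps)
  then obtain \<zeta> where z: "\<And>X. X \<in> A \<Longrightarrow> src T (\<zeta> X) = Fo X" "\<And>X. X \<in> A \<Longrightarrow> tgt T (\<zeta> X) = X"
    "\<And>X. X \<in> A \<Longrightarrow> Sa (\<zeta> X) = \<eta> (So X) \<cdot> arr_inv T (\<omega> X)"
    by metis
  have c: "\<eta> (So X) = Sa (\<zeta> X) \<cdot> \<omega> X" if "X \<in> A" for X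
    using z[OF that] e[OF that] by (simp add: inv_simps)
  have "nat_to_id A \<zeta>"
  proof (rule nat_to_idI)
    fix X assume X: "X \<in> A"
    have "is_iso T (Sa (\<zeta> X))"
      using z(3)[OF X] e[OF X] by (simp add: iso_cmp iso_arr_inv inv_simps)
    then show "is_iso T (\<zeta> X)" by (simp add: Sus_iso)
  next
    fix f X Y assume f: "src T f = X" "tgt T f = Y" and X: "X \<in> A" "Y \<in> A"
    note [simp] = z(1,2) X f
    have "Sa (\<zeta> Y \<cdot> Fa f) \<cdot> \<omega> X = \<eta> (So Y) \<cdot> Fa (Sa f)"
      using \<omega>_natural[of f] c[OF X(2)] by simp
    also have "\<dots> = Sa f \<cdot> \<eta> (So X)"
      by (rule nat_to_idD(4)[OF \<eta>]) (simp_all add: B)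
    also have "\<dots> = Sa (f \<cdot> \<zeta> X) \<cdot> \<omega> X" using c[OF X(1)] by simp
    finally have "Sa (\<zeta> Y \<cdot> Fa f) = Sa (f \<cdot> \<zeta> X)"
      by (rule iso_cancel_right[rotated 3]) simp_all
    then show "\<zeta> Y \<cdot> Fa f = f \<cdot> \<zeta> X" by (rule Sus_faithful) simp_all
  qed (use z in simp_all)
  then show ?thesis using c that by blast
qed

text \<open>The core isomorphism is carried through all positive shifts by dependent choice, each
  step compatible with \<open>\<omega>\<close>. \<open>A n\<close> is to be \<Sigma>^n of the core;
  for right towers the downward version uses \<Sigma>^(-n).\<close>

lemma nat_to_id_up_seq:
  assumes \<eta>: "nat_to_id (A 0) \<eta>"
    and B: "\<And>n Y. Y \<in> A (Suc n) \<Longrightarrow> \<exists>X\<in>A n. \<exists>s. is_iso T s \<and> src T s = So X \<and> tgt T s = Y"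
  obtains \<zeta> :: "nat \<Rightarrow> 'o \<Rightarrow> 'm" where "\<zeta> 0 = \<eta>" "\<And>n. nat_to_id (A n) (\<zeta> n)"
    "\<And>n X. X \<in> A n \<Longrightarrow> So X \<in> A (Suc n) \<Longrightarrow> \<zeta> (Suc n) (So X) = Sa (\<zeta> n X) \<cdot> \<omega> X"
proof -
  have "\<exists>\<zeta> :: nat \<Rightarrow> 'o \<Rightarrow> 'm. \<forall>n. (nat_to_id (A n) (\<zeta> n) \<and> (n = 0 \<longrightarrow> \<zeta> n = \<eta>)) \<and>
    (\<forall>X\<in>A n. So X \<in> A (Suc n) \<longrightarrow> \<zeta> (Suc n) (So X) = Sa (\<zeta> n X) \<cdot> \<omega> X)"
  proof (rule dependent_nat_choice[where P = "\<lambda>n z. nat_to_id (A n) z \<and> (n = 0 \<longrightarrow> z = \<eta>)"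
      and Q = "\<lambda>n x y. \<forall>X\<in>A n. So X \<in> A (Suc n) \<longrightarrow> y (So X) = Sa (x X) \<cdot> \<omega> X"])
    fix x n assume "nat_to_id (A n) x \<and> (n = 0 \<longrightarrow> x = \<eta>)"
    then have x: "nat_to_id (A n) x" ..
    obtain z where "nat_to_id (A (Suc n)) z"
      "\<And>X. X \<in> A n \<Longrightarrow> So X \<in> A (Suc n) \<Longrightarrow> z (So X) = Sa (x X) \<cdot> \<omega> X"
      using nat_to_id_up[OF x B] by blast
    then show "\<exists>y. (nat_to_id (A (Suc n)) y \<and> (Suc n = 0 \<longrightarrow> y = \<eta>)) \<and>
        (\<forall>X\<in>A n. So X \<in> A (Suc n) \<longrightarrow> y (So X) = Sa (x X) \<cdot> \<omega> X)"
      by blast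
  qed (use \<eta> in blast)
  then show ?thesis using that by blast
qed

lemma nat_to_id_down_seq:
  assumes \<eta>: "nat_to_id (A 0) \<eta>" and B: "\<And>n X. X \<in> A (Suc n) \<Longrightarrow> So X \<in> A n"
  obtains \<zeta> :: "nat \<Rightarrow> 'o \<Rightarrow> 'm" where "\<zeta> 0 = \<eta>" "\<And>n. nat_to_id (A n) (\<zeta> n)"
    "\<And>n X. X \<in> A (Suc n) \<Longrightarrow> \<zeta> n (So X) = Sa (\<zeta> (Suc n) X) \<cdot> \<omega> X"
proof -
  have "\<exists>\<zeta> :: nat \<Rightarrow> 'o \<Rightarrow> 'm. \<forall>n. (nat_to_id (A n) (\<zeta> n) \<and> (n = 0 \<longrightarrow> \<zeta> n = \<eta>)) \<and>
    (\<forall>X\<in>A (Suc n). \<zeta> n (So X) = Sa (\<zeta> (Suc n) X) \<cdot> \<omega> X)"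
  proof (rule dependent_nat_choice[where P = "\<lambda>n z. nat_to_id (A n) z \<and> (n = 0 \<longrightarrow> z = \<eta>)"
      and Q = "\<lambda>n x y. \<forall>X\<in>A (Suc n). x (So X) = Sa (y X) \<cdot> \<omega> X"])
    fix x n assume "nat_to_id (A n) x \<and> (n = 0 \<longrightarrow> x = \<eta>)"
    then have x: "nat_to_id (A n) x" ..
    obtain z where "nat_to_id (A (Suc n)) z" "\<And>X. X \<in> A (Suc n) \<Longrightarrow> x (So X) = Sa (z X) \<cdot> \<omega> X"
      using nat_to_id_down[OF x B] by blast
    then show "\<exists>y. (nat_to_id (A (Suc n)) y \<and> (Suc n = 0 \<longrightarrow> y = \<eta>)) \<and>
        (\<forall>X\<in>A (Suc n). x (So X) = Sa (y X) \<cdot> \<omega> X)"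
      by blast
  qed (use \<eta> in blast)
  then show ?thesis using that by blast
qed

text \<open>
  The isomorphisms are built so as to be natural with respect to all morphisms from objects of
  \<open>A n\<close> into \<open>X n\<close>. This makes the square over the attaching map of the next cone commute, and it
  is inherited because \<open>p n\<close> induces an injection on morphisms from objects of \<open>A (Suc n)\<close>.
\<close>

lemma left_tower_iso:
  assumes \<zeta>: "\<And>n. nat_to_id (A n) (\<zeta> n)"
    and comp: "\<And>n X. X \<in> A n \<Longrightarrow> \<zeta> (Suc n) (So X) = Sa (\<zeta> n X) \<cdot> \<omega> X"
    and A1: "\<And>n Y. Y \<in> A (Suc n) \<Longrightarrow> \<exists>X\<in>A n. \<exists>s. is_iso T s \<and> src T s = So X \<and> tgt T s = Y"
    and A2: "\<And>n X. X \<in> A n \<Longrightarrow> So X \<in> A (Suc n)"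
    and hom: "\<And>m n X Y. n < m \<Longrightarrow> X \<in> A m \<Longrightarrow> Y \<in> A n \<Longrightarrow> hom0 X Y"
    and X0: "X 0 \<in> A 0" and t: "\<And>n. dtri (X n) (X (Suc n)) (Q n) (\<phi> n) (p n) (q n)"
    and Q: "\<And>n. Q n \<in> A (Suc n)"
  shows "\<exists>\<theta>. (\<forall>n. src T (\<theta> n) = Fo (X n)) \<and> (\<forall>n. tgt T (\<theta> n) = X n) \<and> (\<forall>n. is_iso T (\<theta> n)) \<and>
    (\<forall>n. \<theta> (Suc n) \<cdot> Fa (\<phi> n) = \<phi> n \<cdot> \<theta> n) \<and> \<theta> 0 = \<zeta> 0 (X 0)"
proof -
  \<comment> \<open>\<open>X n\<close> is built by cones from core objects in degrees 0 to
    \<open>n\<close>, all orthogonal to sources of higher degree.\<close>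
  have hom': "hom0 Z (X n)" if "n < m" "Z \<in> A m" for n m Z
    using that
  proof (induction n)
    case 0
    then show ?case using hom X0 by blast
  next
    case (Suc n)
    show ?case by (rule hom0_right_middle[OF t[of n]]) (use Suc hom[OF Suc.prems Q] in simp_all)
  qed
  \<comment> \<open>The last conjunct pins the initial isomorphism to \<open>\<zeta> 0\<close>; this
    link to \<open>\<eta>\<close> is later the only datum through which morphisms are
    compared.\<close>
  define P where "P = (\<lambda>n \<theta>. src T \<theta> = Fo (X n) \<and> tgt T \<theta> = X n \<and> is_iso T \<theta> \<and>
    (\<forall>f. src T f \<in> A n \<longrightarrow> tgt T f = X n \<longrightarrow> \<theta> \<cdot> Fa f = f \<cdot> \<zeta> n (src T f)) \<and> (n = 0 \<longrightarrow> \<theta> = \<zeta> 0 (X 0)))"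
  have "\<exists>\<theta>. \<forall>n. P n (\<theta> n) \<and> \<theta> (Suc n) \<cdot> Fa (\<phi> n) = \<phi> n \<cdot> \<theta> n"
  proof (rule dependent_nat_choice[where P = P and Q = "\<lambda>n x y. y \<cdot> Fa (\<phi> n) = \<phi> n \<cdot> x"])
    show "\<exists>x. P 0 x"
      using nat_to_idD[OF \<zeta>[of 0]] X0 unfolding P_def by (intro exI[of _ "\<zeta> 0 (X 0)"]) simp
  next
    fix \<theta> n assume P: "P n \<theta>"
    note [simp] = dtri_arr[OF t[of n]]
    have th [simp]: "src T \<theta> = Fo (X n)" "tgt T \<theta> = X n" "is_iso T \<theta>"
      and nat: "\<And>f. src T f \<in> A n \<Longrightarrow> tgt T f = X n \<Longrightarrow> \<theta> \<cdot> Fa f = f \<cdot> \<zeta> n (src T f)"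
      using P by (simp_all add: P_def)
    note e = nat_to_idD[OF \<zeta>[of "Suc n"]]
    note e' [simp] = e(1-3)[OF Q[of n]]
    obtain W s where W: "W \<in> A n" and s [simp]: "is_iso T s" "src T s = So W" "tgt T s = Q n"
      using A1[OF Q[of n]] by blast
    note eW [simp] = nat_to_idD(1-3)[OF \<zeta>[of n] W]
    \<comment> \<open>\<open>f\<close> is the attaching map of the cone: the connecting morphism
      \<open>q n\<close>, desuspended to a morphism from an object of \<open>A n\<close> to
      \<open>X n\<close>, to which the invariant applies.\<close>
    obtain f where f [simp]: "src T f = W" "tgt T f = X n" and Sf: "Sa f = q n \<cdot> s"
      using Sus_full[of "q n \<cdot> s" W "X n"] by auto
    have "(Sa \<theta> \<cdot> (\<omega> (X n) \<cdot> Fa (q n))) \<cdot> Fa s = Sa \<theta> \<cdot> (\<omega> (X n) \<cdot> Fa (Sa f))"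
      by (subst Sf) simp
    also have "\<dots> = Sa (\<theta> \<cdot> Fa f) \<cdot> \<omega> W" using \<omega>_natural[of f] by simp
    also have "\<theta> \<cdot> Fa f = f \<cdot> \<zeta> n W" using nat[of f] W by simp
    also have "Sa (f \<cdot> \<zeta> n W) \<cdot> \<omega> W = q n \<cdot> (s \<cdot> \<zeta> (Suc n) (So W))" 
      using Sf by (simp add: comp[OF W])
    also have "s \<cdot> \<zeta> (Suc n) (So W) = \<zeta> (Suc n) (Q n) \<cdot> Fa s"
      using e(4)[of s "So W" "Q n"] A2[OF W] Q by simp
    also have "q n \<cdot> (\<zeta> (Suc n) (Q n) \<cdot> Fa s) = (q n \<cdot> \<zeta> (Suc n) (Q n)) \<cdot> Fa s" by simp
    finally have sq: "Sa \<theta> \<cdot> (\<omega> (X n) \<cdot> Fa (q n)) = q n \<cdot> \<zeta> (Suc n) (Q n)"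
      by (rule iso_cancel_right[rotated 3]) (simp_all add: F_iso)
    note Ft = F_dtri[OF t[of n]]
    obtain v where v [simp]: "src T v = Fo (X (Suc n))" "tgt T v = X (Suc n)"
      and v1: "v \<cdot> Fa (\<phi> n) = \<phi> n \<cdot> \<theta>" and v2: "\<zeta> (Suc n) (Q n) \<cdot> Fa (p n) = p n \<cdot> v"
      by (rule fill_middle[OF Ft t[of n] e'(1,2) th(1,2) sq])
    have iso: "is_iso T v"
      by (rule iso_middle[OF Ft t[of n] th v e' v1 v2 sq])
    have "v \<cdot> Fa g = g \<cdot> \<zeta> (Suc n) (src T g)" if g: "src T g \<in> A (Suc n)" "tgt T g = X (Suc n)" for g
    proof -
      note eg [simp] = e(1-3)[OF g(1)] g(2)
      have "p n \<cdot> (v \<cdot> Fa g) = \<zeta> (Suc n) (Q n) \<cdot> Fa (p n \<cdot> g)"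
        using cmp_reduce[OF v2, of "Fa g"] by simp
      also have "\<dots> = p n \<cdot> (g \<cdot> \<zeta> (Suc n) (src T g))"
        using e(4)[of "p n \<cdot> g" "src T g" "Q n"] g Q by simp
      finally have "p n \<cdot> msub T (v \<cdot> Fa g) (g \<cdot> \<zeta> (Suc n) (src T g)) = zarr T (Fo (src T g)) (Q n)"
        by simp
      from lift_Y[OF t[of n] _ _ this] obtain b where b: "src T b = Fo (src T g)" "tgt T b = X n"
        "\<phi> n \<cdot> b = msub T (v \<cdot> Fa g) (g \<cdot> \<zeta> (Suc n) (src T g))" by auto
      \<comment> \<open>The error term starts at the image under F, which \<open>\<zeta>\<close>
        identifies with the object of \<open>A (Suc n)\<close> itself.\<close>
      have "hom0 (Fo (src T g)) (X n)"
        by (rule hom0_iso[OF hom'[of n "Suc n" "src T g"] isomorphic_sym[OF isomorphicI[OF eg(3,1,2)]]])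
          (use g in simp_all)
      from hom0D[OF this b(1,2)] b(3)
      have "msub T (v \<cdot> Fa g) (g \<cdot> \<zeta> (Suc n) (src T g)) = zarr T (Fo (src T g)) (X (Suc n))" by simp
      then show ?thesis by (rule msub_zero[rotated 2]) simp_all
    qed
    then have "P (Suc n) v" using iso by (simp add: P_def)
    with v1 show "\<exists>y. P (Suc n) y \<and> y \<cdot> Fa (\<phi> n) = \<phi> n \<cdot> \<theta>" by blast
  qed
  then obtain \<theta> where "\<forall>n. P n (\<theta> n)" "\<forall>n. \<theta> (Suc n) \<cdot> Fa (\<phi> n) = \<phi> n \<cdot> \<theta> n" by blast
  then show ?thesis by (intro exI[of _ \<theta>]) (simp add: P_def)
qed

text \<open>The invariant is naturality for all morphisms from \<open>Y n\<close> to objects of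
  \<open>A n\<close>. As \<open>Q n\<close> lies in \<open>A n\<close> and not one degree further,
  the square over \<open>p n\<close> is already an instance of it; the suspension shift appears only
  when the invariant is inherited by the fibre.\<close>

lemma right_tower_iso:
  assumes \<zeta>: "\<And>n. nat_to_id (A n) (\<zeta> n)"
    and comp: "\<And>n X. X \<in> A (Suc n) \<Longrightarrow> \<zeta> n (So X) = Sa (\<zeta> (Suc n) X) \<cdot> \<omega> X"
    and A: "\<And>n X. X \<in> A (Suc n) \<Longrightarrow> So X \<in> A n"
    and hom: "\<And>m n X Y. n < m \<Longrightarrow> X \<in> A n \<Longrightarrow> Y \<in> A m \<Longrightarrow> hom0 X Y"
    and Y0: "Y 0 \<in> A 0" and t: "\<And>n. dtri (Y (Suc n)) (Y n) (Q n) (\<psi> n) (p n) (q n)"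
    and Q: "\<And>n. Q n \<in> A n"
  shows "\<exists>\<theta>. (\<forall>n. src T (\<theta> n) = Fo (Y n)) \<and> (\<forall>n. tgt T (\<theta> n) = Y n) \<and> (\<forall>n. is_iso T (\<theta> n)) \<and>
    (\<forall>n. \<theta> n \<cdot> Fa (\<psi> n) = \<psi> n \<cdot> \<theta> (Suc n)) \<and> \<theta> 0 = \<zeta> 0 (Y 0)"
proof -
  have hom': "hom0 (Y n) Z" if "n < m" "Z \<in> A m" for n m Z
    using that
  proof (induction n arbitrary: m Z)
    case 0
    then show ?case using hom Y0 by blast
  next
    case (Suc n)
    then obtain m' where m: "m = Suc m'" by (cases m) auto
    \<comment> \<open>Suspending \<open>Z\<close> lowers its index from \<open>m\<close> to
      \<open>m'\<close>, and Suc n < m leaves n < m', just enough for orthogonality to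
      \<open>Q n\<close>.\<close>
    have "hom0 (Q n) (So Z)" using hom[of n m' "Q n" "So Z"] Q A Suc.prems m by simp
    moreover have "hom0 (Y n) Z" using Suc.IH[of m Z] Suc.prems by simp
    ultimately show ?case by (intro hom0_left_first[OF t[of n]])
  qed
  define P where "P = (\<lambda>n \<theta>. src T \<theta> = Fo (Y n) \<and> tgt T \<theta> = Y n \<and> is_iso T \<theta> \<and>
    (\<forall>f. tgt T f \<in> A n \<longrightarrow> src T f = Y n \<longrightarrow> \<zeta> n (tgt T f) \<cdot> Fa f = f \<cdot> \<theta>) \<and> (n = 0 \<longrightarrow> \<theta> = \<zeta> 0 (Y 0)))"
  have "\<exists>\<theta>. \<forall>n. P n (\<theta> n) \<and> \<theta> n \<cdot> Fa (\<psi> n) = \<psi> n \<cdot> \<theta> (Suc n)"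
  proof (rule dependent_nat_choice[where P = P and Q = "\<lambda>n x y. x \<cdot> Fa (\<psi> n) = \<psi> n \<cdot> y"])
    show "\<exists>x. P 0 x"
      using nat_to_idD[OF \<zeta>[of 0]] Y0 unfolding P_def by (intro exI[of _ "\<zeta> 0 (Y 0)"]) simp
  next
    fix \<theta> n assume P: "P n \<theta>"
    note [simp] = dtri_arr[OF t[of n]]
    have th [simp]: "src T \<theta> = Fo (Y n)" "tgt T \<theta> = Y n" "is_iso T \<theta>"
      and nat: "\<And>f. tgt T f \<in> A n \<Longrightarrow> src T f = Y n \<Longrightarrow> \<zeta> n (tgt T f) \<cdot> Fa f = f \<cdot> \<theta>"
      using P by (simp_all add: P_def)
    note e = nat_to_idD[OF \<zeta>[of n]]
    note e' [simp] = e(1-3)[OF Q[of n]]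
    have sq: "\<zeta> n (Q n) \<cdot> Fa (p n) = p n \<cdot> \<theta>" using nat[of "p n"] Q by simp
    note Ft = F_dtri[OF t[of n]]
    obtain u where u [simp]: "src T u = Fo (Y (Suc n))" "tgt T u = Y (Suc n)"
      and u1: "\<theta> \<cdot> Fa (\<psi> n) = \<psi> n \<cdot> u" and u2: "Sa u \<cdot> (\<omega> (Y (Suc n)) \<cdot> Fa (q n)) = q n \<cdot> \<zeta> n (Q n)"
      by (rule fill_first[OF Ft t[of n] e'(1,2) th(1,2) sq])
    have iso [simp]: "is_iso T u"
      by (rule iso_first[OF Ft t[of n] u th e' u1 sq u2])
    have "\<zeta> (Suc n) (tgt T g) \<cdot> Fa g = g \<cdot> u" if g: "tgt T g \<in> A (Suc n)" "src T g = Y (Suc n)" for g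
    proof -
      note eg [simp] = nat_to_idD(1-3)[OF \<zeta>[of "Suc n"] g(1)] g(2)
      have SQ: "So (tgt T g) \<in> A n" by (rule A[OF g(1)])
      note eS [simp] = e(1-3)[OF SQ]
      define D where "D = msub T (\<zeta> (Suc n) (tgt T g) \<cdot> Fa g) (g \<cdot> u)"
      have D [simp]: "src T D = Fo (Y (Suc n))" "tgt T D = tgt T g" by (simp_all add: D_def)
      have "Sa (\<zeta> (Suc n) (tgt T g) \<cdot> Fa g) \<cdot> (\<omega> (Y (Suc n)) \<cdot> Fa (q n)) =
        \<zeta> n (So (tgt T g)) \<cdot> Fa (Sa g \<cdot> q n)"
        using cmp_reduce[OF \<omega>_natural[of g], of "Fa (q n)"] by (simp add: comp[OF g(1)])
      also have "\<dots> = (Sa g \<cdot> q n) \<cdot> \<zeta> n (Q n)"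
        by (rule e(4)) (use SQ Q in simp_all)
      also have "\<dots> = Sa (g \<cdot> u) \<cdot> (\<omega> (Y (Suc n)) \<cdot> Fa (q n))"
        by (simp add: u2)
      finally have "Sa D \<cdot> (\<omega> (Y (Suc n)) \<cdot> Fa (q n)) = zarr T (Fo (Q n)) (So (tgt T g))"
        by (simp add: D_def)
      \<comment> \<open>A morphism out of the fibre extends over \<open>Y n\<close> when it kills
        the desuspended connecting morphism. Checking this after \<Sigma> gives a factorisation of
        \<open>Sa D\<close> through a Hom group that vanishes.\<close>
      from extend_SX[OF Ft _ _ this] obtain b where b: "src T b = So (Fo (Y n))"
        "tgt T b = So (tgt T g)" "b \<cdot> Sa (Fa (\<psi> n)) = Sa D" by auto
      have "hom0 (Fo (Y n)) (tgt T g)"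
        by (rule hom0_iso[OF hom'[of n "Suc n" "tgt T g"] isomorphic_sym[OF isomorphicI[OF th(3,1,2)]]])
          (use g in simp_all)
      then have "hom0 (So (Fo (Y n))) (So (tgt T g))" by (simp add: hom0_Sus)
      from hom0D[OF this b(1,2)] b(3)
      have "Sa D = zarr T (So (Fo (Y (Suc n)))) (So (tgt T g))" by simp
      then have "Sa D = Sa (zarr T (Fo (Y (Suc n))) (tgt T g))" by simp
      then have "D = zarr T (Fo (Y (Suc n))) (tgt T g)" by (rule Sus_faithful) simp_all
      then show ?thesis unfolding D_def by (rule msub_zero[rotated 2]) simp_all
    qed
    then have "P (Suc n) u" by (simp add: P_def)
    with u1 show "\<exists>y. P (Suc n) y \<and> \<theta> \<cdot> Fa (\<psi> n) = \<psi> n \<cdot> y" by blast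
  qed
  then obtain \<theta> where "\<forall>n. P n (\<theta> n)" "\<forall>n. \<theta> n \<cdot> Fa (\<psi> n) = \<psi> n \<cdot> \<theta> (Suc n)" by blast
  then show ?thesis by (intro exI[of _ \<theta>]) (simp add: P_def)
qed

text \<open>The \<open>\<theta> n\<close> assemble to an isomorphism of coproducts that commutes
  with 1 - \<phi>, and completion of triangles yields \<open>\<kappa>\<close>. It is not unique, but
  any completion is compatible with the \<open>\<gamma>s n\<close>, which retains control over the
  bottom stage.\<close>

lemma hocolim_iso:
  assumes H: "is_hocolim T X \<phi> H \<gamma>s"
    and arr: "\<And>n. src T (\<phi> n) = X n" "\<And>n. tgt T (\<phi> n) = X (Suc n)"
    and F: "\<And>(X :: nat \<Rightarrow> 'o) P i. is_coproduct T UNIV X P i \<Longrightarrow> is_coproduct T UNIV (Fo \<circ> X) (Fo P) (Fa \<circ> i)"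
    and \<theta>: "\<And>n. src T (\<theta> n) = Fo (X n)" "\<And>n. tgt T (\<theta> n) = X n" "\<And>n. is_iso T (\<theta> n)"
      "\<And>n. \<theta> (Suc n) \<cdot> Fa (\<phi> n) = \<phi> n \<cdot> \<theta> n"
  obtains \<kappa> where "src T \<kappa> = Fo H" "tgt T \<kappa> = H" "is_iso T \<kappa>" "\<And>n. \<kappa> \<cdot> Fa (\<gamma>s n) = \<gamma>s n \<cdot> \<theta> n"
proof -
  obtain P i d \<gamma> \<delta> where P: "is_coproduct T UNIV X P i" and d [simp]: "src T d = P" "tgt T d = P"
    and di: "\<And>n. d \<cdot> i n = msub T (i n) (i (Suc n) \<cdot> \<phi> n)"
    and D: "(d, \<gamma>, \<delta>) \<in> Dist T" and tg: "tgt T \<gamma> = H" and gs: "\<And>n. \<gamma>s n = \<gamma> \<cdot> i n"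
    using H unfolding is_hocolim_def by auto
  have t: "dtri P P H d \<gamma> \<delta>"
    using dtriI[OF D] Dist_is_triangle[OF D] tg by (simp add: is_triangle_def)
  note FP = F[OF P]
  have i [simp]: "src T (i n) = X n" "tgt T (i n) = P" for n using coproduct_arr[OF P] by simp_all
  note [simp] = arr \<theta>(1-3) dtri_arr[OF t]
  obtain \<Theta> where Th [simp]: "src T \<Theta> = Fo P" "tgt T \<Theta> = P" and Ti: "\<And>n. \<Theta> \<cdot> Fa (i n) = i n \<cdot> \<theta> n"
    using coproduct_ex[OF FP, of "\<lambda>n. i n \<cdot> \<theta> n" P] by auto
  \<comment> \<open>The inverse comes from the coproduct property of \<open>P\<close> itself,
    \<open>\<Theta>\<close> from that of its image under F.\<close>
  obtain \<Xi> where Xi [simp]: "src T \<Xi> = P" "tgt T \<Xi> = Fo P" and Xii: "\<And>n. \<Xi> \<cdot> i n = Fa (i n) \<cdot> arr_inv T (\<theta> n)"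
    using coproduct_ex[OF P, of "\<lambda>n. Fa (i n) \<cdot> arr_inv T (\<theta> n)" "Fo P"] by (auto simp: inv_simps)
  have "\<Xi> \<cdot> \<Theta> = idt T (Fo P)"
    by (rule coproduct_eq[OF FP]) (simp_all add: Ti cmp_reduce[OF Xii] inv_simps)
  moreover have "\<Theta> \<cdot> \<Xi> = idt T P"
    by (rule coproduct_eq[OF P]) (simp_all add: Xii cmp_reduce[OF Ti] inv_simps)
  ultimately have iso: "is_iso T \<Theta>" by (intro isoI[of \<Xi>]) simp_all
  have sq: "\<Theta> \<cdot> Fa d = d \<cdot> \<Theta>"
  proof (rule coproduct_eq[OF FP])
    fix n
    have "(\<Theta> \<cdot> Fa d) \<cdot> Fa (i n) = \<Theta> \<cdot> Fa (d \<cdot> i n)" by simp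
    also have "\<dots> = msub T (i n \<cdot> \<theta> n) (i (Suc n) \<cdot> (\<phi> n \<cdot> \<theta> n))"
      by (simp add: di Ti cmp_reduce[OF Ti] \<theta>(4))
    also have "\<dots> = (d \<cdot> \<Theta>) \<cdot> Fa (i n)"
      by (simp add: Ti cmp_reduce[OF di])
    finally show "(\<Theta> \<cdot> Fa d) \<cdot> (Fa \<circ> i) n = (d \<cdot> \<Theta>) \<cdot> (Fa \<circ> i) n" by simp
  qed simp_all
  obtain w where w: "src T w = Fo H" "tgt T w = H" "w \<cdot> Fa \<gamma> = \<gamma> \<cdot> \<Theta>" "Sa \<Theta> \<cdot> (\<omega> P \<cdot> Fa \<delta>) = \<delta> \<cdot> w"
    by (rule fill_third[OF F_dtri[OF t] t Th Th sq])
  have "is_iso T w"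
    by (rule iso_third[OF F_dtri[OF t] t Th iso Th iso w(1,2) sq w(3,4)])
  moreover have "w \<cdot> Fa (\<gamma>s n) = \<gamma>s n \<cdot> \<theta> n" for n
    using w(1,2) by (simp add: gs cmp_reduce[OF w(3)] Ti)
  ultimately show ?thesis using w(1,2) that by blast
qed

lemma holim_iso:
  assumes H: "is_holim T Y \<psi> H \<sigma>s"
    and arr: "\<And>n. src T (\<psi> n) = Y (Suc n)" "\<And>n. tgt T (\<psi> n) = Y n"
    and F: "\<And>(Y :: nat \<Rightarrow> 'o) P p. is_product T UNIV Y P p \<Longrightarrow> is_product T UNIV (Fo \<circ> Y) (Fo P) (Fa \<circ> p)"
    and \<theta>: "\<And>n. src T (\<theta> n) = Fo (Y n)" "\<And>n. tgt T (\<theta> n) = Y n" "\<And>n. is_iso T (\<theta> n)"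
      "\<And>n. \<theta> n \<cdot> Fa (\<psi> n) = \<psi> n \<cdot> \<theta> (Suc n)"
  obtains \<kappa> where "src T \<kappa> = Fo H" "tgt T \<kappa> = H" "is_iso T \<kappa>" "\<And>n. \<theta> n \<cdot> Fa (\<sigma>s n) = \<sigma>s n \<cdot> \<kappa>"
proof -
  obtain P p d \<sigma> \<delta> where P: "is_product T UNIV Y P p" and d [simp]: "src T d = P" "tgt T d = P"
    and pd: "\<And>n. p n \<cdot> d = msub T (p n) (\<psi> n \<cdot> p (Suc n))"
    and D: "(\<sigma>, d, \<delta>) \<in> Dist T" and tg: "src T \<sigma> = H" and gs: "\<And>n. \<sigma>s n = p n \<cdot> \<sigma>"
    using H unfolding is_holim_def by auto
  have t: "dtri H P P \<sigma> d \<delta>"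
    using dtriI[OF D] Dist_is_triangle[OF D] tg by (simp add: is_triangle_def)
  note FP = F[OF P]
  have p [simp]: "src T (p n) = P" "tgt T (p n) = Y n" for n using product_arr[OF P] by simp_all
  note [simp] = arr \<theta>(1-3) dtri_arr[OF t]
  obtain \<Theta> where Th [simp]: "src T \<Theta> = Fo P" "tgt T \<Theta> = P" and Tp: "\<And>n. p n \<cdot> \<Theta> = \<theta> n \<cdot> Fa (p n)"
    using product_ex[OF P, of "\<lambda>n. \<theta> n \<cdot> Fa (p n)" "Fo P"] by auto
  obtain \<Xi> where Xi [simp]: "src T \<Xi> = P" "tgt T \<Xi> = Fo P" and Xip: "\<And>n. Fa (p n) \<cdot> \<Xi> = arr_inv T (\<theta> n) \<cdot> p n"
    using product_ex[OF FP, of "\<lambda>n. arr_inv T (\<theta> n) \<cdot> p n" P] by (auto simp: inv_simps)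
  have "\<Xi> \<cdot> \<Theta> = idt T (Fo P)"
    by (rule product_eq[OF FP]) (simp_all add: Tp cmp_reduce[OF Xip] inv_simps)
  moreover have "\<Theta> \<cdot> \<Xi> = idt T P"
    by (rule product_eq[OF P]) (simp_all add: Xip cmp_reduce[OF Tp] inv_simps)
  ultimately have iso: "is_iso T \<Theta>" by (intro isoI[of \<Xi>]) simp_all
  have sq: "\<Theta> \<cdot> Fa d = d \<cdot> \<Theta>"
  proof (rule product_eq[OF P])
    fix n
    have "p n \<cdot> (\<Theta> \<cdot> Fa d) = \<theta> n \<cdot> Fa (p n \<cdot> d)" by (simp add: cmp_reduce[OF Tp])
    also have "\<dots> = msub T (\<theta> n \<cdot> Fa (p n)) (\<psi> n \<cdot> (\<theta> (Suc n) \<cdot> Fa (p (Suc n))))"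
      by (simp add: pd cmp_reduce[OF \<theta>(4)])
    also have "\<dots> = p n \<cdot> (d \<cdot> \<Theta>)"
      by (simp add: Tp cmp_reduce[OF pd])
    finally show "p n \<cdot> (\<Theta> \<cdot> Fa d) = p n \<cdot> (d \<cdot> \<Theta>)" .
  qed simp_all
  obtain w where w: "src T w = Fo H" "tgt T w = H" "\<Theta> \<cdot> Fa \<sigma> = \<sigma> \<cdot> w" "Sa w \<cdot> (\<omega> H \<cdot> Fa \<delta>) = \<delta> \<cdot> \<Theta>"
    by (rule fill_first[OF F_dtri[OF t] t Th Th sq])
  have "is_iso T w"
    by (rule iso_first[OF F_dtri[OF t] t w(1,2) Th iso Th iso w(3) sq w(4)])
  moreover have "\<theta> n \<cdot> Fa (\<sigma>s n) = \<sigma>s n \<cdot> w" for n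
    using w(1,2) by (simp add: gs flip: w(3)) (simp add: cmp_reduce[OF Tp])
  ultimately show ?thesis using w(1,2) that by blast
qed

end

section \<open>Pre-weight structures\<close>

context triangulated_category
begin

lemma cone_inE:
  assumes "cone_in T f A"
  obtains Z g h where "Z \<in> A" "dtri (src T f) (tgt T f) Z f g h"
proof -
  obtain g h where t: "(f, g, h) \<in> Dist T" "tgt T g \<in> A" using assms unfolding cone_in_def by blast
  show ?thesis
    by (rule that[of "tgt T g" g h])
      (use t dtriI[OF t(1)] Dist_is_triangle[OF t(1)] in \<open>simp_all add: is_triangle_def\<close>)
qed

text \<open>A containment between two shifts moves to all others: upwards by passing to isomorphic
  suspensions, downwards by suspending.\<close>

lemma shifted_subset:
  assumes "shifted T a A \<subseteq> shifted T b B"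
  shows "X \<in> shifted T (n + a) A \<Longrightarrow> X \<in> shifted T (n + b) B"
proof (induction n arbitrary: X rule: int_induct[where k = 0])
  case base
  then show ?case using assms by auto
next
  case (step1 n)
  have "X \<in> shifted T (n + a + 1) A" using step1.prems by (simp add: algebra_simps)
  then obtain Y s where Y: "Y \<in> shifted T (n + a) A" "is_iso T s" "src T s = So Y" "tgt T s = X"
    by (rule shifted_Suc_ex)
  have "So Y \<in> shifted T (n + b + 1) B" using step1.IH[OF Y(1)] by (simp add: shifted_Sus)
  then have "X \<in> shifted T (n + b + 1) B" by (rule shifted_iso[OF _ isomorphicI[OF Y(2-4)]])
  then show ?case by (simp add: algebra_simps)
next
  case (step2 n)
  have "So X \<in> shifted T (n + a) A"
    using step2.prems shifted_Sus[of X "n - 1 + a" A] by (simp add: algebra_simps)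
  then have "So X \<in> shifted T (n + b) B" by (rule step2.IH)
  then show ?case using shifted_Sus[of X "n - 1 + b" B] by (simp add: algebra_simps)
qed

end

text \<open>Homotopy limits of towers are built from countable products and coproducts. Preservation
  is therefore recorded for the index type \<open>nat\<close>, which keeps the universe type out of
  the locale.\<close>

locale pre_weight_setting = triangle_endofunctor T F \<omega>
  for T :: "('o, 'm, 'z) triangulated_category_scheme" (structure)
    and F :: "('o, 'm, 'o, 'm) fctr" and \<omega> :: "'o \<Rightarrow> 'm" +
  fixes U V :: "'o set" and \<eta> :: "'o \<Rightarrow> 'm"
  assumes pre_weight: "pre_weight_structure T U V"
    and convergent: "two_sided_convergent T U V"
    and negative_hom: "\<And>n::int. n \<ge> 1 \<Longrightarrow> Hom_vanishes T (U \<inter> V) (shifted T (- n) (U \<inter> V))"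
    and \<eta>: "natural_iso_on T T (U \<inter> V) F id_functor \<eta>"
    and F_coproduct: "is_coproduct T (UNIV :: nat set) X P i \<Longrightarrow>
      is_coproduct T UNIV (Fo \<circ> X) (Fo P) (Fa \<circ> i)"
    and F_product: "is_product T (UNIV :: nat set) X P i \<Longrightarrow>
      is_product T UNIV (Fo \<circ> X) (Fo P) (Fa \<circ> i)"
begin

section \<open>Closure and vanishing properties of the two classes and the core\<close>

lemma U_iso: "iso_closed U" and V_iso: "iso_closed V"
  using pre_weight iso_closed_of_extension_closed unfolding pre_weight_structure_def by blast+

lemma core_iso: "iso_closed (U \<inter> V)"
  using U_iso V_iso unfolding iso_closed_def by blast

lemma shifted_0_simps [simp]: "shifted T 0 U = U" "shifted T 0 V = V" "shifted T 0 (U \<inter> V) = U \<inter> V"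
  using U_iso V_iso core_iso shifted_0 by auto

lemma shifted_1_V: "shifted T 1 V \<subseteq> V"
  using pre_weight unfolding pre_weight_structure_def by blast

lemma shifted_V_antimono:
  assumes "X \<in> shifted T n V" "m \<le> n" shows "X \<in> shifted T m V"
proof -
  have "X \<in> shifted T (m + int k) V \<Longrightarrow> X \<in> shifted T m V" for k
  proof (induction k)
    case (Suc k)
    have "X \<in> shifted T (m + int k + 0) V"
      by (rule shifted_subset[of 1 V]) (use shifted_1_V Suc.prems in \<open>simp_all add: algebra_simps\<close>)
    then show ?case using Suc.IH by simp
  qed simp
  from this[of "nat (n - m)"] show ?thesis using assms by simp
qed

lemma Sus_V: "X \<in> V \<Longrightarrow> So X \<in> shifted T 1 V" "X \<in> V \<Longrightarrow> So X \<in> V"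
  using shifted_Sus[of X 0 V] shifted_1_V by auto

lemma U_of_Sus: assumes "So X \<in> U" shows "X \<in> U"
proof -
  have "X \<in> shifted T (-1) U" using assms shifted_Sus[of X "-1" U] by simp
  then show ?thesis using pre_weight unfolding pre_weight_structure_def by blast
qed

lemma core_hom0: "X \<in> shifted T p (U \<inter> V) \<Longrightarrow> Y \<in> shifted T q (U \<inter> V) \<Longrightarrow> q < p \<Longrightarrow> hom0 X Y"
  using hom0_shifted[of "U \<inter> V" "q - p" "U \<inter> V" X p Y] negative_hom[of "p - q"]
  by (simp add: Hom_vanishes_iff)

text \<open>A convergent left tower with the cones of the \<open>\<phi> n\<close> chosen. The
  morphism from the n-th stage to \<open>X\<close> is expressed as
  \<open>\<kappa> \<cdot> \<gamma>s n\<close>; its cone stays existential, being needed at one stage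
  at a time.\<close>

definition left_tower_data ::
  "'o \<Rightarrow> (nat \<Rightarrow> 'o) \<Rightarrow> (nat \<Rightarrow> 'm) \<Rightarrow> (nat \<Rightarrow> 'o) \<Rightarrow> (nat \<Rightarrow> 'm) \<Rightarrow> (nat \<Rightarrow> 'm) \<Rightarrow> 'o \<Rightarrow> (nat \<Rightarrow> 'm) \<Rightarrow> 'm \<Rightarrow> bool"
  where "left_tower_data X Xs \<phi> Q p q H \<gamma>s \<kappa> \<longleftrightarrow>
    Xs 0 \<in> U \<inter> V \<and> (\<forall>n. dtri (Xs n) (Xs (Suc n)) (Q n) (\<phi> n) (p n) (q n) \<and>
      Q n \<in> shifted T (int (Suc n)) (U \<inter> V) \<and> Xs n \<in> U_bounded T U V \<and>
      (\<exists>R r s. dtri (Xs n) X R (\<kappa> \<cdot> \<gamma>s n) r s \<and> R \<in> shifted T (int (Suc n)) V)) \<and>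
    is_hocolim T Xs \<phi> H \<gamma>s \<and> src T \<kappa> = H \<and> tgt T \<kappa> = X \<and> is_iso T \<kappa>"

lemma left_tower_data_ex:
  assumes "X \<in> V"
  obtains Xs \<phi> Q p q H \<gamma>s \<kappa> where "left_tower_data X Xs \<phi> Q p q H \<gamma>s \<kappa>"
proof -
  obtain Xs \<iota> \<phi> where c: "convergent_left_tower T U V X Xs \<iota> \<phi>"
    using convergent assms unfolding two_sided_convergent_def left_convergent_def by blast
  obtain H \<gamma>s \<kappa> where H: "is_hocolim T Xs \<phi> H \<gamma>s" and k: "src T \<kappa> = H" "tgt T \<kappa> = X" "is_iso T \<kappa>"
    and g: "\<And>n. \<kappa> \<cdot> \<gamma>s n = \<iota> n"
    using c unfolding convergent_left_tower_def by auto
  have "left_tower T U V X Xs \<iota> \<phi>" using c unfolding convergent_left_tower_def ..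
  then have "Xs n \<in> U_interval T U V (- int n) 0 \<and> \<iota> n \<in> Hom T (Xs n) X \<and>
    \<phi> n \<in> Hom T (Xs n) (Xs (Suc n)) \<and> cone_in T (\<iota> n) (U_le T V (- int n - 1)) \<and>
    cone_in T (\<phi> n) (shifted T (int n + 1) (U \<inter> V))" for n
    unfolding left_tower_def by blast
  then have tower: "Xs n \<in> U_interval T U V (- int n) 0" "src T (\<iota> n) = Xs n" "tgt T (\<iota> n) = X"
    "src T (\<phi> n) = Xs n" "tgt T (\<phi> n) = Xs (Suc n)" 
    "cone_in T (\<iota> n) (U_le T V (- int n - 1))" "cone_in T (\<phi> n) (shifted T (int n + 1) (U \<inter> V))" for n
    by simp_all
  have "\<exists>Z g h. Z \<in> shifted T (int (Suc n)) (U \<inter> V) \<and> dtri (Xs n) (Xs (Suc n)) Z (\<phi> n) g h" for n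
    using cone_inE[OF tower(7)[of n]] tower(4,5)[of n] by (metis add.commute of_nat_Suc)
  then obtain Q p q where Q: "\<And>n. Q n \<in> shifted T (int (Suc n)) (U \<inter> V)"
    "\<And>n. dtri (Xs n) (Xs (Suc n)) (Q n) (\<phi> n) (p n) (q n)" by metis
  have R: "\<exists>R r s. dtri (Xs n) X R (\<kappa> \<cdot> \<gamma>s n) r s \<and> R \<in> shifted T (int (Suc n)) V" for n
  proof -
    obtain Z g' h where "Z \<in> U_le T V (- int n - 1)" "dtri (src T (\<iota> n)) (tgt T (\<iota> n)) Z (\<iota> n) g' h"
      using tower(6)[of n] by (rule cone_inE)
    then show ?thesis using tower(2,3)[of n] g[of n] by (auto simp: U_le_def algebra_simps)
  qed
  have B: "Xs n \<in> U_bounded T U V" for n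
    unfolding U_bounded_def using tower(1)[of n] by (intro UN_I[of "- int n"] UN_I[of 0]) simp_all
  have C: "Xs 0 \<in> U \<inter> V"
    using tower(1)[of 0] by (simp add: U_interval_def U_ge_def U_le_def)
  have "left_tower_data X Xs \<phi> Q p q H \<gamma>s \<kappa>"
    unfolding left_tower_data_def by (intro conjI allI B C Q R H k)
  then show ?thesis by (rule that)
qed

lemma left_tower_dataD:
  assumes "left_tower_data X Xs \<phi> Q p q H \<gamma>s \<kappa>"
  shows "Xs 0 \<in> U \<inter> V" "dtri (Xs n) (Xs (Suc n)) (Q n) (\<phi> n) (p n) (q n)"
    "Q n \<in> shifted T (int (Suc n)) (U \<inter> V)" "Xs n \<in> U_bounded T U V"
    "\<exists>R r s. dtri (Xs n) X R (\<kappa> \<cdot> \<gamma>s n) r s \<and> R \<in> shifted T (int (Suc n)) V"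
    "is_hocolim T Xs \<phi> H \<gamma>s" "src T \<kappa> = H" "tgt T \<kappa> = X" "is_iso T \<kappa>"
  using assms unfolding left_tower_data_def by blast+

text \<open>The degrees are not mirror images of those of a left tower: the cones over stage
  \<open>n\<close> have shift -n here, against n + 1 there, since the tower describes
  fibres.\<close>

definition right_tower_data ::
  "'o \<Rightarrow> (nat \<Rightarrow> 'o) \<Rightarrow> (nat \<Rightarrow> 'm) \<Rightarrow> (nat \<Rightarrow> 'o) \<Rightarrow> (nat \<Rightarrow> 'm) \<Rightarrow> (nat \<Rightarrow> 'm) \<Rightarrow> 'o \<Rightarrow> (nat \<Rightarrow> 'm) \<Rightarrow> 'm \<Rightarrow> bool"
  where "right_tower_data Y Ys \<psi> Q p q H \<sigma>s \<kappa> \<longleftrightarrow>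
    Ys 0 \<in> U \<inter> V \<and> (\<forall>n. dtri (Ys (Suc n)) (Ys n) (Q n) (\<psi> n) (p n) (q n) \<and>
      Q n \<in> shifted T (- int n) (U \<inter> V) \<and> Ys n \<in> U_bounded T U V \<and>
      (\<exists>R r s. dtri Y (Ys n) R (\<sigma>s n \<cdot> \<kappa>) r s \<and> R \<in> shifted T (- int n) U)) \<and>
    is_holim T Ys \<psi> H \<sigma>s \<and> src T \<kappa> = Y \<and> tgt T \<kappa> = H \<and> is_iso T \<kappa>"

lemma right_tower_data_ex:
  assumes "Y \<in> U"
  obtains Ys \<psi> Q p q H \<sigma>s \<kappa> where "right_tower_data Y Ys \<psi> Q p q H \<sigma>s \<kappa>"
proof -
  obtain Ys \<pi> \<psi> where c: "convergent_right_tower T U V Y Ys \<pi> \<psi>"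
    using convergent assms unfolding two_sided_convergent_def right_convergent_def by blast
  obtain H \<sigma>s \<kappa> where H: "is_holim T Ys \<psi> H \<sigma>s" and k: "src T \<kappa> = Y" "tgt T \<kappa> = H" "is_iso T \<kappa>"
    and g: "\<And>n. \<sigma>s n \<cdot> \<kappa> = \<pi> n"
    using c unfolding convergent_right_tower_def by auto
  have "right_tower T U V Y Ys \<pi> \<psi>" using c unfolding convergent_right_tower_def ..
  then have "Ys n \<in> U_interval T U V 0 (int n) \<and> \<pi> n \<in> Hom T Y (Ys n) \<and>
    \<psi> n \<in> Hom T (Ys (Suc n)) (Ys n) \<and> cone_in T (\<pi> n) (U_ge T U (int n)) \<and>
    cone_in T (\<psi> n) (shifted T (- int n) (U \<inter> V))" for n
    unfolding right_tower_def by blast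
  then have tower: "Ys n \<in> U_interval T U V 0 (int n)" "src T (\<pi> n) = Y" "tgt T (\<pi> n) = Ys n"
    "src T (\<psi> n) = Ys (Suc n)" "tgt T (\<psi> n) = Ys n" 
    "cone_in T (\<pi> n) (U_ge T U (int n))" "cone_in T (\<psi> n) (shifted T (- int n) (U \<inter> V))" for n
    by simp_all
  have "\<exists>Z g h. Z \<in> shifted T (- int n) (U \<inter> V) \<and> dtri (Ys (Suc n)) (Ys n) Z (\<psi> n) g h" for n
    using cone_inE[OF tower(7)[of n]] tower(4,5)[of n] by metis
  then obtain Q p q where Q: "\<And>n. Q n \<in> shifted T (- int n) (U \<inter> V)"
    "\<And>n. dtri (Ys (Suc n)) (Ys n) (Q n) (\<psi> n) (p n) (q n)" by metis
  have R: "\<exists>R r s. dtri Y (Ys n) R (\<sigma>s n \<cdot> \<kappa>) r s \<and> R \<in> shifted T (- int n) U" for n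
  proof -
    obtain Z g' h where "Z \<in> U_ge T U (int n)" "dtri (src T (\<pi> n)) (tgt T (\<pi> n)) Z (\<pi> n) g' h"
      using tower(6)[of n] by (rule cone_inE)
    then show ?thesis using tower(2,3)[of n] g[of n] by (auto simp: U_ge_def)
  qed
  have B: "Ys n \<in> U_bounded T U V" for n
    unfolding U_bounded_def using tower(1)[of n] by (intro UN_I[of 0] UN_I[of "int n"]) simp_all
  have C: "Ys 0 \<in> U \<inter> V"
    using tower(1)[of 0] by (simp add: U_interval_def U_ge_def U_le_def)
  have "right_tower_data Y Ys \<psi> Q p q H \<sigma>s \<kappa>"
    unfolding right_tower_data_def by (intro conjI allI B C Q R H k)
  then show ?thesis by (rule that)
qed

lemma right_tower_dataD:
  assumes "right_tower_data Y Ys \<psi> Q p q H \<sigma>s \<kappa>"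
  shows "Ys 0 \<in> U \<inter> V" "dtri (Ys (Suc n)) (Ys n) (Q n) (\<psi> n) (p n) (q n)"
    "Q n \<in> shifted T (- int n) (U \<inter> V)" "Ys n \<in> U_bounded T U V"
    "\<exists>R r s. dtri Y (Ys n) R (\<sigma>s n \<cdot> \<kappa>) r s \<and> R \<in> shifted T (- int n) U"
    "is_holim T Ys \<psi> H \<sigma>s" "src T \<kappa> = Y" "tgt T \<kappa> = H" "is_iso T \<kappa>"
  using assms unfolding right_tower_data_def by blast+

text \<open>The stages of a right tower are iterated fibres of morphisms into \<Sigma>^(-n) of the
  core, and negative self-extensions of the core vanish; the homotopy limit inherits the
  vanishing.\<close>

lemma core_U_hom0:
  assumes Y: "Y \<in> U" and k: "k \<ge> 1" and Z: "Z \<in> shifted T k (U \<inter> V)"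
  shows "hom0 Z Y"
proof -
  obtain Ys \<psi> Q p q H \<sigma>s \<kappa> where D: "right_tower_data Y Ys \<psi> Q p q H \<sigma>s \<kappa>"
    using Y by (rule right_tower_data_ex)
  note d = right_tower_dataD[OF D]
  have *: "hom0 Z (Ys n)" if "k \<ge> 1" "Z \<in> shifted T k (U \<inter> V)" for n k Z
    using that
  proof (induction n arbitrary: k Z)
    case 0
    then show ?case using core_hom0[of Z k "Ys 0" 0] d(1) by simp
  next
    case (Suc n)
    have "hom0 (So Z) (Q n)"
      using core_hom0[of "So Z" "k + 1" "Q n" "- int n"] Suc.prems d(3)[of n] by (simp add: shifted_Sus)
    then show ?case using Suc by (intro hom0_right_first[OF d(2)[of n]]) blast+
  qed
  obtain P i e \<sigma> \<delta> where P: "is_product T UNIV Ys P i" and t: "dtri H P P \<sigma> e \<delta>"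
    using d(6) by (rule holim_dtri)
  \<comment> \<open>The homotopy limit is a fibre of an endomorphism of \<open>P\<close>, so the
    vanishing is needed for \<open>So Z\<close> too. This is why the induction was run for all
    degrees \<open>k\<close>.\<close>
  have "hom0 Z P" "hom0 (So Z) P"
    using hom0_product[OF P] *[OF k Z] *[of "k + 1" "So Z"] k Z by (auto simp: shifted_Sus)
  then have "hom0 Z H" by (rule hom0_right_first[OF t])
  then show ?thesis
    by (rule hom0_iso) (simp_all add: isomorphic_sym[OF isomorphicI[OF d(9,7,8)]])
qed

text \<open>The towers are used on both sides: a right tower gives vanishing on core objects, and a
  left tower builds the source from core objects in degrees at least zero.\<close>

lemma V_U_hom0:
  assumes X: "X \<in> shifted T 1 V" and Y: "Y \<in> U"
  shows "hom0 X Y"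
proof -
  obtain X' s where X': "X' \<in> shifted T 0 V" "is_iso T s" "src T s = So X'" "tgt T s = X"
    using shifted_Suc_ex[of X 0 V] X by auto
  \<comment> \<open>Both sides are desuspended, so that the left tower starts in the core itself.
    The condition on the target becomes that \<open>So B\<close> lies in \<open>U\<close>.\<close>
  obtain B t where B: "is_iso T t" "src T t = So B" "tgt T t = Y" by (rule Sus_ess_surj)
  have SB: "So B \<in> U"
    using iso_closedD[OF U_iso Y] isomorphic_sym isomorphicI[OF B] by blast
  have "X' \<in> V" using X'(1) by simp
  then obtain Xs \<phi> Q p q H \<gamma>s \<kappa> where D: "left_tower_data X' Xs \<phi> Q p q H \<gamma>s \<kappa>"
    by (rule left_tower_data_ex)
  note d = left_tower_dataD[OF D]
  have core: "hom0 Z B" if "So B \<in> U" "Z \<in> shifted T (int k) (U \<inter> V)" for Z k B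
    using core_U_hom0[OF that(1), of "int k + 1" "So Z"] that(2) by (simp add: shifted_Sus hom0_Sus)
  have *: "hom0 (Xs n) B" if "So B \<in> U" for n B
  proof (induction n)
    case 0
    then show ?case using core[OF that, of "Xs 0" 0] d(1) by simp
  next
    case (Suc n)
    then show ?case using hom0_left_middle[OF d(2)[of n] Suc core[OF that d(3)]] by blast
  qed
  obtain P i e \<gamma> \<delta> where P: "is_coproduct T UNIV Xs P i" and t': "dtri P P H e \<gamma> \<delta>"
    using d(6) by (rule hocolim_dtri)
  have **: "hom0 P B" if "So B \<in> U" for B using hom0_coproduct[OF P *[OF that]] .
  \<comment> \<open>The homotopy colimit is a cone, so \<open>So P\<close> is needed as well as
    \<open>P\<close>. Its suspension is moved to the target, where \<open>U\<close> is closed under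
    desuspension; hence the earlier claims are kept for arbitrary \<open>B\<close>.\<close>
  have "hom0 (So P) B"
  proof -
    obtain B' s where B': "is_iso T s" "src T s = So B'" "tgt T s = B" by (rule Sus_ess_surj)
    have iso: "isomorphic T (So B') B" using isomorphicI[OF B'] .
    then have "isomorphic T (So B) (So (So B'))" by (simp add: Sus_isomorphic isomorphic_sym)
    then have "So (So B') \<in> U" using iso_closedD[OF U_iso SB] by blast
    then have "So B' \<in> U" by (rule U_of_Sus)
    then have "hom0 (So P) (So B')" using ** by (simp add: hom0_Sus)
    then show ?thesis by (rule hom0_iso) (simp_all add: iso)
  qed
  then have "hom0 H B" using **[OF SB] by (intro hom0_left_third[OF t'])
  then have "hom0 X' B" by (rule hom0_iso) (simp_all add: isomorphicI[OF d(9,7,8)])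
  then have "hom0 (So X') (So B)" by (simp add: hom0_Sus)
  then show ?thesis by (rule hom0_iso) (rule isomorphicI[OF X'(2-4)], rule isomorphicI[OF B])
qed

section \<open>Isomorphisms between F X and X\<close>

lemma \<eta>_nat_to_id: "nat_to_id (U \<inter> V) \<eta>"
  unfolding nat_to_id_def by (rule \<eta>)

text \<open>\<open>C\<close> is the bottom stage of the tower, and \<open>\<iota>\<close> has its
  cone in \<Sigma>(V). The isomorphism of homotopy colimits is carried to \<open>X\<close> along
  \<open>\<kappa>\<close>; that it restricts to \<open>\<eta>\<close> on \<open>C\<close> is what
  makes comparisons possible later.\<close>

lemma V_iso_data:
  assumes X: "X \<in> V"
  obtains C R \<iota> r s \<theta> where "C \<in> U \<inter> V" "R \<in> shifted T 1 V" "dtri C X R \<iota> r s"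
    "src T \<theta> = Fo X" "tgt T \<theta> = X" "is_iso T \<theta>" "\<theta> \<cdot> Fa \<iota> = \<iota> \<cdot> \<eta> C"
proof -
  obtain Xs \<phi> Q p q H \<gamma>s \<kappa> where D: "left_tower_data X Xs \<phi> Q p q H \<gamma>s \<kappa>"
    using X by (rule left_tower_data_ex)
  note d = left_tower_dataD[OF D]
  define A where "A = (\<lambda>n. shifted T (int n) (U \<inter> V))"
  have A0: "A 0 = U \<inter> V" by (simp add: A_def)
  have A1: "\<exists>X\<in>A n. \<exists>s. is_iso T s \<and> src T s = So X \<and> tgt T s = Y" if "Y \<in> A (Suc n)" for n Y
    using shifted_Suc_ex[of Y "int n" "U \<inter> V"] that unfolding A_def by (metis add.commute of_nat_Suc)
  have A2: "So X \<in> A (Suc n)" if "X \<in> A n" for n X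
    using shifted_Sus[of X "int n" "U \<inter> V"] that by (simp add: A_def add.commute)
  obtain \<zeta> where z: "\<zeta> 0 = \<eta>" "\<And>n. nat_to_id (A n) (\<zeta> n)"
    "\<And>n X. X \<in> A n \<Longrightarrow> So X \<in> A (Suc n) \<Longrightarrow> \<zeta> (Suc n) (So X) = Sa (\<zeta> n X) \<cdot> \<omega> X"
    using nat_to_id_up_seq[of A \<eta>, unfolded A0, OF \<eta>_nat_to_id A1] by blast
  have comp: "\<zeta> (Suc n) (So X) = Sa (\<zeta> n X) \<cdot> \<omega> X" if "X \<in> A n" for n X
    using z(3)[OF that A2[OF that]] .
  have hom: "hom0 X Y" if "n < m" "X \<in> A m" "Y \<in> A n" for m n X Y
    using that core_hom0[of X "int m" Y "int n"] by (simp add: A_def)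
  have A3: "Xs 0 \<in> A 0" and A4: "Q n \<in> A (Suc n)" for n
    using d(1) d(3)[of n] unfolding A_def by simp_all
  have "\<exists>\<theta>. (\<forall>n. src T (\<theta> n) = Fo (Xs n)) \<and> (\<forall>n. tgt T (\<theta> n) = Xs n) \<and>
    (\<forall>n. is_iso T (\<theta> n)) \<and> (\<forall>n. \<theta> (Suc n) \<cdot> Fa (\<phi> n) = \<phi> n \<cdot> \<theta> n) \<and> \<theta> 0 = \<zeta> 0 (Xs 0)"
    by (rule left_tower_iso[of A \<zeta> Xs Q \<phi> p q]; fact z(2) comp A1 A2 hom A3 d(2) A4)
  then obtain \<theta> where th: "\<And>n. src T (\<theta> n) = Fo (Xs n)" "\<And>n. tgt T (\<theta> n) = Xs n" "\<And>n. is_iso T (\<theta> n)"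
    "\<And>n. \<theta> (Suc n) \<cdot> Fa (\<phi> n) = \<phi> n \<cdot> \<theta> n" "\<theta> 0 = \<zeta> 0 (Xs 0)"
    by blast
  obtain \<kappa>' where k: "src T \<kappa>' = Fo H" "tgt T \<kappa>' = H" "is_iso T \<kappa>'"
    "\<And>n. \<kappa>' \<cdot> Fa (\<gamma>s n) = \<gamma>s n \<cdot> \<theta> n"
  proof (rule hocolim_iso[OF d(6) _ _ F_coproduct th(1-4)])
    show "src T (\<phi> n) = Xs n" "tgt T (\<phi> n) = Xs (Suc n)" for n using dtri_arr[OF d(2)] by simp_all
  qed (assumption, (rule that; blast))
  obtain R r s where R: "dtri (Xs 0) X R (\<kappa> \<cdot> \<gamma>s 0) r s" "R \<in> shifted T 1 V"
    using d(5)[of 0] by auto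
  have g: "src T (\<gamma>s 0) = Xs 0" "tgt T (\<gamma>s 0) = H"
  proof -
    obtain P i e \<gamma> \<delta> where P: "is_coproduct T UNIV Xs P i" "dtri P P H e \<gamma> \<delta>" "\<forall>n. \<gamma>s n = \<gamma> \<cdot> i n"
      using d(6) by (rule hocolim_dtri)
    show "src T (\<gamma>s 0) = Xs 0" "tgt T (\<gamma>s 0) = H"
      using coproduct_arr[OF P(1), of 0] dtri_arr[OF P(2)] P(3) by simp_all
  qed
  note [simp] = d(7-9) k(1-3) g inv_simps[OF F_iso[OF d(9)]]
  have [simp]: "src T (\<eta> (Xs 0)) = Fo (Xs 0)" "tgt T (\<eta> (Xs 0)) = Xs 0"
    using nat_to_idD(1,2)[OF \<eta>_nat_to_id d(1)] by simp_all
  show ?thesis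
  proof (rule that[OF d(1) R(2,1)])
    show "is_iso T (\<kappa> \<cdot> (\<kappa>' \<cdot> arr_inv T (Fa \<kappa>)))"
      by (intro iso_cmp iso_arr_inv F_iso) simp_all
    show "(\<kappa> \<cdot> (\<kappa>' \<cdot> arr_inv T (Fa \<kappa>))) \<cdot> Fa (\<kappa> \<cdot> \<gamma>s 0) = (\<kappa> \<cdot> \<gamma>s 0) \<cdot> \<eta> (Xs 0)"
      by (simp add: k(4) th(5) z(1))
  qed simp_all
qed

text \<open>Dual to the previous construction: \<open>C\<close> is the bottom stage of a right
  tower. The cone \<open>R\<close> of \<open>\<pi>\<close> lies in \<open>U\<close>, so the fibre
  lies one desuspension further.\<close>

lemma U_iso_data:
  assumes Y: "Y \<in> U"
  obtains C R \<pi> r s \<theta> where "C \<in> U \<inter> V" "R \<in> U" "dtri Y C R \<pi> r s"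
    "src T \<theta> = Fo Y" "tgt T \<theta> = Y" "is_iso T \<theta>" "\<eta> C \<cdot> Fa \<pi> = \<pi> \<cdot> \<theta>"
proof -
  obtain Ys \<psi> Q p q H \<sigma>s \<kappa> where D: "right_tower_data Y Ys \<psi> Q p q H \<sigma>s \<kappa>"
    using Y by (rule right_tower_data_ex)
  note d = right_tower_dataD[OF D]
  define A where "A = (\<lambda>n. shifted T (- int n) (U \<inter> V))"
  have A0: "A 0 = U \<inter> V" by (simp add: A_def)
  have A1: "So X \<in> A n" if "X \<in> A (Suc n)" for n X
    using shifted_Sus[of X "- int (Suc n)" "U \<inter> V"] that by (simp add: A_def)
  obtain \<zeta> where z: "\<zeta> 0 = \<eta>" "\<And>n. nat_to_id (A n) (\<zeta> n)"
    "\<And>n X. X \<in> A (Suc n) \<Longrightarrow> \<zeta> n (So X) = Sa (\<zeta> (Suc n) X) \<cdot> \<omega> X"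
    using nat_to_id_down_seq[of A \<eta>, unfolded A0, OF \<eta>_nat_to_id A1] by blast
  have hom: "hom0 X Y" if "n < m" "X \<in> A n" "Y \<in> A m" for m n X Y
    using that core_hom0[of X "- int n" Y "- int m"] by (simp add: A_def)
  have A2: "Ys 0 \<in> A 0" and A3: "Q n \<in> A n" for n
    using d(1) d(3)[of n] unfolding A_def by simp_all
  have "\<exists>\<theta>. (\<forall>n. src T (\<theta> n) = Fo (Ys n)) \<and> (\<forall>n. tgt T (\<theta> n) = Ys n) \<and>
    (\<forall>n. is_iso T (\<theta> n)) \<and> (\<forall>n. \<theta> n \<cdot> Fa (\<psi> n) = \<psi> n \<cdot> \<theta> (Suc n)) \<and> \<theta> 0 = \<zeta> 0 (Ys 0)"
    by (rule right_tower_iso[of A \<zeta> Ys Q \<psi> p q]; fact z(2,3) A1 hom A2 d(2) A3)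
  then obtain \<theta> where th: "\<And>n. src T (\<theta> n) = Fo (Ys n)" "\<And>n. tgt T (\<theta> n) = Ys n" "\<And>n. is_iso T (\<theta> n)"
    "\<And>n. \<theta> n \<cdot> Fa (\<psi> n) = \<psi> n \<cdot> \<theta> (Suc n)" "\<theta> 0 = \<zeta> 0 (Ys 0)"
    by blast
  obtain \<kappa>' where k: "src T \<kappa>' = Fo H" "tgt T \<kappa>' = H" "is_iso T \<kappa>'"
    "\<And>n. \<theta> n \<cdot> Fa (\<sigma>s n) = \<sigma>s n \<cdot> \<kappa>'"
  proof (rule holim_iso[OF d(6) _ _ F_product th(1-4)])
    show "src T (\<psi> n) = Ys (Suc n)" "tgt T (\<psi> n) = Ys n" for n using dtri_arr[OF d(2)] by simp_all
  qed (assumption, (rule that; blast))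
  obtain R r s where R: "dtri Y (Ys 0) R (\<sigma>s 0 \<cdot> \<kappa>) r s" "R \<in> U"
    using d(5)[of 0] by auto
  have g: "src T (\<sigma>s 0) = H" "tgt T (\<sigma>s 0) = Ys 0"
  proof -
    obtain P i e \<sigma> \<delta> where P: "is_product T UNIV Ys P i" "dtri H P P \<sigma> e \<delta>" "\<forall>n. \<sigma>s n = i n \<cdot> \<sigma>"
      using d(6) by (rule holim_dtri)
    show "src T (\<sigma>s 0) = H" "tgt T (\<sigma>s 0) = Ys 0"
      using product_arr[OF P(1), of 0] dtri_arr[OF P(2)] P(3) by simp_all
  qed
  note [simp] = d(7-9) k(1-3) g inv_simps[OF d(9)]
  have [simp]: "src T (\<eta> (Ys 0)) = Fo (Ys 0)" "tgt T (\<eta> (Ys 0)) = Ys 0"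
    using nat_to_idD(1,2)[OF \<eta>_nat_to_id d(1)] by simp_all
  have k4: "\<eta> (Ys 0) \<cdot> Fa (\<sigma>s 0) = \<sigma>s 0 \<cdot> \<kappa>'" using k(4)[of 0] th(5) z(1) by simp
  show ?thesis
  proof (rule that[OF d(1) R(2,1)])
    show "is_iso T (arr_inv T \<kappa> \<cdot> (\<kappa>' \<cdot> Fa \<kappa>))"
      by (intro iso_cmp iso_arr_inv F_iso) simp_all
    show "\<eta> (Ys 0) \<cdot> Fa (\<sigma>s 0 \<cdot> \<kappa>) = (\<sigma>s 0 \<cdot> \<kappa>) \<cdot> (arr_inv T \<kappa> \<cdot> (\<kappa>' \<cdot> Fa \<kappa>))"
      using cmp_reduce[OF k4, of "Fa \<kappa>"] by simp
  qed simp_all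
qed

text \<open>
  A morphism from \<open>V\<close> to \<open>U\<close> is determined by its composites with \<open>\<iota>\<close> and \<open>\<pi>\<close>, which reduces
  naturality to the core.
\<close>

lemma V_U_natural:
  assumes X: "X \<in> V" "C \<in> U \<inter> V" "R \<in> shifted T 1 V" "dtri C X R \<iota> r s"
      "src T \<theta> = Fo X" "tgt T \<theta> = X" "is_iso T \<theta>" "\<theta> \<cdot> Fa \<iota> = \<iota> \<cdot> \<eta> C"
    and Y: "C' \<in> U \<inter> V" "R' \<in> U" "dtri Y C' R' \<pi> r' s'"
      "src T \<theta>' = Fo Y" "tgt T \<theta>' = Y" "is_iso T \<theta>'" "\<eta> C' \<cdot> Fa \<pi> = \<pi> \<cdot> \<theta>'"
    and h: "src T h = X" "tgt T h = Y"
  shows "\<theta>' \<cdot> Fa h = h \<cdot> \<theta>"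
proof -
  note [simp] = dtri_arr[OF X(4)] dtri_arr[OF Y(3)] X(5-7) Y(4-6) h
  note e [simp] = nat_to_idD(1,2)[OF \<eta>_nat_to_id X(2)] nat_to_idD(1,2)[OF \<eta>_nat_to_id Y(1)]
  define D where "D = msub T (\<theta>' \<cdot> Fa h) (h \<cdot> \<theta>)"
  have D [simp]: "src T D = Fo X" "tgt T D = Y" by (simp_all add: D_def)
  have "\<pi> \<cdot> (\<theta>' \<cdot> (Fa h \<cdot> Fa \<iota>)) = \<eta> C' \<cdot> Fa (\<pi> \<cdot> (h \<cdot> \<iota>))"
    using cmp_reduce[OF Y(7), of "Fa h \<cdot> Fa \<iota>"] by simp
  also have "\<dots> = \<pi> \<cdot> (h \<cdot> (\<theta> \<cdot> Fa \<iota>))"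
    using nat_to_idD(4)[OF \<eta>_nat_to_id, of "\<pi> \<cdot> (h \<cdot> \<iota>)" C C'] X(2) Y(1) by (simp add: X(8))
  finally have "(\<pi> \<cdot> D) \<cdot> Fa \<iota> = zarr T (Fo C) C'" by (simp add: D_def)
  from extend_Y[OF F_dtri[OF X(4)] _ _ this]
  obtain b where b: "src T b = Fo R" "tgt T b = C'" "b \<cdot> Fa r = \<pi> \<cdot> D" by auto
  \<comment> \<open>\<open>R\<close> also lies in \<open>V\<close>, so F R \<cong> R is already
    available and turns orthogonality of \<open>R\<close> to the core into orthogonality of its
    image.\<close>
  have "R \<in> V" using X(3) shifted_1_V by blast
  then obtain \<rho> where "src T \<rho> = Fo R" "tgt T \<rho> = R" "is_iso T \<rho>" by (rule V_iso_data)
  then have "isomorphic T R (Fo R)" by (blast intro: isomorphicI isomorphic_sym)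
  then have "hom0 (Fo R) C'"
    using hom0_iso[OF V_U_hom0[OF X(3), of C']] Y(1) by simp
  from hom0D[OF this b(1,2)] b(3) have pD: "\<pi> \<cdot> D = zarr T (Fo X) C'" by simp
  \<comment> \<open>Now \<open>D\<close> factors through the fibre of \<open>\<pi>\<close>. After
    one suspension the factor goes from an object isomorphic to \<Sigma>X, in \<Sigma>(V), to
    \<open>R'\<close> in \<open>U\<close>.\<close>
  have "Sa \<pi> \<cdot> Sa D = zarr T (So (Fo X)) (So C')" using arg_cong[OF pD, of Sa] by simp
  from lift_SX[OF Y(3) _ _ this] obtain c where c: "src T c = So (Fo X)" "tgt T c = R'" "s' \<cdot> c = Sa D"
    by auto
  have "isomorphic T (So X) (So (Fo X))"
    unfolding Sus_isomorphic by (rule isomorphic_sym, rule isomorphicI[of \<theta>]) simp_all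
  then have "hom0 (So (Fo X)) R'"
    using hom0_iso[OF V_U_hom0[OF Sus_V(1)[OF X(1)] Y(2)]] by simp
  from hom0D[OF this c(1,2)] c(3) have "Sa D = Sa (zarr T (Fo X) Y)" by simp
  then have "D = zarr T (Fo X) Y" by (rule Sus_faithful) simp_all
  then show ?thesis unfolding D_def by (rule msub_zero[rotated 2]) simp_all
qed

lemma decomposition: obtains A B f g h where "A \<in> U" "B \<in> shifted T 1 V" "dtri A X B f g h"
proof -
  have "X \<in> extension_product T U (shifted T 1 V)"
    using pre_weight unfolding pre_weight_structure_def by blast
  then show ?thesis using that by (rule extension_productE)
qed

text \<open>Naturality with respect to the connecting morphism alone suffices to complete to an
  isomorphism at \<open>X\<close>. The completion is a choice, so nothing is claimed about
  naturality in \<open>X\<close>.\<close>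

lemma F_object_iso: obtains \<theta> where "src T \<theta> = Fo X" "tgt T \<theta> = X" "is_iso T \<theta>"
proof -
  obtain A B f g h where A: "A \<in> U" and B: "B \<in> shifted T 1 V" and t: "dtri A X B f g h"
    by (rule decomposition)
  note [simp] = dtri_arr[OF t]
  obtain W s where W: "W \<in> V" and s [simp]: "is_iso T s" "src T s = So W" "tgt T s = B"
    using shifted_Suc_ex[of B 0 V] B by auto
  obtain k where k [simp]: "src T k = W" "tgt T k = A" and Sk: "Sa k = h \<cdot> s"
    using Sus_full[of "h \<cdot> s" W A] by auto
  \<comment> \<open>Replacing \<open>B\<close> by \<open>So W\<close> makes the connecting morphism
    a literal suspension \<open>Sa k\<close>, with \<open>k\<close> going from \<open>V\<close> to
    \<open>U\<close>, where naturality is known.\<close>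
  have t': "dtri A X (So W) f (arr_inv T s \<cdot> g) (Sa k)"
    by (rule dtri_iso[OF t, of _ _ _ "arr_inv T s"]) (simp_all add: inv_simps iso_arr_inv Sk)
  obtain C R \<iota> r q \<theta> where X: "C \<in> U \<inter> V" "R \<in> shifted T 1 V" "dtri C W R \<iota> r q"
    "src T \<theta> = Fo W" "tgt T \<theta> = W" "is_iso T \<theta>" "\<theta> \<cdot> Fa \<iota> = \<iota> \<cdot> \<eta> C"
    using W by (rule V_iso_data)
  obtain C' R' \<pi> r' q' \<theta>' where Y: "C' \<in> U \<inter> V" "R' \<in> U" "dtri A C' R' \<pi> r' q'"
      "src T \<theta>' = Fo A" "tgt T \<theta>' = A" "is_iso T \<theta>'" "\<eta> C' \<cdot> Fa \<pi> = \<pi> \<cdot> \<theta>'"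
    using A by (rule U_iso_data)
  note [simp] = X(4-6) Y(4-6)
  have nat: "\<theta>' \<cdot> Fa k = k \<cdot> \<theta>" by (rule V_U_natural[OF W X Y]) simp_all
  define w where "w = Sa \<theta> \<cdot> \<omega> W"
  have w: "src T w = Fo (So W)" "tgt T w = So W" "is_iso T w"
    by (simp_all add: w_def iso_cmp Sus_iso)
  have "Sa \<theta>' \<cdot> (\<omega> A \<cdot> Fa (Sa k)) = Sa (\<theta>' \<cdot> Fa k) \<cdot> \<omega> W"
    using \<omega>_natural[of k] by simp
  then have sq: "Sa \<theta>' \<cdot> (\<omega> A \<cdot> Fa (Sa k)) = Sa k \<cdot> w"
    by (simp add: nat w_def)
  obtain v where v: "src T v = Fo X" "tgt T v = X" "v \<cdot> Fa f = f \<cdot> \<theta>'"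
    "w \<cdot> Fa (arr_inv T s \<cdot> g) = (arr_inv T s \<cdot> g) \<cdot> v"
    by (rule fill_middle[OF F_dtri[OF t'] t' w(1,2) Y(4,5) sq])
  have "is_iso T v"
    by (rule iso_middle[OF F_dtri[OF t'] t' Y(4-6) v(1,2) w v(3,4) sq])
  with v show ?thesis using that by blast
qed

lemma F_isomorphic_id: "isomorphic T (Fo X) X" "isomorphic T X (Fo X)"
proof -
  obtain \<theta> where "src T \<theta> = Fo X" "tgt T \<theta> = X" "is_iso T \<theta>" by (rule F_object_iso)
  then show "isomorphic T (Fo X) X" by (blast intro: isomorphicI)
  then show "isomorphic T X (Fo X)" by (rule isomorphic_sym)
qed

text \<open>Here the objectwise isomorphisms enter full faithfulness: since F X \<cong> X and F Y
  \<cong> Y, both Hom groups vanish together.\<close>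

lemma ff_of_hom0: "hom0 X Y \<Longrightarrow> ff X Y"
  using hom0_iso[OF _ F_isomorphic_id(2) F_isomorphic_id(2)] ff_hom0 by blast

lemma U_bounded_iff:
  "X \<in> U_bounded T U V \<longleftrightarrow> (\<exists>m n. m \<le> n \<and> X \<in> shifted T (- m) U \<and> X \<in> shifted T (- n) V)"
  unfolding U_bounded_def U_interval_def U_ge_def U_le_def by auto

lemma U_bounded_Sus: assumes "X \<in> U_bounded T U V" shows "So X \<in> U_bounded T U V"
proof -
  obtain m n where "m \<le> n" "X \<in> shifted T (- m) U" "X \<in> shifted T (- n) V"
    using assms unfolding U_bounded_iff by blast
  then show ?thesis
    unfolding U_bounded_iff using shifted_Sus[of X "- m" U] shifted_Sus[of X "- n" V]
    by (intro exI[of _ "m - 1"] exI[of _ "n - 1"]) simp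
qed

lemma U_bounded_Sus_pow: "X \<in> U_bounded T U V \<Longrightarrow> (So ^^ k) X \<in> U_bounded T U V"
  by (induction k) (simp_all add: U_bounded_Sus)

end

text \<open>\<open>e\<close> is d + 1 for an admissible dimension bound d.\<close>

locale finite_dimension_setting = pre_weight_setting +
  fixes e :: int
  assumes dimension: "X \<in> U \<Longrightarrow> Y \<in> shifted T e V \<Longrightarrow> hom0 X Y"
begin

lemma U_V_hom0:
  assumes "X \<in> shifted T p U" "Y \<in> shifted T q V" "p + e \<le> q"
  shows "hom0 X Y"
  using hom0_shifted[of U e V X p Y] dimension assms(1) shifted_V_antimono[OF assms(2,3)] by simp

text \<open>\<open>Y\<close> differs from a bounded stage of its left tower by a cone in
  \<Sigma>^(n+1)(V), which by finite dimension is invisible from \<open>X\<close> once the stage is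
  far enough.\<close>

lemma FF_V:
  assumes X: "X \<in> shifted T p U" and Y: "Y \<in> V" and FF: "\<And>Z. Z \<in> U_bounded T U V \<Longrightarrow> FF X Z"
  shows "FF X Y"
  unfolding FF_def
proof (intro allI)
  fix a b
  obtain Xs \<phi> Q q q' H \<gamma>s \<kappa> where D: "left_tower_data Y Xs \<phi> Q q q' H \<gamma>s \<kappa>"
    using Y by (rule left_tower_data_ex)
  \<comment> \<open>The binding condition comes from \<Sigma>^(a+1) X against \<Sigma>^b R, namely p
    + a + 1 + e \<le> n + 1 + b. The stage is chosen after \<open>a\<close>, so each pair of
    suspensions gets its own.\<close>
  define n where "n = nat (p + int a + e)"
  obtain R r s where R: "dtri (Xs n) Y R (\<kappa> \<cdot> \<gamma>s n) r s" "R \<in> shifted T (int (Suc n)) V"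
    using left_tower_dataD(5)[OF D] by blast
  obtain f g h where t: "dtri ((So ^^ b) (Xs n)) ((So ^^ b) Y) ((So ^^ b) R) f g h"
    using R(1) by (rule dtri_Sus_pow)
  have SR: "(So ^^ b) R \<in> shifted T (int (Suc n) + int b) V" using R(2) by (rule shifted_pow')
  have SX: "(So ^^ a) X \<in> shifted T (p + int a) U" using X by (rule shifted_pow')
  then have SSX: "So ((So ^^ a) X) \<in> shifted T (p + int a + 1) U" by (simp add: shifted_Sus)
  note FXn = FF[OF left_tower_dataD(4)[OF D, of n]]
  show "ff ((So ^^ a) X) ((So ^^ b) Y)"
  proof (rule ff_right_middle[OF t])
    show "ff ((So ^^ a) X) ((So ^^ b) R)"
      by (rule ff_of_hom0, rule U_V_hom0[OF SX SR]) (simp add: n_def)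
    show "ff (So ((So ^^ a) X)) ((So ^^ b) R)"
      by (rule ff_of_hom0, rule U_V_hom0[OF SSX SR]) (simp add: n_def)
  qed (use FXn in \<open>simp_all add: FF_pow\<close>)
qed

text \<open>Dually, \<open>X\<close> is approximated by a bounded stage of its right tower. The
  triangle is rotated so that the suspension of \<open>X\<close> stands in the middle, which is why
  \<open>So X\<close> is treated in place of \<open>X\<close>.\<close>

lemma FF_U:
  assumes X: "X \<in> U" and Y: "Y \<in> shifted T p V" and FF: "\<And>Z. Z \<in> U_bounded T U V \<Longrightarrow> FF Z Y"
  shows "FF X Y"
proof -
  have "FF (So X) Y"
    unfolding FF_def
  proof (intro allI)
    fix a b
    obtain Ys \<psi> Q q q' H \<sigma>s \<kappa> where D: "right_tower_data X Ys \<psi> Q q q' H \<sigma>s \<kappa>"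
      using X by (rule right_tower_data_ex)
    \<comment> \<open>\<open>R\<close> lies in \<Sigma>^(-n)(U); the binding condition, for
      \<Sigma>^(a+1) R against \<Sigma>^b Y, is -n + a + 1 + e \<le> p + b.\<close>
    define n where "n = nat (int a + 1 + e - p)"
    obtain R r s where R: "dtri X (Ys n) R (\<sigma>s n \<cdot> \<kappa>) r s" "R \<in> shifted T (- int n) U"
      using right_tower_dataD(5)[OF D] by blast
    obtain f g h where t: "dtri ((So ^^ a) R) ((So ^^ a) (So X)) ((So ^^ a) (So (Ys n))) f g h"
      using dtri_rotate[OF dtri_rotate[OF R(1)]] by (rule dtri_Sus_pow)
    have SR: "(So ^^ a) R \<in> shifted T (- int n + int a) U" using R(2) by (rule shifted_pow')
    then have SSR: "So ((So ^^ a) R) \<in> shifted T (- int n + int a + 1) U" by (simp add: shifted_Sus)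
    have SY: "(So ^^ b) Y \<in> shifted T (p + int b) V" using Y by (rule shifted_pow')
    have FYn: "FF (So (Ys n)) Y" using FF[OF right_tower_dataD(4)[OF D, of n]] by (simp add: FF_Sus_left)
    show "ff ((So ^^ a) (So X)) ((So ^^ b) Y)"
    proof (rule ff_left_middle[OF t])
      show "ff ((So ^^ a) R) ((So ^^ b) Y)"
        by (rule ff_of_hom0, rule U_V_hom0[OF SR SY]) (simp add: n_def)
      show "ff (So ((So ^^ a) R)) ((So ^^ b) Y)"
        by (rule ff_of_hom0, rule U_V_hom0[OF SSR SY]) (simp add: n_def)
    qed (use FYn in \<open>simp_all add: FF_pow\<close>)
  qed
  then show ?thesis by (simp add: FF_Sus_left)
qed

text \<open>Loc handles sources in \<open>V\<close> and coLoc targets in \<open>U\<close>. The other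
  two kinds, targets in \<open>V\<close> and sources in \<open>U\<close>, are reduced to bounded
  objects by finite dimension. Decomposing each variable then gives all pairs.\<close>

lemma FF_everywhere:
  assumes c: "bicontinuous TYPE('u) T T F"
    and Loc: "V \<subseteq> Loc TYPE('u) T (U_bounded T U V)"
    and coLoc: "U \<subseteq> coLoc TYPE('u) T (U_bounded T U V)"
    and bounded: "fully_faithful_on T T (U_bounded T U V) F"
  shows "FF X Y"
proof -
  let ?B = "U_bounded T U V"
  have BB: "FF X Y" if "X \<in> ?B" "Y \<in> ?B" for X Y
    unfolding FF_def ff_def using bounded that U_bounded_Sus_pow unfolding fully_faithful_on_def by blast
  have "FF X Y" if "X \<in> Loc TYPE('u) T ?B" "Y \<in> coLoc TYPE('u) T ?B" for X Y
    by (rule FF_coLoc[OF c FF_Loc[OF c BB] that])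
  then have VU: "FF X Y" if "X \<in> V" "Y \<in> U" for X Y using Loc coLoc that by blast
  have BV: "FF X Y" if X: "X \<in> ?B" and Y: "Y \<in> V" for X Y
  proof -
    obtain m where "X \<in> shifted T m U" using X unfolding U_bounded_iff by blast
    then show ?thesis using Y BB[OF X] by (rule FF_V)
  qed
  have VV: "FF X Y" if "X \<in> V" "Y \<in> V" for X Y
    by (rule FF_Loc[OF c BV, of ?B V]) (use Loc that in blast)+
  have UB: "FF X Y" if X: "X \<in> U" and Y: "Y \<in> ?B" for X Y
  proof -
    obtain m where m: "Y \<in> shifted T m V" using Y unfolding U_bounded_iff by blast
    show ?thesis using X m BB[OF _ Y] by (rule FF_U)
  qed
  have UU: "FF X Y" if "X \<in> U" "Y \<in> U" for X Y
    by (rule FF_coLoc[OF c UB, of U ?B]) (use coLoc that in blast)+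
  \<comment> \<open>Neither generation hypothesis addresses this pair: the target is reduced to
    bounded objects here, after the source was dealt with in \<open>UB\<close>.\<close>
  have UV: "FF X Y" if X: "X \<in> U" and Y: "Y \<in> V" for X Y
    by (rule FF_V[of X 0]) (use X Y UB in simp_all)
  have *: "FF X Y" if "X \<in> U \<or> X \<in> V" for X
  proof -
    obtain A B f g h where "A \<in> U" "B \<in> shifted T 1 V" and t: "dtri A Y B f g h"
      by (rule decomposition)
    then have "FF X A" "FF X B" using that UU UV VU VV shifted_1_V by blast+
    then show ?thesis by (rule FF_right_middle[OF t])
  qed
  obtain A B f g h where "A \<in> U" "B \<in> shifted T 1 V" and t: "dtri A X B f g h"
    by (rule decomposition)
  then have "FF A Y" "FF B Y" using * shifted_1_V by blast+
  then show ?thesis by (rule FF_left_middle[OF t])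
qed

end

section \<open>Conjugating a functor to the identity on objects\<close>

text \<open>Such a functor is even an isomorphism of categories: the inverse takes preimages of
  arrows, and identity arrows serve as both natural isomorphisms.\<close>

lemma (in category) equivalence_of_bijective:
  assumes G: "is_functor T T G" and ob: "\<And>X. fob G X = X"
    and bij: "\<And>X Y. bij_betw (far G) (Hom T X Y) (Hom T X Y)"
  shows "is_equivalence T T G"
proof -
  define pre where "pre = (\<lambda>f. the_inv_into (Hom T (src T f) (tgt T f)) (far G) f)"
  define H :: "('o, 'm, 'o, 'm) fctr" where "H = \<lparr>fob = (\<lambda>X. X), far = pre\<rparr>"
  note [simp] = functor_simps[OF G] ob
  have Gi: "far G (pre f) = f" for f
    unfolding pre_def by (rule f_the_inv_into_f_bij_betw[OF bij]) simp
  have "pre f \<in> Hom T (src T f) (tgt T f)" for f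
    unfolding pre_def
    by (rule the_inv_into_into[OF bij_betw_imp_inj_on[OF bij]])
      (use bij[of "src T f" "tgt T f"] in \<open>simp_all add: bij_betw_def del: in_Hom\<close>, simp)
  then have i [simp]: "src T (pre f) = src T f" "tgt T (pre f) = tgt T f" for f by simp_all
  have inj: "f = g" if "far G f = far G g" "src T f = src T g" "tgt T f = tgt T g" for f g
    by (rule inj_onD[OF bij_betw_imp_inj_on[OF bij[of "src T g" "tgt T g"]] that(1)]) (use that in simp_all)
  have iG: "pre (far G f) = f" for f by (rule inj) (simp_all add: Gi)
  have "is_functor T T H"
    unfolding is_functor_def H_def
  proof (intro conjI allI ballI)
    show "far \<lparr>fob = \<lambda>X. X, far = pre\<rparr> (idt T X) = idt T (fob \<lparr>fob = \<lambda>X. X, far = pre\<rparr> X)" for X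
      using iG[of "idt T X"] by simp
    show "far \<lparr>fob = \<lambda>X. X, far = pre\<rparr> (g \<cdot> f) =
        far \<lparr>fob = \<lambda>X. X, far = pre\<rparr> g \<cdot> far \<lparr>fob = \<lambda>X. X, far = pre\<rparr> f"
      if "f \<in> Hom T X Y" "g \<in> Hom T Y Z" for f g X Y Z
      using iG[of "pre g \<cdot> pre f"] that by (simp add: Gi)
  qed simp
  moreover have "natural_iso T T (comp_functor H G) id_functor (idt T)"
    "natural_iso T T (comp_functor G H) id_functor (idt T)"
    by (simp_all add: natural_iso_on_def comp_functor_def id_functor_def H_def Gi iG)
  ultimately show ?thesis unfolding is_equivalence_def using G by blast
qed

text \<open>No naturality of \<open>\<theta>\<close> is assumed: transporting F along
  \<open>\<theta>\<close> produces a functor for which \<open>\<theta>\<close> is natural by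
  construction.\<close>

locale conjugated_functor = triangle_endofunctor T F \<omega>
  for T :: "('o, 'm, 'z) triangulated_category_scheme" (structure)
    and F :: "('o, 'm, 'o, 'm) fctr" and \<omega> :: "'o \<Rightarrow> 'm" +
  fixes \<theta> :: "'o \<Rightarrow> 'm"
  assumes \<theta>: "src T (\<theta> X) = Fo X" "tgt T (\<theta> X) = X" "is_iso T (\<theta> X)"
begin

definition conj_functor :: "('o, 'm, 'o, 'm) fctr"
  where "conj_functor = \<lparr>fob = \<lambda>X. X, far = \<lambda>f. \<theta> (tgt T f) \<cdot> (Fa f \<cdot> arr_inv T (\<theta> (src T f)))\<rparr>"

text \<open>The value is forced by compatibility of \<open>\<theta>\<close> with the connecting
  isomorphisms, \<open>conj_connect X \<cdot> \<theta> (So X) = Sa (\<theta> X) \<cdot> \<omega>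
  X\<close>.\<close>

definition conj_connect :: "'o \<Rightarrow> 'm"
  where "conj_connect X = Sa (\<theta> X) \<cdot> (\<omega> X \<cdot> arr_inv T (\<theta> (So X)))"

lemma \<theta>_simps [simp]:
  "src T (\<theta> X) = Fo X" "tgt T (\<theta> X) = X" "is_iso T (\<theta> X)"
  "src T (arr_inv T (\<theta> X)) = X" "tgt T (arr_inv T (\<theta> X)) = Fo X" "is_iso T (arr_inv T (\<theta> X))"
  "arr_inv T (\<theta> X) \<cdot> \<theta> X = idt T (Fo X)" "\<theta> X \<cdot> arr_inv T (\<theta> X) = idt T X"
  "tgt T x = Fo X \<Longrightarrow> arr_inv T (\<theta> X) \<cdot> (\<theta> X \<cdot> x) = x"
  "tgt T x = X \<Longrightarrow> \<theta> X \<cdot> (arr_inv T (\<theta> X) \<cdot> x) = x"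
  using \<theta> by (simp_all add: inv_simps iso_arr_inv)

lemma conj_functor_simps [simp]:
  "fob conj_functor X = X"
  "far conj_functor f = \<theta> (tgt T f) \<cdot> (Fa f \<cdot> arr_inv T (\<theta> (src T f)))"
  by (simp_all add: conj_functor_def)

lemma conj_functor: "is_additive_functor T T conj_functor"
  unfolding is_additive_functor_def is_functor_def by simp

lemma conj_functor_equivalence:
  assumes ff: "\<And>X Y. ff X Y"
  shows "is_equivalence T T conj_functor"
proof (rule equivalence_of_bijective)
  show "is_functor T T conj_functor" using conj_functor by (rule additive_functor)
  show "bij_betw (far conj_functor) (Hom T X Y) (Hom T X Y)" for X Y
  proof (rule bij_betwI')
    fix f g assume f: "f \<in> Hom T X Y" and g: "g \<in> Hom T X Y"
    note [simp] = f[simplified] g[simplified]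
    show "far conj_functor f = far conj_functor g \<longleftrightarrow> f = g"
    proof
      assume "far conj_functor f = far conj_functor g"
      then have "\<theta> Y \<cdot> (Fa f \<cdot> arr_inv T (\<theta> X)) = \<theta> Y \<cdot> (Fa g \<cdot> arr_inv T (\<theta> X))" by simp
      then have "Fa f \<cdot> arr_inv T (\<theta> X) = Fa g \<cdot> arr_inv T (\<theta> X)"
        by (rule iso_cancel_left[rotated 3]) simp_all
      then have "Fa f = Fa g" by (rule iso_cancel_right[rotated 3]) simp_all
      then show "f = g"
        using inj_onD[OF bij_betw_imp_inj_on[OF ff[of X Y, unfolded ff_def]]] f g by blast
    qed simp
  next
    fix y assume "y \<in> Hom T X Y"
    then have y [simp]: "src T y = X" "tgt T y = Y" by simp_all
    obtain f where f [simp]: "src T f = X" "tgt T f = Y" "Fa f = arr_inv T (\<theta> Y) \<cdot> (y \<cdot> \<theta> X)"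
      by (rule ff_surj[OF ff, of "arr_inv T (\<theta> Y) \<cdot> (y \<cdot> \<theta> X)" X Y]) simp_all
    show "\<exists>f\<in>Hom T X Y. y = far conj_functor f" by (rule bexI[of _ f]) simp_all
  qed simp
qed simp

lemma conj_functor_triangle: "is_triangle_functor T T conj_functor conj_connect"
  unfolding is_triangle_functor_def
proof (intro conjI allI impI)
  show "is_additive_functor T T conj_functor" by (rule conj_functor)
  have iso: "is_iso T (conj_connect X)" for X
    unfolding conj_connect_def by (intro iso_cmp) (simp_all add: Sus_iso)
  have nat: "conj_connect (tgt T f) \<cdot> far conj_functor (Sa f) =
      Sa (far conj_functor f) \<cdot> conj_connect (src T f)" for f
  proof -
    have "Sa (arr_inv T (\<theta> X)) \<cdot> Sa (\<theta> X) = idt T (So (Fo X))" for X by (simp flip: Sus_simps(4))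
    then show ?thesis
      by (simp add: conj_connect_def cmp_reduce[OF \<omega>_natural] cmp_reduce[of "Sa (arr_inv T (\<theta> _))"])
  qed
  show "natural_iso T T (comp_functor conj_functor (Sus T)) (comp_functor (Sus T) conj_functor) conj_connect"
    unfolding natural_iso_on_def
  proof (intro conjI ballI)
    fix X Y f assume f: "f \<in> Hom T X Y"
    show "conj_connect Y \<cdot> far (comp_functor conj_functor (Sus T)) f =
        far (comp_functor (Sus T) conj_functor) f \<cdot> conj_connect X"
      using nat[of f] f by (simp only: comp_functor_def fctr.simps comp_apply in_Hom)
  next
    show "conj_connect X \<in> Hom T (fob (comp_functor conj_functor (Sus T)) X)
        (fob (comp_functor (Sus T) conj_functor) X)" for X
      by (simp add: conj_connect_def comp_functor_def)
  qed (use iso in simp)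
next
  fix f g h assume "(f, g, h) \<in> Dist T"
  then obtain X Y Z where t: "dtri X Y Z f g h" using dtriI by blast
  have Ft: "(Fa f, Fa g, \<omega> X \<cdot> Fa h) \<in> Dist T"
    using F_dtri[OF t] by (simp add: dtri_def)
  note [simp] = dtri_arr[OF t]
  show "(far conj_functor f, far conj_functor g, conj_connect (src T f) \<cdot> far conj_functor h) \<in> Dist T"
    \<comment> \<open>The conjugated triangle is isomorphic through \<open>\<theta>\<close> to the
      image under F of the given one.\<close>
    by (rule TR1_iso[OF Ft, of _ _ _ "\<theta> X" "\<theta> Y" "\<theta> Z"])
      (simp_all add: is_triangle_def conj_connect_def)
qed

lemma conj_functor_isomorphic:
  "triangle_functors_isomorphic T T F \<omega> conj_functor conj_connect"
  unfolding triangle_functors_isomorphic_def natural_iso_on_def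
  by (intro exI[of _ \<theta>]) (simp add: conj_connect_def)

end

text \<open>If no bound were admissible, the infimum would run over infinity alone; any admissible
  bound serves, so attainment of the infimum is not at issue.\<close>

lemma finite_dimension:
  fixes T :: "('o, 'm, 'z) triangulated_category_scheme"
  assumes "pw_dimension T U V \<noteq> \<infinity>"
  obtains d :: int where "Hom_vanishes T U (U_le T V (- (d + 1)))"
proof -
  have "\<exists>d::int. d \<ge> -1 \<and> Hom_vanishes T U (U_le T V (- (d + 1)))"
  proof (rule ccontr)
    assume "\<not> ?thesis"
    then have *: "{ereal (of_int d) | d :: int. d \<ge> -1 \<and> Hom_vanishes T U (U_le T V (- (d + 1)))} = {}"
      by blast
    then have "pw_dimension T U V = \<infinity>" unfolding pw_dimension_def * by simp
    with assms show False by contradiction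
  qed
  then show ?thesis using that by blast
qed

text \<open>Uncountability of the index type makes countable families small, so that bicontinuity
  covers the products and coproducts behind homotopy limits.\<close>

theorem theorem6p3:
  fixes T :: "('o, 'm, 'z) triangulated_category_scheme"
    and U V :: "'o set"
    and F :: "('o, 'm, 'o, 'm) fctr"
    and \<omega> \<eta> :: "'o \<Rightarrow> 'm"
  assumes universe: "uncountable (UNIV :: 'u set)"
    and triangulated: "triangulated_category T"
    and bicomplete: "bicomplete TYPE('u) T"
    and pre_weight: "pre_weight_structure T U V"
    and F_triangle: "is_triangle_functor T T F \<omega>"
    and F_bicontinuous: "bicontinuous TYPE('u) T T F"
    and cond1: "two_sided_convergent T U V" "pw_dimension T U V \<noteq> \<infinity>"
    and cond2: "\<And>n::int. n \<ge> 1 \<Longrightarrow> Hom_vanishes T (U \<inter> V) (shifted T (- n) (U \<inter> V))"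
    and cond3: "V \<subseteq> Loc TYPE('u) T (U_bounded T U V)" "U \<subseteq> coLoc TYPE('u) T (U_bounded T U V)"
    and cond4: "natural_iso_on T T (U \<inter> V) F id_functor \<eta>"
    and cond5: "fully_faithful_on T T (U_bounded T U V) F"
  shows "\<exists>G \<omega>'. pseudo_identity T U V G \<omega>' \<and> triangle_functors_isomorphic T T F \<omega> G \<omega>'"
proof -
  interpret triangulated_category T by (rule triangulated)
  interpret triangle_endofunctor T F \<omega> by unfold_locales (rule F_triangle)
  obtain d :: int where d: "Hom_vanishes T U (U_le T V (- (d + 1)))"
    using cond1(2) by (rule finite_dimension)
  interpret finite_dimension_setting T F \<omega> U V \<eta> "d + 1"
  proof unfold_locales
    show "hom0 X Y" if "X \<in> U" "Y \<in> shifted T (d + 1) V" for X Y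
      using d[unfolded Hom_vanishes_iff U_le_def minus_minus] that by blast
  qed (fact pre_weight cond1(1) cond2 cond4 bicontinuous_nat[OF universe F_bicontinuous])+
  have ff: "ff X Y" for X Y
    by (rule FF_ff, rule FF_everywhere[OF F_bicontinuous cond3 cond5])
  \<comment> \<open>On the core the isomorphism must be \<open>\<eta>\<close> itself, so that
    conjugation fixes core morphisms; elsewhere any isomorphism will do.\<close>
  have "\<exists>\<theta>. src T \<theta> = Fo X \<and> tgt T \<theta> = X \<and> is_iso T \<theta> \<and> (X \<in> U \<inter> V \<longrightarrow> \<theta> = \<eta> X)" for X
  proof (cases "X \<in> U \<inter> V")
    case True
    then show ?thesis using nat_to_idD(1-3)[OF \<eta>_nat_to_id True] by blast
  next
    case False
    then show ?thesis using F_object_iso[of X] by metis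
  qed
  then obtain \<theta> where \<theta>: "\<And>X. src T (\<theta> X) = Fo X" "\<And>X. tgt T (\<theta> X) = X" "\<And>X. is_iso T (\<theta> X)"
    and core: "\<And>X. X \<in> U \<inter> V \<Longrightarrow> \<theta> X = \<eta> X"
    by metis
  interpret conjugated_functor T F \<omega> \<theta> by unfold_locales (fact \<theta>)+
  have "far conj_functor f = f" if f: "f \<in> Hom T A B" and A: "A \<in> U \<inter> V" "B \<in> U \<inter> V" for f A B
  proof -
    \<comment> \<open>Naturality of \<open>\<eta>\<close>, multiplied by the inverse of
      \<open>\<theta> A\<close>, says that the conjugate of F f is f.\<close>
    have "\<theta> B \<cdot>\<^bsub>T\<^esub> Fa f = f \<cdot>\<^bsub>T\<^esub> \<theta> A"
      using nat_to_idD(4)[OF \<eta>_nat_to_id, of f A B] f A core by simp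
    from cmp_reduce[OF this, of "arr_inv T (\<theta> A)"] show ?thesis
      using f by simp
  qed
  then have "pseudo_identity T U V conj_functor conj_connect"
    unfolding pseudo_identity_def
    using conj_functor_triangle conj_functor_equivalence[OF ff] conj_functor_simps(1)
    by blast
  then show ?thesis using conj_functor_isomorphic by blast
qed

end
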